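(* Let $n\geq 1$. Then $\operatorname{depth}(S_{n,2}/I(\mathcal{P}_{n,2}))=\operatorname{sdepth}(S_{n,2}/I(\mathcal{P}_{n,2}))=\left\lceil\frac{n}{3}\right\rceil$.
   Context: $K$ is a field. For a finite simple graph $G$ whose vertices are the variables of a polynomial ring over $K$, the edge ideal $I(G)$ is the squarefree monomial ideal generated by all products $uv$ with $\{u,v\}\in E(G)$. $P_n$ is the path on $n$ vertices ($P_1$ is a single vertex with no edges). The strong product $G_1\boxtimes G_2$ has vertex set $V(G_1)\times V(G_2)$, and two distinct vertices $(v_1,u_1),(v_2,u_2)$ are adjacent iff each coordinate pair is equal or adjacent ($v_1=v_2$ or $v_1v_2\in E(G_1)$, and $u_1=u_2$ or $u_1u_2\in E(G_2)$). Put $\mathcal{P}_{n,m}:=P_n\boxtimes P_m$, with vertices labelled by variables $x_{ij}$ ($1\le i\le n$, $1\le j\le m$), so that distinct $x_{ij},x_{kl}$ are adjacent iff $|i-k|\le 1$ and $|j-l|\le 1$. $S_{n,m}:=K[x_{ij}:1\le i\le n,\ 1\le j\le m]$. Depth is taken with respect to the graded maximal ideal generated by all the variables. Stanley depth: let $S=K[x_1,\dots,x_N]$ and $M$ a finitely generated $\mathbb{Z}^N$-graded $S$-module. A Stanley decomposition $\mathcal{D}$ of $M$ is a finite direct sum of $K$-vector spaces $M=\bigoplus_{i=1}^r w_iK[A_i]$ with $w_i\in M$ homogeneous, $A_i\subseteq\{x_1,\dots,x_N\}$, where $w_iK[A_i]$ (the $K$-span of all $w_iu$, $u$ a monomial in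 $K[A_i]$) is a free $K[A_i]$-module. $\operatorname{sdepth}(\mathcal{D})=\min_i|A_i|$ and $\operatorname{sdepth}(M)$ is the maximum of $\operatorname{sdepth}(\mathcal{D})$ over all Stanley decompositions $\mathcal{D}$ of $M$. *)

theory Defs
  imports Complex_Main "HOL-Library.Poly_Mapping" "HOL-Library.Extended_Nat" "HOL-Algebra.Module" "HOL-Algebra.QuotRing"
begin

section \<open>Polynomial rings\<close>

type_synonym ('v, 'k) mpoly = "('v \<Rightarrow>\<^sub>0 nat) \<Rightarrow>\<^sub>0 'k"

text \<open>The polynomial ring \<open>K[V]\<close>, as a subring of the ring of polynomials in all
  indeterminates of type \<open>'v\<close>. Arithmetic is that of the type class instance of
  \<^type>\<open>poly_mapping\<close>, i.e. convolution.\<close>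

definition mpoly_ring :: "'v set \<Rightarrow> ('v, 'k::field) mpoly ring" where
  "mpoly_ring V =
     \<lparr>carrier = {p. \<forall>m \<in> Poly_Mapping.keys p. Poly_Mapping.keys m \<subseteq> V},
      monoid.mult = (*), one = 1, zero = 0, add = (+)\<rparr>"

definition indet :: "'v \<Rightarrow> ('v, 'k::field) mpoly" where
  "indet v = Poly_Mapping.single (Poly_Mapping.single v 1) 1"

definition graded_max_ideal :: "'v set \<Rightarrow> ('v, 'k::field) mpoly set" where
  "graded_max_ideal V = genideal (mpoly_ring V) (indet ` V)"

text \<open>The multigrading by \<open>\<int>\<^sup>N\<close>. A degree not supported on \<open>V\<close>, or with
  a negative entry, has component \<open>{0}\<close>.\<close>

definition mpoly_component :: "'v set \<Rightarrow> ('v \<Rightarrow> int) \<Rightarrow> ('v, 'k::field) mpoly set" where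
  "mpoly_component V a =
     {p \<in> carrier (mpoly_ring V).
        \<forall>m \<in> Poly_Mapping.keys p. \<forall>v. int (Poly_Mapping.lookup m v) = a v}"

section \<open>The residue class ring as a module\<close>

definition quotient_module :: "('a, 'c) ring_scheme \<Rightarrow> 'a set \<Rightarrow> ('a, 'a set) module" where
  "quotient_module R I =
     ring.extend (R Quot I)
       (module.fields (\<lambda>r X. (I +>\<^bsub>R\<^esub> r) \<otimes>\<^bsub>R Quot I\<^esub> X))"

text \<open>For a monomial ideal \<open>I\<close> of \<open>K[V]\<close>, the grading that \<open>K[V]/I\<close> inherits
  from \<open>K[V]\<close>.\<close>

definition quotient_grading ::
    "'v set \<Rightarrow> ('v, 'k::field) mpoly set \<Rightarrow> ('v \<Rightarrow> int) \<Rightarrow> ('v, 'k) mpoly set set" where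
  "quotient_grading V I a = (\<lambda>p. I +>\<^bsub>mpoly_ring V\<^esub> p) ` mpoly_component V a"

section \<open>Depth\<close>

text \<open>The submodule \<open>(f\<^sub>1, \<dots>, f\<^sub>r)M\<close>.\<close>

definition seq_submodule :: "('a, 'm, 'c) module_scheme \<Rightarrow> 'a list \<Rightarrow> 'm set" where
  "seq_submodule M fs =
     {finsum M (\<lambda>j. fs ! j \<odot>\<^bsub>M\<^esub> x j) {..<length fs} | x. x \<in> {..<length fs} \<rightarrow> carrier M}"

text \<open>The second conjunct says that \<open>f\<^sub>i\<close> is not a zero divisor on
  \<open>M/(f\<^sub>1, \<dots>, f\<^sub>i\<^sub>-\<^sub>1)M\<close>.\<close>

definition regular_sequence ::
    "('a, 'd) ring_scheme \<Rightarrow> ('a, 'm, 'c) module_scheme \<Rightarrow> 'a list \<Rightarrow> bool" where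
  "regular_sequence R M fs \<longleftrightarrow>
     set fs \<subseteq> carrier R \<and>
     (\<forall>i<length fs. \<forall>x \<in> carrier M.
        fs ! i \<odot>\<^bsub>M\<^esub> x \<in> seq_submodule M (take i fs) \<longrightarrow> x \<in> seq_submodule M (take i fs)) \<and>
     seq_submodule M fs \<noteq> carrier M"

text \<open>The elements of a regular sequence need not be homogeneous.\<close>

definition depth ::
    "'v set \<Rightarrow> (('v, 'k::field) mpoly, 'm, 'c) module_scheme \<Rightarrow> enat" where
  "depth V M =
     Sup {enat (length fs) | fs.
            set fs \<subseteq> graded_max_ideal V \<and> regular_sequence (mpoly_ring V) M fs}"

section \<open>Stanley depth\<close>

text \<open>\<open>w K[A]\<close>, the span over \<open>K\<close> of all \<open>w u\<close> with \<open>u\<close> a monomial of \<open>K[A]\<close>.\<close>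

definition stanley_space ::
    "(('v, 'k::field) mpoly, 'm, 'c) module_scheme \<Rightarrow> 'm \<Rightarrow> 'v set \<Rightarrow> 'm set" where
  "stanley_space M w A = (\<lambda>f. f \<odot>\<^bsub>M\<^esub> w) ` carrier (mpoly_ring A)"

text \<open>A decomposition is a list of pairs \<open>(w, A)\<close>; \<open>gr a\<close> is the homogeneous component
  of \<open>M\<close> of degree \<open>a\<close>. The clause on \<open>f\<close> is freeness of \<open>w K[A]\<close> over \<open>K[A]\<close>,
  with basis \<open>w\<close>; it excludes \<open>w = 0\<close>. The last clause is directness of the sum:
  every element of \<open>M\<close> is a sum of elements of the summands in exactly one way.\<close>

definition stanley_decomposition ::
    "'v set \<Rightarrow> (('v \<Rightarrow> int) \<Rightarrow> 'm set) \<Rightarrow> (('v, 'k::field) mpoly, 'm, 'c) module_scheme \<Rightarrow>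
     ('m \<times> 'v set) list \<Rightarrow> bool" where
  "stanley_decomposition V gr M D \<longleftrightarrow>
     (\<forall>(w, A) \<in> set D.
        w \<in> carrier M \<and> (\<exists>a. w \<in> gr a) \<and>
        A \<subseteq> V \<and>
        (\<forall>f \<in> carrier (mpoly_ring A). f \<odot>\<^bsub>M\<^esub> w = \<zero>\<^bsub>M\<^esub> \<longrightarrow> f = 0)) \<and>
     (\<forall>x \<in> carrier M.
        \<exists>!y. y \<in> (\<Pi>\<^sub>E i\<in>{..<length D}. stanley_space M (fst (D ! i)) (snd (D ! i))) \<and>
             x = finsum M y {..<length D})"

definition sdepth_of :: "('m \<times> 'v set) list \<Rightarrow> enat" where
  "sdepth_of D = (INF (w, A) \<in> set D. enat (card A))"

definition sdepth ::
    "'v set \<Rightarrow> (('v \<Rightarrow> int) \<Rightarrow> 'm set) \<Rightarrow> (('v, 'k::field) mpoly, 'm, 'c) module_scheme \<Rightarrow> enat" where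
  "sdepth V gr M = Sup {sdepth_of D | D. stanley_decomposition V gr M D}"

section \<open>Graphs and edge ideals\<close>

record 'v graph =
  verts :: "'v set"
  edges :: "'v set set"

definition path_graph :: "nat \<Rightarrow> nat graph" where
  "path_graph n = \<lparr>verts = {1..n}, edges = {{i, i + 1} | i. 1 \<le> i \<and> i < n}\<rparr>"

definition strong_product :: "'a graph \<Rightarrow> 'b graph \<Rightarrow> ('a \<times> 'b) graph" (infixl \<open>\<boxtimes>\<close> 70) where
  "G \<boxtimes> H =
     \<lparr>verts = verts G \<times> verts H,
      edges = {{(v1, u1), (v2, u2)} | v1 u1 v2 u2.
        v1 \<in> verts G \<and> v2 \<in> verts G \<and> u1 \<in> verts H \<and> u2 \<in> verts H \<and>
        (v1, u1) \<noteq> (v2, u2) \<and>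
        (v1 = v2 \<or> {v1, v2} \<in> edges G) \<and> (u1 = u2 \<or> {u1, u2} \<in> edges H)}\<rparr>"

definition strong_grid :: "nat \<Rightarrow> nat \<Rightarrow> (nat \<times> nat) graph" where
  "strong_grid n m = path_graph n \<boxtimes> path_graph m"

text \<open>The vertices of the graph serve as the indeterminates.\<close>

definition edge_ideal :: "'v graph \<Rightarrow> ('v, 'k::field) mpoly set" where
  "edge_ideal G =
     genideal (mpoly_ring (verts G)) {indet u * indet v | u v. {u, v} \<in> edges G}"

section \<open>Well-definedness\<close>

lemma mpoly_ring_cring: "cring (mpoly_ring V :: ('v, 'k::field) mpoly ring)"
proof -
  let ?C = "{p :: ('v, 'k) mpoly. \<forall>m \<in> Poly_Mapping.keys p. Poly_Mapping.keys m \<subseteq> V}"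
  have add: "p + q \<in> ?C" if "p \<in> ?C" "q \<in> ?C" for p q
    using that Poly_Mapping.keys_add[of p q] by blast
  have mult: "p * q \<in> ?C" if "p \<in> ?C" "q \<in> ?C" for p q
  proof (intro CollectI ballI)
    fix m assume "m \<in> Poly_Mapping.keys (p * q)"
    then obtain a b where "m = a + b" "a \<in> Poly_Mapping.keys p" "b \<in> Poly_Mapping.keys q"
      using keys_mult[of p q] by blast
    then show "Poly_Mapping.keys m \<subseteq> V"
      using that Poly_Mapping.keys_add[of a b] by blast
  qed
  have neg: "- p \<in> ?C" if "p \<in> ?C" for p
    using that by simp
  have one: "1 \<in> ?C" and zero: "0 \<in> ?C" by simp_all
  have R: "carrier (mpoly_ring V) = ?C"
    "monoid.mult (mpoly_ring V :: ('v, 'k) mpoly ring) = (*)"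
    "monoid.one (mpoly_ring V :: ('v, 'k) mpoly ring) = 1"
    "ring.zero (mpoly_ring V :: ('v, 'k) mpoly ring) = 0"
    "ring.add (mpoly_ring V :: ('v, 'k) mpoly ring) = (+)"
    by (simp_all add: mpoly_ring_def)
  show ?thesis
  proof (rule cringI)
    show "abelian_group (mpoly_ring V :: ('v, 'k) mpoly ring)"
    proof (rule abelian_groupI)
      fix x :: "('v, 'k) mpoly" assume "x \<in> carrier (mpoly_ring V)"
      then show "\<exists>y\<in>carrier (mpoly_ring V). y \<oplus>\<^bsub>mpoly_ring V\<^esub> x = \<zero>\<^bsub>mpoly_ring V\<^esub>"
        unfolding R using neg by (intro bexI[of _ "- x"]) (simp_all only: left_minus)
    qed (unfold R, fact add, fact zero, simp_all only: ac_simps add_0_left add_0_right)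
    show "Group.comm_monoid (mpoly_ring V :: ('v, 'k) mpoly ring)"
    proof (rule comm_monoidI)
    qed (unfold R, fact mult, fact one, simp_all only: ac_simps mult_1_left mult_1_right)
  qed (simp only: R distrib_right)
qed

lemma edge_ideal_ideal:
  assumes "\<And>e. e \<in> edges G \<Longrightarrow> e \<subseteq> verts G"
  shows "ideal (edge_ideal G) (mpoly_ring (verts G) :: ('v, 'k::field) mpoly ring)"
proof -
  let ?R = "mpoly_ring (verts G) :: ('v, 'k) mpoly ring"
  interpret R: cring ?R by (rule mpoly_ring_cring)
  have indet: "indet v \<in> carrier ?R" if "v \<in> verts G" for v
    using that by (simp add: mpoly_ring_def indet_def)
  have "indet u * indet v \<in> carrier ?R" if "{u, v} \<in> edges G" for u v
  proof -
    have "indet u \<otimes>\<^bsub>?R\<^esub> indet v \<in> carrier ?R"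
      using assms[OF that] by (intro R.m_closed indet) auto
    then show ?thesis by (simp add: mpoly_ring_def)
  qed
  then show ?thesis
    unfolding edge_ideal_def by (intro R.genideal_ideal) blast
qed

lemma strong_grid_edges: "e \<in> edges (strong_grid n m) \<Longrightarrow> e \<subseteq> verts (strong_grid n m)"
  by (auto simp: strong_grid_def strong_product_def)

lemma quotient_module_module:
  assumes "cring R" "ideal I R"
  shows "module R (quotient_module R I)"
proof -
  interpret R: cring R by fact
  interpret I: ideal I R by fact
  interpret Q: cring "R Quot I" by (rule I.quotient_is_cring[OF assms(1)])
  have hom: "(\<lambda>r. I +>\<^bsub>R\<^esub> r) \<in> ring_hom R (R Quot I)"
    by (rule I.rcos_ring_hom)
  have Qm: "carrier (quotient_module R I) = carrier (R Quot I)"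
    "add (quotient_module R I) = add (R Quot I)"
    "zero (quotient_module R I) = zero (R Quot I)"
    "smult (quotient_module R I) = (\<lambda>r X. (I +>\<^bsub>R\<^esub> r) \<otimes>\<^bsub>R Quot I\<^esub> X)"
    by (simp_all add: quotient_module_def ring.defs module.defs)
  note closed = ring_hom_closed[OF hom]
  show ?thesis
  proof (rule moduleI)
    show "cring R" by fact
    show "abelian_group (quotient_module R I)"
    proof (rule abelian_groupI)
      fix x assume "x \<in> carrier (quotient_module R I)"
      then show "\<exists>y\<in>carrier (quotient_module R I).
          y \<oplus>\<^bsub>quotient_module R I\<^esub> x = \<zero>\<^bsub>quotient_module R I\<^esub>"
        unfolding Qm using Q.l_neg Q.a_inv_closed by blast
    qed (simp_all only: Qm Q.a_closed Q.zero_closed Q.a_assoc Q.l_zero, rule Q.a_comm)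
  next
    fix a x assume "a \<in> carrier R" "x \<in> carrier (quotient_module R I)"
    then show "a \<odot>\<^bsub>quotient_module R I\<^esub> x \<in> carrier (quotient_module R I)"
      unfolding Qm by (intro Q.m_closed closed)
  next
    fix a b x assume "a \<in> carrier R" "b \<in> carrier R" "x \<in> carrier (quotient_module R I)"
    then show "(a \<oplus>\<^bsub>R\<^esub> b) \<odot>\<^bsub>quotient_module R I\<^esub> x =
        (a \<odot>\<^bsub>quotient_module R I\<^esub> x) \<oplus>\<^bsub>quotient_module R I\<^esub> (b \<odot>\<^bsub>quotient_module R I\<^esub> x)"
      unfolding Qm by (simp only: ring_hom_add[OF hom] Q.l_distr closed)
  next
    fix a x y assume "a \<in> carrier R" "x \<in> carrier (quotient_module R I)"
      "y \<in> carrier (quotient_module R I)"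
    then show "a \<odot>\<^bsub>quotient_module R I\<^esub> (x \<oplus>\<^bsub>quotient_module R I\<^esub> y) =
        (a \<odot>\<^bsub>quotient_module R I\<^esub> x) \<oplus>\<^bsub>quotient_module R I\<^esub> (a \<odot>\<^bsub>quotient_module R I\<^esub> y)"
      unfolding Qm by (simp only: Q.r_distr closed)
  next
    fix a b x assume "a \<in> carrier R" "b \<in> carrier R" "x \<in> carrier (quotient_module R I)"
    then show "(a \<otimes>\<^bsub>R\<^esub> b) \<odot>\<^bsub>quotient_module R I\<^esub> x =
        a \<odot>\<^bsub>quotient_module R I\<^esub> (b \<odot>\<^bsub>quotient_module R I\<^esub> x)"
      unfolding Qm by (simp only: ring_hom_mult[OF hom] Q.m_assoc closed)
  next
    fix x assume "x \<in> carrier (quotient_module R I)"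
    then show "\<one>\<^bsub>R\<^esub> \<odot>\<^bsub>quotient_module R I\<^esub> x = x"
      unfolding Qm by (simp only: ring_hom_one[OF hom] Q.l_one)
  qed
qed

end

theory Submission
  imports Defs "HOL-Library.Product_Lexorder"
begin

text \<open>
  Let \<open>S/I\<close> be the residue class ring of the edge ideal of any finite simple graph, let \<open>F\<close> be a
  maximal independent set, and let \<open>c\<^sub>0, \<dots>, c\<^sub>r\<^sub>-\<^sub>1\<close> be vertices with pairwise disjoint closed
  neighbourhoods. Then both depth and Stanley depth of \<open>S/I\<close> lie between \<open>r\<close> and \<open>|F|\<close>. In the
  strong product of \<open>P\<^sub>n\<close> and \<open>P\<^sub>2\<close> the vertices \<open>(1,1), (4,1), (7,1), \<dots>\<close> have disjoint closed
  neighbourhoods, and \<open>(2,1), (5,1), (8,1), \<dots>\<close>, with the last column cut off at \<open>n\<close>, is a maximal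
  independent set. Both lists have \<open>\<lceil>n/3\<rceil>\<close> members, so the two bounds meet.

  Upper bounds. Let \<open>u\<close> be the product of the variables in \<open>F\<close>. As \<open>F\<close> is maximal, a monomial kills
  \<open>u\<close> modulo \<open>I\<close> exactly when it involves a variable outside \<open>F\<close>; hence the submodule generated by
  \<open>u\<close> is a copy of \<open>K[F]\<close>. In a Stanley decomposition, \<open>u\<close> occurs in some \<open>w K[A]\<close>; as this is free,
  no variable in \<open>A\<close> kills \<open>u\<close>, so \<open>A \<subseteq> F\<close> (\<open>sdepth_le_card_maximal_independent\<close>). For depth, a
  regular sequence \<open>f\<^sub>1, \<dots>, f\<^sub>r\<close> is quasi-regular (\<open>nonzero_form_cancel\<close>): the associated graded
  module of its ideal is a polynomial ring. Consequently no nonzero polynomial in the \<open>f\<^sub>i\<close> with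
  coefficients in \<open>K\<close> kills an element that lies outside some power of the ideal
  (\<open>regular_sequence_independent\<close>). But if \<open>r > |F|\<close>, the images of the \<open>f\<^sub>i\<close> in \<open>K[F]\<close> satisfy a
  polynomial relation, by counting monomials, and the relation kills \<open>u\<close>
  (\<open>depth_le_card_maximal_independent\<close>).

  Lower bounds. Let \<open>C\<close> be the set of the \<open>c\<^sub>j\<close>, and sort the monomials outside \<open>I\<close> by their core
  \<open>W\<close>, the set of their variables that are not in \<open>C\<close>. The monomials with core \<open>W\<close> are those of
  \<open>x\<^sup>W K[A]\<close>, where \<open>A\<close> consists of \<open>W\<close> and of the \<open>c\<^sub>j\<close> without a neighbour in \<open>W\<close>. So \<open>A\<close> meets
  each of the \<open>r\<close> disjoint closed neighbourhoods. These spaces form a Stanley decomposition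
  (\<open>cell_stanley_decomposition\<close>), which bounds the Stanley depth from below. They also show that the
  sums \<open>\<theta>\<^sub>j\<close> of the variables in the closed neighbourhood of \<open>c\<^sub>j\<close> form a regular sequence: up to
  monomials that are smaller in a suitable order, \<open>\<theta>\<^sub>j\<close> multiplies a monomial with core \<open>W\<close> by one
  variable that depends only on \<open>j\<close> and \<open>W\<close>, and a sequence that is triangular in this sense is
  regular (\<open>triangular_regular\<close>).
\<close>

section \<open>Powers of the ideal of a sequence\<close>

locale ring_with_ideal =
  fixes S I :: "'a::comm_ring_1 set"
  assumes one_S: "1 \<in> S"
    and diff_S: "x \<in> S \<Longrightarrow> y \<in> S \<Longrightarrow> x - y \<in> S"
    and mult_S: "x \<in> S \<Longrightarrow> y \<in> S \<Longrightarrow> x * y \<in> S"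
    and I_subset: "I \<subseteq> S"
    and zero_I: "0 \<in> I"
    and diff_I: "x \<in> I \<Longrightarrow> y \<in> I \<Longrightarrow> x - y \<in> I"
    and mult_I: "s \<in> S \<Longrightarrow> x \<in> I \<Longrightarrow> s * x \<in> I"
begin

definition ideal_above :: "'a set \<Rightarrow> bool" where
  "ideal_above L \<longleftrightarrow> I \<subseteq> L \<and> L \<subseteq> S \<and> (\<forall>x\<in>L. \<forall>y\<in>L. x - y \<in> L) \<and> (\<forall>s\<in>S. \<forall>x\<in>L. s * x \<in> L)"

lemma aboveD:
  assumes "ideal_above L"
  shows "x \<in> I \<Longrightarrow> x \<in> L" "x \<in> L \<Longrightarrow> x \<in> S" "x \<in> L \<Longrightarrow> y \<in> L \<Longrightarrow> x - y \<in> L"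
    "s \<in> S \<Longrightarrow> x \<in> L \<Longrightarrow> s * x \<in> L" "0 \<in> L" "x \<in> L \<Longrightarrow> - x \<in> L"
    "x \<in> L \<Longrightarrow> y \<in> L \<Longrightarrow> x + y \<in> L"
proof -
  show sub: "x \<in> I \<Longrightarrow> x \<in> L" "x \<in> L \<Longrightarrow> x \<in> S" "s \<in> S \<Longrightarrow> x \<in> L \<Longrightarrow> s * x \<in> L" for x s
    using assms unfolding ideal_above_def by blast+
  show diff: "x \<in> L \<Longrightarrow> y \<in> L \<Longrightarrow> x - y \<in> L" for x y
    using assms unfolding ideal_above_def by blast
  show zero: "0 \<in> L" using sub(1)[OF zero_I] .
  show neg: "x \<in> L \<Longrightarrow> - x \<in> L" for x using diff[OF zero, of x] by simp
  show "x \<in> L \<Longrightarrow> y \<in> L \<Longrightarrow> x + y \<in> L" using diff[of x "- y"] neg[of y] by simp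
qed

lemma above_S: "ideal_above S"
  using I_subset diff_S mult_S unfolding ideal_above_def by blast

lemma above_I: "ideal_above I"
  using I_subset diff_I mult_I unfolding ideal_above_def by blast

lemmas S_closed = aboveD(5-7)[OF above_S]

lemma sum_in_above:
  assumes "ideal_above L" "\<And>x. x \<in> A \<Longrightarrow> h x \<in> L"
  shows "sum h A \<in> L"
  using assms(2) by (induction A rule: infinite_finite_induct) (auto intro: aboveD(5,7)[OF assms(1)])

end

locale ring_sequence = ring_with_ideal +
  fixes f :: "nat \<Rightarrow> 'a"
  assumes f_S: "f i \<in> S"
begin

text \<open>With \<open>J\<close> the ideal generated by \<open>f\<^sub>0, \<dots>, f\<^sub>i\<^sub>-\<^sub>1\<close> and \<open>L\<close> an ideal that contains \<open>I\<close>, this is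
\<open>J^k L + I\<close>. The recursion sorts the products of \<open>k + 1\<close> of the generators by whether they involve
the last one, so that inductions over it need no exponent vectors.\<close>

fun adic :: "nat \<Rightarrow> nat \<Rightarrow> 'a set \<Rightarrow> 'a set" where
  "adic i 0 L = L"
| "adic 0 (Suc k) L = I"
| "adic (Suc i) (Suc k) L = {f i * a + b | a b. a \<in> adic (Suc i) k L \<and> b \<in> adic i (Suc k) L}"

abbreviation partial_ideal :: "nat \<Rightarrow> 'a set" where
  "partial_ideal i \<equiv> adic i 1 S"

lemma adicE:
  assumes "x \<in> adic (Suc i) (Suc k) L"
  obtains a b where "x = f i * a + b" "a \<in> adic (Suc i) k L" "b \<in> adic i (Suc k) L"
  using assms by auto

lemma above_adic:
  assumes "ideal_above L" shows "ideal_above (adic i k L)"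
  using assms
proof (induction i k L rule: adic.induct)
  case (2 k L)
  then show ?case by (simp add: above_I)
next
  case (3 i k L)
  note A = aboveD[OF 3(1)[OF 3(3)]] and B = aboveD[OF 3(2)[OF 3(3)]]
  let ?T = "adic (Suc i) (Suc k) L"
  have mem: "f i * a + b \<in> ?T" if "a \<in> adic (Suc i) k L" "b \<in> adic i (Suc k) L" for a b
    using that by auto
  show ?case unfolding ideal_above_def
  proof (intro conjI ballI subsetI)
    fix x assume "x \<in> I"
    then show "x \<in> ?T" using mem[OF A(5) B(1)] by fastforce
  next
    fix x assume "x \<in> ?T"
    then obtain a b where x: "x = f i * a + b" "a \<in> adic (Suc i) k L" "b \<in> adic i (Suc k) L"
      by (rule adicE)
    show "x \<in> S" unfolding x(1) by (intro S_closed mult_S f_S A(2) B(2) x)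
    fix s assume s: "s \<in> S"
    have "s * x = f i * (s * a) + s * b" unfolding x(1) by (simp add: algebra_simps)
    then show "s * x \<in> ?T" using mem[OF A(4)[OF s x(2)] B(4)[OF s x(3)]] by simp
  next
    fix x y assume "x \<in> ?T" "y \<in> ?T"
    obtain a b where x: "x = f i * a + b" "a \<in> adic (Suc i) k L" "b \<in> adic i (Suc k) L"
      using \<open>x \<in> ?T\<close> by (rule adicE)
    obtain c d where y: "y = f i * c + d" "c \<in> adic (Suc i) k L" "d \<in> adic i (Suc k) L"
      using \<open>y \<in> ?T\<close> by (rule adicE)
    have "x - y = f i * (a - c) + (b - d)" unfolding x y by (simp add: algebra_simps)
    then show "x - y \<in> ?T" using mem[OF A(3)[OF x(2) y(2)] B(3)[OF x(3) y(3)]] by simp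
  qed
qed simp

lemma adic_mono: "L \<subseteq> L' \<Longrightarrow> adic i k L \<subseteq> adic i k L'"
proof (induction i k L rule: adic.induct)
  case (3 i k L)
  then show ?case by fastforce
qed auto

lemma adic_Suc_index: "ideal_above L \<Longrightarrow> adic i k L \<subseteq> adic (Suc i) k L"
proof (cases k)
  case (Suc l)
  assume "ideal_above L"
  then have "0 \<in> adic (Suc i) l L" by (rule aboveD(5)[OF above_adic])
  then show ?thesis unfolding Suc by force
qed simp

lemma adic_mult_f: "ideal_above L \<Longrightarrow> j < i \<Longrightarrow> x \<in> adic i k L \<Longrightarrow> f j * x \<in> adic i (Suc k) L"
proof (induction i arbitrary: k x)
  case (Suc i)
  show ?case
  proof (cases "j = i")
    case True
    have "0 \<in> adic i (Suc k) L" using above_adic[OF Suc(2)] by (rule aboveD)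
    then show ?thesis using Suc True by force
  next
    case False
    then have ji: "j < i" using Suc by simp
    show ?thesis using Suc(4)
    proof (induction k arbitrary: x)
      case 0
      then show ?case using Suc.IH[OF Suc(2) ji, of x 0] adic_Suc_index[OF Suc(2), of i 1] by auto
    next
      case k: (Suc k)
      obtain a b where x: "x = f i * a + b" "a \<in> adic (Suc i) k L" "b \<in> adic i (Suc k) L"
        using k(2) by (rule adicE)
      have "f j * x = f i * (f j * a) + f j * b" unfolding x by (simp add: algebra_simps)
      then show ?case using k(1)[OF x(2)] Suc.IH[OF Suc(2) ji x(3)] by auto
    qed
  qed
qed simp

lemma adic_decreasing: "ideal_above L \<Longrightarrow> adic i (Suc k) L \<subseteq> adic i k L"
proof (induction i k L rule: adic.induct)
  case (1 i L)
  show ?case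
  proof (induction i)
    case 0 then show ?case using 1 by (auto dest: aboveD)
  next
    case (Suc i)
    then show ?case using aboveD(4,7)[OF 1] f_S by auto
  qed
next
  case (3 i k L)
  show ?case
  proof
    fix x assume "x \<in> adic (Suc i) (Suc (Suc k)) L"
    then obtain a b where x: "x = f i * a + b" "a \<in> adic (Suc i) (Suc k) L" "b \<in> adic i (Suc (Suc k)) L"
      by (rule adicE)
    then have "a \<in> adic (Suc i) k L" "b \<in> adic i (Suc k) L" using 3 by blast+
    then show "x \<in> adic (Suc i) (Suc k) L" using x(1) by auto
  qed
qed auto

lemma adic_scale: "ideal_above L \<Longrightarrow> y \<in> L \<Longrightarrow> x \<in> adic i k S \<Longrightarrow> y * x \<in> adic i k L"
proof (induction k arbitrary: i x)
  case 0
  then show ?case using aboveD(4)[of L x y] by (simp add: mult.commute)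
next
  case (Suc k)
  show ?case using Suc(4)
  proof (induction i arbitrary: x)
    case 0
    then show ?case using mult_I[of y x] aboveD(2) Suc.prems by simp
  next
    case i: (Suc i)
    obtain a b where x: "x = f i * a + b" "a \<in> adic (Suc i) k S" "b \<in> adic i (Suc k) S"
      using i(2) by (rule adicE)
    have "y * x = f i * (y * a) + y * b" unfolding x by (simp add: algebra_simps)
    then show ?case using Suc.IH[OF Suc(2,3) x(2)] i(1)[OF x(3)] by auto
  qed
qed

text \<open>One factor of \<open>J^(k+1)\<close> can be absorbed by \<open>L\<close> as soon as \<open>J \<subseteq> L\<close>. For \<open>L = J\<close> the
next lemma is the converse, and both together identify \<open>J^k J\<close> with \<open>J^(k+1)\<close>.\<close>

lemma adic_Suc_subset: "ideal_above L \<Longrightarrow> partial_ideal i \<subseteq> L \<Longrightarrow> adic i (Suc k) S \<subseteq> adic i k L"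
proof (induction i k L rule: adic.induct)
  case (3 i k L)
  have "partial_ideal i \<subseteq> L" using 3(4) adic_Suc_index[OF above_S, of i 1] by blast
  then have "adic i (Suc (Suc k)) S \<subseteq> adic i (Suc k) L" "adic (Suc i) (Suc k) S \<subseteq> adic (Suc i) k L"
    using 3 by auto
  then show ?case
    by (subst (1 2) adic.simps) blast
qed auto

lemma adic_subset_Suc: "ideal_above L \<Longrightarrow> L \<subseteq> partial_ideal j \<Longrightarrow> i \<le> j \<Longrightarrow> adic i k L \<subseteq> adic j (Suc k) S"
proof (induction i k L rule: adic.induct)
  case (2 k L)
  then show ?case using aboveD(1)[OF above_adic[OF above_S]] by auto
next
  case (3 i k L)
  show ?case
  proof
    fix x assume "x \<in> adic (Suc i) (Suc k) L"
    then obtain a b where x: "x = f i * a + b" "a \<in> adic (Suc i) k L" "b \<in> adic i (Suc k) L"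
      by (rule adicE)
    have "a \<in> adic j (Suc k) S" "b \<in> adic j (Suc (Suc k)) S" using 3 x by auto
    then show "x \<in> adic j (Suc (Suc k)) S" unfolding x(1)
      using adic_mult_f[OF above_S, of i j a "Suc k"] 3(5) aboveD(7)[OF above_adic[OF above_S]]
      by auto
  qed
qed auto

lemma adic_mult:
  "ideal_above L \<Longrightarrow> y \<in> adic i k S \<Longrightarrow> x \<in> adic i t L \<Longrightarrow> y * x \<in> adic i (t + k) L"
proof (induction i arbitrary: k t x y)
  case 0
  show ?case
  proof (cases k)
    case k: 0
    then show ?thesis using "0.prems" aboveD(4)[OF above_adic[OF "0.prems"(1)]] by simp
  next
    case (Suc l)
    then have "x * y \<in> I" using "0.prems" mult_I[of x y] aboveD(2)[OF above_adic[OF "0.prems"(1)], of x 0 t] by simp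
    then show ?thesis using Suc by (simp add: mult.commute)
  qed
next
  case (Suc i)
  note ab = above_adic[OF Suc.prems(1)]
  have *: "b * x \<in> adic (Suc i) (t + k) L" if "b \<in> adic i k S" "x \<in> adic (Suc i) t L" for b x t k
    using that(2)
  proof (induction t arbitrary: x)
    case 0
    then show ?case using adic_scale[OF Suc.prems(1), of x b i k] that(1)
      adic_Suc_index[OF Suc.prems(1), of i k] by (auto simp: mult.commute)
  next
    case t: (Suc t)
    obtain c d where x: "x = f i * c + d" "c \<in> adic (Suc i) t L" "d \<in> adic i (Suc t) L"
      using t(2) by (rule adicE)
    have "b * x = f i * (b * c) + b * d" unfolding x by (simp add: algebra_simps)
    then show ?case using t(1)[OF x(2)] Suc.IH[OF Suc.prems(1) that(1) x(3)] by auto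
  qed
  show ?case using Suc(3)
  proof (induction k arbitrary: y)
    case 0
    then show ?case using Suc(4) aboveD(4)[OF ab] by simp
  next
    case k: (Suc k)
    obtain a b where y: "y = f i * a + b" "a \<in> adic (Suc i) k S" "b \<in> adic i (Suc k) S"
      using k(2) by (rule adicE)
    have "y * x = f i * (a * x) + b * x" unfolding y by (simp add: algebra_simps)
    moreover have "f i * (a * x) \<in> adic (Suc i) (Suc (t + k)) L"
      by (rule adic_mult_f[OF Suc.prems(1)]) (use k(1)[OF y(2)] in auto)
    moreover have "b * x \<in> adic (Suc i) (t + Suc k) L" using *[OF y(3) Suc(4)] .
    ultimately show ?case using aboveD(7)[OF ab] by (metis add_Suc_right)
  qed
qed

text \<open>The values at \<open>f\<^sub>0, \<dots>, f\<^sub>i\<^sub>-\<^sub>1\<close> of forms of degree \<open>k\<close> that do not vanish modulo \<open>L\<close>. What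
counts is the form, not its value: in the last variable it is \<open>T G' + G''\<close>, and either \<open>G''\<close> is
again such a form and \<open>G'\<close> is arbitrary, or \<open>G''\<close> is zero and \<open>G'\<close> is such a form. A coefficient
has to be a nonzerodivisor modulo \<open>L\<close>. This covers nonzero scalars as well as, for \<open>k = 0\<close>, the
next element of a regular sequence.\<close>

fun nonzero_form :: "'a set \<Rightarrow> nat \<Rightarrow> nat \<Rightarrow> 'a \<Rightarrow> bool" where
  "nonzero_form L i 0 g \<longleftrightarrow> g \<in> S \<and> (\<forall>x\<in>S. g * x \<in> L \<longrightarrow> x \<in> L)"
| "nonzero_form L 0 (Suc k) g \<longleftrightarrow> False"
| "nonzero_form L (Suc i) (Suc k) g \<longleftrightarrow>
     (\<exists>a b. g = f i * a + b \<and> a \<in> adic (Suc i) k S \<and> nonzero_form L i (Suc k) b) \<or>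
     (\<exists>a. g = f i * a \<and> nonzero_form L (Suc i) k a)"

lemma nonzero_form_adic: "nonzero_form L i k g \<Longrightarrow> g \<in> adic i k S"
proof (induction L i k g rule: nonzero_form.induct)
  case (3 L i k g)
  then show ?case using aboveD(5)[OF above_adic[OF above_S], of i "Suc k"]
    by simp (metis add_0_right)
qed auto

lemma adic_Suc_subset_Suc_index:
  assumes "ideal_above L" "partial_ideal (Suc i) \<subseteq> L" "c \<in> adic i (Suc m) S"
  shows "c \<in> adic (Suc i) m L"
  using assms(3) adic_Suc_index[OF above_S, of i "Suc m"] adic_Suc_subset[OF assms(1,2), of m] by blast

text \<open>The step from \<open>i\<close> to \<open>i + 1\<close> for a form \<open>f\<^sub>i e + h\<close> whose part \<open>h\<close> without \<open>f\<^sub>i\<close> is a nonzero form.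
If \<open>x = f\<^sub>i a + b\<close>, then the product with \<open>x\<close> is \<open>h b\<close> plus a multiple of \<open>f\<^sub>i\<close>. As \<open>f\<^sub>i\<close> is
regular modulo the powers for the index \<open>i\<close>, the term \<open>h b\<close> can be isolated, which settles \<open>b\<close> by
the hypothesis on \<open>h\<close>; what remains is the same statement for \<open>a\<close> and a smaller \<open>t\<close>.\<close>

lemma nonzero_form_cancel_step:
  assumes L: "ideal_above L" "partial_ideal (Suc i) \<subseteq> L"
    and reg: "\<And>x k. x \<in> S \<Longrightarrow> f i * x \<in> adic i k S \<Longrightarrow> x \<in> adic i k S"
    and IH: "\<And>x t. x \<in> adic i t S \<Longrightarrow> h * x \<in> adic i (t + k) L \<Longrightarrow> x \<in> adic i t L"
    and h: "h \<in> adic i k S"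
    and e: "e \<in> adic (Suc i) (k - 1) S" "k = 0 \<longrightarrow> e = 0"
    and x: "x \<in> adic (Suc i) t S" "(f i * e + h) * x \<in> adic (Suc i) (t + k) L"
  shows "x \<in> adic (Suc i) t L"
proof -
  note ab = aboveD[OF above_adic[OF L(1)]] and abS = aboveD[OF above_adic[OF above_S]]
  have fL: "f i \<in> L"
  proof -
    have "f i * 1 \<in> partial_ideal (Suc i)"
      using adic_mult_f[OF above_S, of i "Suc i" 1 0] one_S by simp
    then show ?thesis using L(2) by auto
  qed
  have LS: "L \<subseteq> S" using aboveD(2)[OF L(1)] by blast
  show ?thesis using x
  proof (induction t arbitrary: x)
    case 0
    show ?case
    proof (cases k)
      case 0
      then show ?thesis using IH[of x 0] "0.prems" e by simp
    next
      case (Suc l)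
      obtain a' b' where ab': "(f i * e + h) * x = f i * a' + b'" "a' \<in> adic (Suc i) l L" "b' \<in> adic i (Suc l) L"
        using "0.prems"(2) unfolding Suc add_0 by (rule adicE)
      have xS: "x \<in> S" using 0 by simp
      \<comment> \<open>Of the two expressions for the product, \<open>c\<close> is the
        difference of the cofactors of \<open>f\<^sub>i\<close>.\<close>
      define c where "c = e * x - a'"
      have eq: "f i * c = b' - h * x" using ab'(1) by (simp add: c_def algebra_simps)
      have "h * x \<in> adic i k S" using abS(4)[OF xS h] by (simp add: mult.commute)
      then have "f i * c \<in> adic i k S"
        unfolding eq using subsetD[OF adic_mono[OF LS] ab'(3)] Suc by (intro abS(3)) simp_all
      moreover have "c \<in> S" unfolding c_def
        using abS(2)[OF e(1)] xS ab(2)[OF ab'(2)] by (intro diff_S mult_S)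
      ultimately have "c \<in> adic i k S" using reg by blast
      then have "f i * c \<in> adic i k L" by (rule adic_scale[OF L(1) fL])
      then have "b' - f i * c \<in> adic i k L" using ab'(3) Suc by (intro ab(3)) simp_all
      then have "h * x \<in> adic i k L" using eq by simp
      then show ?thesis using IH[of x 0] xS by simp
    qed
  next
    case (Suc t)
    obtain a b where x: "x = f i * a + b" "a \<in> adic (Suc i) t S" "b \<in> adic i (Suc t) S"
      using Suc.prems(1) by (rule adicE)
    obtain a' b' where ab': "(f i * e + h) * x = f i * a' + b'" "a' \<in> adic (Suc i) (t + k) L"
      "b' \<in> adic i (Suc (t + k)) L"
      using Suc.prems(2) unfolding add_Suc by (rule adicE)
    have xS: "x \<in> S" using abS(2)[OF Suc.prems(1)] .
    define c where "c = e * x + h * a - a'"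
    have eq: "f i * c = b' - h * b" using ab'(1) unfolding c_def x(1) by (simp add: algebra_simps)
    have "h * b \<in> adic i (Suc t + k) S" by (rule adic_mult[OF above_S h x(3)])
    then have "f i * c \<in> adic i (Suc (t + k)) S"
      unfolding eq using subsetD[OF adic_mono[OF LS] ab'(3)] by (intro abS(3)) simp_all
    moreover have "c \<in> S" unfolding c_def
      using abS(2)[OF e(1)] xS ab(2)[OF ab'(2)] abS(2)[OF h] abS(2)[OF x(2)]
      by (intro diff_S mult_S S_closed)
    ultimately have c: "c \<in> adic i (Suc (t + k)) S" using reg by blast
    then have "f i * c \<in> adic i (Suc (t + k)) L" by (rule adic_scale[OF L(1) fL])
    then have "b' - f i * c \<in> adic i (Suc (t + k)) L" using ab'(3) by (intro ab(3)) simp_all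
    then have "h * b \<in> adic i (Suc t + k) L" using eq by simp
    then have b: "b \<in> adic i (Suc t) L" by (rule IH[OF x(3)])
    have eb: "e * b \<in> adic (Suc i) (t + k) L"
    proof (cases k)
      case 0 then show ?thesis using e(2) ab(5) by simp
    next
      case (Suc l)
      have "b \<in> adic (Suc i) (Suc t) L" using b adic_Suc_index[OF L(1)] by blast
      then show ?thesis using adic_mult[OF L(1) e(1)] Suc by fastforce
    qed
    have "(f i * e + h) * a = a' + c - e * b" unfolding c_def x(1) by (simp add: algebra_simps)
    then have "(f i * e + h) * a \<in> adic (Suc i) (t + k) L"
      using ab(3)[OF ab(7)[OF ab'(2) adic_Suc_subset_Suc_index[OF L c]] eb] by (simp only:)
    then have "a \<in> adic (Suc i) t L" by (rule Suc.IH[OF x(2)])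
    then show ?case unfolding x(1) adic.simps using b by blast
  qed
qed

text \<open>Regular sequences are quasi-regular: multiplication by a nonzero form of degree \<open>k\<close> is injective
from \<open>J^t/J^t L\<close> to \<open>J^(t+k)/J^(t+k) L\<close>. For \<open>L = J\<close> this says that the associated graded module
is a polynomial ring over \<open>S/J\<close>. In the induction on \<open>i\<close>, the case of the form \<open>f\<^sub>i\<close> of degree
zero and \<open>L = J\<close> shows that \<open>f\<^sub>i\<close> is regular not only modulo \<open>J\<close> but modulo every power of \<open>J\<close>.
This is what the next step needs.\<close>

lemma nonzero_form_cancel:
  assumes reg: "\<And>i x. i < r \<Longrightarrow> x \<in> S \<Longrightarrow> f i * x \<in> partial_ideal i \<Longrightarrow> x \<in> partial_ideal i"
  shows "i \<le> r \<Longrightarrow> ideal_above L \<Longrightarrow> partial_ideal i \<subseteq> L \<Longrightarrow> nonzero_form L i k g \<Longrightarrow>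
    x \<in> adic i t S \<Longrightarrow> g * x \<in> adic i (t + k) L \<Longrightarrow> x \<in> adic i t L"
proof (induction i arbitrary: L k g x t)
  case 0
  then have "k = 0" "g \<in> S" "\<And>x. x \<in> S \<Longrightarrow> g * x \<in> L \<Longrightarrow> x \<in> L"
    by (cases k; simp)+
  then show ?case using "0.prems" by (cases t) simp_all
next
  case (Suc i)
  note outer = Suc.IH
  note L = Suc.prems(2,3) and ab = aboveD[OF above_adic[OF Suc.prems(2)]]
  have Li: "partial_ideal i \<subseteq> L" using L(2) adic_Suc_index[OF above_S, of i 1] by blast
  have ir: "i < r" using Suc.prems by simp
  have reg_i: "f i * x \<in> adic i k S \<Longrightarrow> x \<in> S \<Longrightarrow> x \<in> adic i k S" for x k
  proof (induction k)
    case (Suc k)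
    have PI: "ideal_above (partial_ideal i)" by (rule above_adic[OF above_S])
    have x: "x \<in> adic i k S"
      using Suc adic_decreasing[OF above_S, of i k] by blast
    have "nonzero_form (partial_ideal i) i 0 (f i)" using reg[OF ir] f_S by simp
    then have "x \<in> adic i k (partial_ideal i)"
      using Suc.prems(1) adic_Suc_subset[OF PI, of i k]
      by (intro outer[of "partial_ideal i" 0 "f i" x k]) (use x ir PI in auto)
    then show ?case using adic_subset_Suc[OF PI, of i i k] by auto
  qed simp
  have LS: "L \<subseteq> S" using aboveD(2)[OF L(1)] by blast
  have cancel_f: "y \<in> adic (Suc i) m L" 
    if y: "y \<in> S" "f i * y \<in> adic (Suc i) (Suc m) L" for y m
  proof -
    obtain a b where ab': "f i * y = f i * a + b" "a \<in> adic (Suc i) m L" "b \<in> adic i (Suc m) L"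
      using y(2) by (rule adicE)
    have "f i * (y - a) = b" using ab'(1) by (simp add: algebra_simps)
    moreover have "b \<in> adic i (Suc m) S" using ab'(3) adic_mono[OF LS] by blast
    ultimately have "y - a \<in> adic i (Suc m) S"
      using reg_i[of "y - a"] diff_S[OF y(1) ab(2)[OF ab'(2)]] by simp
    then have "y - a + a \<in> adic (Suc i) m L" by (rule ab(7)[OF adic_Suc_subset_Suc_index[OF L] ab'(2)])
    then show ?thesis by simp
  qed
  have aux: "x \<in> adic (Suc i) t L"
    if "nonzero_form L i k h" "e \<in> adic (Suc i) (k - 1) S" "k = 0 \<longrightarrow> e = 0"
      "x \<in> adic (Suc i) t S" "(f i * e + h) * x \<in> adic (Suc i) (t + k) L" for k h e x t
  proof (rule nonzero_form_cancel_step[OF L _ _ nonzero_form_adic[OF that(1)] that(2-5)])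
    show "y \<in> adic i m S" if "y \<in> S" "f i * y \<in> adic i m S" for y m
      using reg_i that by blast
    show "y \<in> adic i s L" if y: "y \<in> adic i s S" "h * y \<in> adic i (s + k) L" for y s
      by (rule outer[OF _ L(1) Li \<open>nonzero_form L i k h\<close> y]) (use ir in simp)
  qed
  show ?case using Suc.prems(4-)
  proof (induction k arbitrary: g x t)
    case 0
    have "nonzero_form L i 0 g" using 0(1) by simp
    from aux[OF this, of 0 x t] show ?case using 0(2,3) S_closed(1) by simp
  next
    case (Suc k)
    from Suc.prems(1) consider
        a b where "g = f i * a + b" "a \<in> adic (Suc i) k S" "nonzero_form L i (Suc k) b"
      | a where "g = f i * a" "nonzero_form L (Suc i) k a"
      unfolding nonzero_form.simps by blast
    then show ?case
    proof cases
      case (1 a b)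
      show ?thesis
        by (rule aux[OF 1(3) _ _ Suc.prems(2) Suc.prems(3)[unfolded 1(1)]]) (simp_all add: 1(2))
    next
      case (2 a)
      note in_S = aboveD(2)[OF above_adic[OF above_S]]
      have "a * x \<in> S"
        by (rule mult_S[OF in_S[OF nonzero_form_adic[OF 2(2)]] in_S[OF Suc.prems(2)]])
      then have "a * x \<in> adic (Suc i) (t + k) L"
        by (rule cancel_f) (use Suc.prems(3) 2(1) in \<open>simp add: mult.assoc\<close>)
      then show ?thesis using Suc.IH[OF 2(2) Suc.prems(2)] by simp
    qed
  qed
qed

end

context ring_sequence
begin

section \<open>Regular sequences are algebraically independent\<close>

definition exponents :: "nat \<Rightarrow> nat \<Rightarrow> (nat \<Rightarrow> nat) set" where
  "exponents i k = {\<alpha>. (\<forall>j\<ge>i. \<alpha> j = 0) \<and> (\<Sum>j<i. \<alpha> j) = k}"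

definition power_product :: "nat \<Rightarrow> (nat \<Rightarrow> nat) \<Rightarrow> 'a" where
  "power_product i \<alpha> = (\<Prod>j<i. f j ^ \<alpha> j)"

abbreviation bump :: "nat \<Rightarrow> (nat \<Rightarrow> nat) \<Rightarrow> nat \<Rightarrow> nat" where
  "bump i \<alpha> \<equiv> \<alpha>(i := Suc (\<alpha> i))"

lemma exponents_0: "exponents i 0 = {\<lambda>_. 0}"
  unfolding exponents_def by (auto simp: fun_eq_iff) (metis lessThan_iff not_le)

lemma exponents_0_Suc: "exponents 0 (Suc k) = {}"
  unfolding exponents_def by auto

lemma exponents_rec:
  "exponents (Suc i) (Suc k) = exponents i (Suc k) \<union> bump i ` exponents (Suc i) k"
proof (intro equalityI subsetI)
  fix \<alpha> assume \<alpha>: "\<alpha> \<in> exponents (Suc i) (Suc k)"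
  show "\<alpha> \<in> exponents i (Suc k) \<union> bump i ` exponents (Suc i) k"
  proof (cases "\<alpha> i")
    case 0
    then have "\<alpha> \<in> exponents i (Suc k)" using \<alpha> unfolding exponents_def
      by (auto simp: Suc_le_eq) (metis le_neq_implies_less)
    then show ?thesis by blast
  next
    case (Suc m)
    have "(\<Sum>j<i. (\<alpha>(i := m)) j) = (\<Sum>j<i. \<alpha> j)" by (rule sum.cong) auto
    then have "\<alpha>(i := m) \<in> exponents (Suc i) k" using \<alpha> Suc unfolding exponents_def by auto
    moreover have "\<alpha> = bump i (\<alpha>(i := m))" using Suc by auto
    ultimately show ?thesis by blast
  qed
next
  fix \<alpha> assume "\<alpha> \<in> exponents i (Suc k) \<union> bump i ` exponents (Suc i) k"
  then show "\<alpha> \<in> exponents (Suc i) (Suc k)"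
  proof
    assume "\<alpha> \<in> bump i ` exponents (Suc i) k"
    then obtain \<beta> where \<beta>: "\<alpha> = bump i \<beta>" "\<beta> \<in> exponents (Suc i) k" by blast
    have "(\<Sum>j<i. \<alpha> j) = (\<Sum>j<i. \<beta> j)" unfolding \<beta> by (rule sum.cong) auto
    then show ?thesis using \<beta> unfolding exponents_def by auto
  qed (auto simp: exponents_def)
qed

lemma finite_exponents: "finite (exponents i k)"
proof (induction i arbitrary: k)
  case 0
  then show ?case by (cases k) (simp_all add: exponents_0 exponents_0_Suc)
next
  case (Suc i)
  note outer = Suc
  show ?case
    by (induction k) (simp_all add: exponents_0 exponents_rec outer)
qed

lemma power_product_bump: "power_product (Suc i) (bump i \<alpha>) = f i * power_product (Suc i) \<alpha>"
proof -
  have "(\<Prod>j<i. f j ^ (bump i \<alpha>) j) = (\<Prod>j<i. f j ^ \<alpha> j)" by (rule prod.cong) auto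
  then show ?thesis unfolding power_product_def by (simp add: mult_ac)
qed

lemma sum_exponents_rec:
  "(\<Sum>\<alpha>\<in>exponents (Suc i) (Suc k). g \<alpha> * power_product (Suc i) \<alpha>) =
    f i * (\<Sum>\<alpha>\<in>exponents (Suc i) k. g (bump i \<alpha>) * power_product (Suc i) \<alpha>) +
    (\<Sum>\<alpha>\<in>exponents i (Suc k). g \<alpha> * power_product i \<alpha>)"
proof -
  have inj: "inj_on (bump i) (exponents (Suc i) k)"
  proof (rule inj_onI)
    fix \<alpha> \<beta> :: "nat \<Rightarrow> nat" assume "bump i \<alpha> = bump i \<beta>"
    then have "bump i \<alpha> j = bump i \<beta> j" for j by simp
    then show "\<alpha> = \<beta>" by (metis ext fun_upd_apply nat.inject)
  qed
  have disj: "exponents i (Suc k) \<inter> bump i ` exponents (Suc i) k = {}"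
    unfolding exponents_def by auto
  have "(\<Sum>\<alpha>\<in>exponents i (Suc k). g \<alpha> * power_product (Suc i) \<alpha>) =
      (\<Sum>\<alpha>\<in>exponents i (Suc k). g \<alpha> * power_product i \<alpha>)"
    by (rule sum.cong) (auto simp: exponents_def power_product_def)
  then show ?thesis unfolding exponents_rec
    by (simp add: sum.union_disjoint finite_exponents disj sum.reindex[OF inj] power_product_bump
        sum_distrib_left mult_ac del: fun_upd_apply)
qed

lemma power_product_adic: "power_product i \<alpha> \<in> adic i (\<Sum>j<i. \<alpha> j) S"
proof -
  have S1: "power_product j \<alpha> \<in> S" for j
  proof (induction j)
    case (Suc j)
    have "f j ^ m \<in> S" for m by (induction m) (simp_all add: one_S mult_S f_S)
    then show ?case using Suc by (simp add: power_product_def mult_S)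
  qed (simp add: power_product_def one_S)
  have *: "f j ^ m * x \<in> adic i (k + m) S" if "j < i" "x \<in> adic i k S" for j i k m x
    using that
  proof (induction m)
    case (Suc m)
    then show ?case using adic_mult_f[OF above_S, of j i "f j ^ m * x" "k + m"]
      by (simp add: mult_ac)
  qed simp
  have "power_product j \<alpha> \<in> adic i (\<Sum>l<j. \<alpha> l) S" if "j \<le> i" for j
    using that
  proof (induction j)
    case 0
    then show ?case by (simp add: power_product_def one_S)
  next
    case (Suc j)
    then show ?case using *[of j i "power_product j \<alpha>" "\<Sum>l<j. \<alpha> l" "\<alpha> j"]
      by (simp add: power_product_def mult_ac)
  qed
  then show ?thesis by simp
qed

lemma form_adic:
  assumes "\<And>\<alpha>. g \<alpha> \<in> S"
  shows "(\<Sum>\<alpha>\<in>exponents i k. g \<alpha> * power_product i \<alpha>) \<in> adic i k S"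
proof (rule sum_in_above[OF above_adic[OF above_S]])
  fix \<alpha> assume "\<alpha> \<in> exponents i k"
  then have "(\<Sum>j<i. \<alpha> j) = k" by (simp add: exponents_def)
  then show "g \<alpha> * power_product i \<alpha> \<in> adic i k S"
    using aboveD(4)[OF above_adic[OF above_S] assms power_product_adic[of i \<alpha>]] by simp
qed

text \<open>Splitting the exponent vectors by whether they vanish at the last index gives exactly the recursion
for nonzero forms.\<close>

lemma nonzero_form_sum:
  assumes S: "\<And>\<alpha>. g \<alpha> \<in> S"
    and reg: "\<And>\<alpha> x. g \<alpha> \<noteq> 0 \<Longrightarrow> x \<in> S \<Longrightarrow> g \<alpha> * x \<in> L \<Longrightarrow> x \<in> L"
    and nz: "\<exists>\<alpha>\<in>exponents i k. g \<alpha> \<noteq> 0"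
  shows "nonzero_form L i k (\<Sum>\<alpha>\<in>exponents i k. g \<alpha> * power_product i \<alpha>)"
  using assms
proof (induction i arbitrary: k g)
  case 0
  then show ?case by (cases k) (auto simp: exponents_0 exponents_0_Suc power_product_def)
next
  case (Suc i)
  note outer = Suc.IH
  show ?case using Suc.prems
  proof (induction k arbitrary: g)
    case 0
    then show ?case by (auto simp: exponents_0 power_product_def)
  next
    case (Suc k)
    let ?a = "\<Sum>\<alpha>\<in>exponents (Suc i) k. g (bump i \<alpha>) * power_product (Suc i) \<alpha>"
    let ?b = "\<Sum>\<alpha>\<in>exponents i (Suc k). g \<alpha> * power_product i \<alpha>"
    show ?case
    proof (cases "\<exists>\<alpha>\<in>exponents i (Suc k). g \<alpha> \<noteq> 0")
      case True
      then have "nonzero_form L i (Suc k) ?b"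
        using outer[of g "Suc k"] Suc.prems(1,2) by blast
      moreover have "?a \<in> adic (Suc i) k S" by (rule form_adic) (rule Suc.prems)
      ultimately show ?thesis unfolding sum_exponents_rec nonzero_form.simps by blast
    next
      case False
      then have "\<exists>\<alpha>\<in>exponents (Suc i) k. g (bump i \<alpha>) \<noteq> 0"
        using Suc.prems(3) unfolding exponents_rec by blast
      then have "nonzero_form L (Suc i) k ?a"
        using Suc.IH[of "\<lambda>\<alpha>. g (bump i \<alpha>)"] Suc.prems(1,2) by blast
      moreover have "?b = 0" using False by (intro sum.neutral) auto
      ultimately show ?thesis unfolding sum_exponents_rec nonzero_form.simps by auto
    qed
  qed
qed

text \<open>Let \<open>u \<in> J^t\<close> with \<open>u \<notin> J^(t+1)\<close>, and let \<open>s\<close> be the least degree of a term of the polynomial.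
Modulo \<open>J^(t+s+1)\<close> only the terms of degree \<open>s\<close> contribute to the product with \<open>u\<close>, and they form
a nonzero form, which does not map \<open>u\<close> into \<open>J^(t+s+1)\<close>.\<close>

theorem regular_sequence_independent:
  assumes reg: "\<And>i x. i < r \<Longrightarrow> x \<in> S \<Longrightarrow> f i * x \<in> partial_ideal i \<Longrightarrow> x \<in> partial_ideal i"
    and u: "u \<in> S" "u \<notin> adic r T S"
    and A: "finite A" "\<And>\<alpha> j. \<alpha> \<in> A \<Longrightarrow> j \<ge> r \<Longrightarrow> \<alpha> j = 0"
    and unit: "\<And>\<alpha>. \<alpha> \<in> A \<Longrightarrow> g \<alpha> \<in> S \<and> (g \<alpha> = 0 \<or> (\<exists>h\<in>S. h * g \<alpha> = 1))"
    and nz: "\<exists>\<alpha>\<in>A. g \<alpha> \<noteq> 0"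
  shows "(\<Sum>\<alpha>\<in>A. g \<alpha> * power_product r \<alpha>) * u \<notin> I"
proof
  assume zero: "(\<Sum>\<alpha>\<in>A. g \<alpha> * power_product r \<alpha>) * u \<in> I"
  define deg where "deg \<alpha> = (\<Sum>j<r. \<alpha> j)" for \<alpha> :: "nat \<Rightarrow> nat"
  define g' where "g' \<alpha> = (if \<alpha> \<in> A then g \<alpha> else 0)" for \<alpha>
  define s where "s = (LEAST s. \<exists>\<alpha>\<in>A. g \<alpha> \<noteq> 0 \<and> deg \<alpha> = s)"
  have ex: "\<exists>\<alpha>\<in>A. g \<alpha> \<noteq> 0 \<and> deg \<alpha> = s"
    unfolding s_def by (rule LeastI_ex) (use nz in blast)
  have least: "s \<le> deg \<alpha>" if "\<alpha> \<in> A" "g \<alpha> \<noteq> 0" for \<alpha>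
    unfolding s_def by (rule Least_le) (use that in blast)
  obtain t where t: "u \<in> adic r t S" "u \<notin> adic r (Suc t) S"
  proof -
    have "\<exists>t. u \<notin> adic r t S" using u(2) by blast
    define t where "t = (LEAST t. u \<notin> adic r t S)"
    have t: "u \<notin> adic r t S" unfolding t_def by (rule LeastI_ex) (use u(2) in blast)
    moreover have "t \<noteq> 0" using t u(1) by (metis adic.simps(1))
    ultimately show ?thesis
      using not_less_Least[of "t - 1" "\<lambda>t. u \<notin> adic r t S"] that[of "t - 1"]
      unfolding t_def[symmetric] by (cases t) auto
  qed
  \<comment> \<open>The order of \<open>u\<close> with respect to the powers of \<open>J\<close> is now \<open>t\<close>, and \<open>?low\<close> is the initial form
    of the polynomial.\<close>
  let ?L = "partial_ideal r"
  have L: "ideal_above ?L" by (rule above_adic[OF above_S])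
  note ad = aboveD[OF above_adic[OF above_S, of r "Suc (t + s)"]]
  let ?low = "\<Sum>\<alpha>\<in>exponents r s. g' \<alpha> * power_product r \<alpha>"
  let ?high = "\<Sum>\<alpha>\<in>{\<alpha>\<in>A. deg \<alpha> \<noteq> s}. g \<alpha> * power_product r \<alpha>"
  have g'S: "g' \<alpha> \<in> S" for \<alpha> unfolding g'_def using unit S_closed(1) by auto
  have form: "nonzero_form ?L r s ?low"
  proof (rule nonzero_form_sum[OF g'S])
    fix \<alpha> x assume *: "g' \<alpha> \<noteq> 0" "x \<in> S" "g' \<alpha> * x \<in> ?L"
    then obtain h where h: "h \<in> S" "h * g' \<alpha> = 1"
      unfolding g'_def using unit by (metis (full_types))
    have "h * (g' \<alpha> * x) \<in> ?L" using aboveD(4)[OF L h(1) *(3)] .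
    then show "x \<in> ?L" using h(2) by (simp add: mult.assoc[symmetric])
  next
    show "\<exists>\<alpha>\<in>exponents r s. g' \<alpha> \<noteq> 0"
      using ex A(2) unfolding exponents_def g'_def deg_def by auto
  qed
  have low: "?low = (\<Sum>\<alpha>\<in>{\<alpha>\<in>A. deg \<alpha> = s}. g \<alpha> * power_product r \<alpha>)"
    by (rule sum.mono_neutral_cong_right[OF finite_exponents])
      (use A(2) in \<open>auto simp: exponents_def deg_def g'_def\<close>)
  have "A = {\<alpha>\<in>A. deg \<alpha> = s} \<union> {\<alpha>\<in>A. deg \<alpha> \<noteq> s}" by blast
  then have split: "(\<Sum>\<alpha>\<in>A. g \<alpha> * power_product r \<alpha>) = ?low + ?high"
    unfolding low using A(1) by (subst sum.union_disjoint[symmetric]) auto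
  have high: "?high \<in> adic r (Suc s) S"
  proof (rule sum_in_above[OF above_adic[OF above_S]])
    fix \<alpha> assume \<alpha>: "\<alpha> \<in> {\<alpha>\<in>A. deg \<alpha> \<noteq> s}"
    show "g \<alpha> * power_product r \<alpha> \<in> adic r (Suc s) S"
    proof (cases "g \<alpha> = 0")
      case True
      then show ?thesis using aboveD(5)[OF above_adic[OF above_S]] by simp
    next
      case False
      then have le: "Suc s \<le> deg \<alpha>" using \<alpha> least[of \<alpha>] by simp
      have "adic r (deg \<alpha>) S \<subseteq> adic r (Suc s) S"
        using le by (induction rule: dec_induct) (use adic_decreasing[OF above_S] in blast)+
      then have "power_product r \<alpha> \<in> adic r (Suc s) S"
        using power_product_adic[of r \<alpha>] unfolding deg_def by blast
      then show ?thesis using aboveD(4)[OF above_adic[OF above_S]] unit \<alpha> by blast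
    qed
  qed
  have "?high * u \<in> adic r (Suc (t + s)) S"
    using adic_mult[OF above_S high t(1)] by simp
  then have "(?low + ?high) * u - ?high * u \<in> adic r (Suc (t + s)) S"
    by (rule ad(3)[OF ad(1)[OF zero[unfolded split]]])
  then have "?low * u \<in> adic r (Suc (t + s)) S" by (simp add: algebra_simps)
  then have "?low * u \<in> adic r (t + s) ?L" using adic_Suc_subset[OF L, of r "t + s"] by blast
  with reg have "u \<in> adic r t ?L"
    by (rule nonzero_form_cancel[OF _ order_refl L order_refl form t(1)])
  then have "u \<in> adic r (Suc t) S" using adic_subset_Suc[OF L, of r r t] by blast
  then show False using t(2) by simp
qed

end

context ring_sequence
begin

lemma partial_ideal_iff:
  "p \<in> partial_ideal i \<longleftrightarrow> (\<exists>q. (\<forall>j. q j \<in> S) \<and> p - (\<Sum>j<i. f j * q j) \<in> I)"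
proof (induction i arbitrary: p)
  case 0
  then show ?case using S_closed(1) by auto
next
  case (Suc i)
  show ?case
  proof
    assume "p \<in> partial_ideal (Suc i)"
    then obtain a b where ab: "p = f i * a + b" "a \<in> S" "b \<in> partial_ideal i" by auto
    then obtain q where q: "\<forall>j. q j \<in> S" "b - (\<Sum>j<i. f j * q j) \<in> I" using Suc by blast
    have "(\<Sum>j<i. f j * (q(i := a)) j) = (\<Sum>j<i. f j * q j)" by (rule sum.cong) auto
    then have "p - (\<Sum>j<Suc i. f j * (q(i := a)) j) \<in> I" using q(2) ab(1) by simp
    then show "\<exists>q. (\<forall>j. q j \<in> S) \<and> p - (\<Sum>j<Suc i. f j * q j) \<in> I"
      using q(1) ab(2) by (intro exI[of _ "q(i := a)"]) auto
  next
    assume "\<exists>q. (\<forall>j. q j \<in> S) \<and> p - (\<Sum>j<Suc i. f j * q j) \<in> I"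
    then obtain q where q: "\<forall>j. q j \<in> S" "p - (\<Sum>j<Suc i. f j * q j) \<in> I" by blast
    then have "p - f i * q i - (\<Sum>j<i. f j * q j) \<in> I" by (simp add: algebra_simps)
    then have "p - f i * q i \<in> partial_ideal i" using Suc q(1) by blast
    then have "f i * q i + (p - f i * q i) \<in> partial_ideal (Suc i)"
      unfolding One_nat_def adic.simps using q(1) by blast
    then show "p \<in> partial_ideal (Suc i)" by simp
  qed
qed

end

section \<open>Linear systems and numbers of monomials\<close>

text \<open>Elimination of one unknown: the equation for \<open>b\<close> expresses the value at an index \<open>p\<close> with
nonzero coefficient through the other values.\<close>

lemma homogeneous_system_nontrivial_solution:
  fixes c :: "'a \<Rightarrow> 'b \<Rightarrow> 'k::field"
  assumes "finite B" "finite A" "card B < card A"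
  shows "\<exists>g. (\<exists>a\<in>A. g a \<noteq> 0) \<and> (\<forall>b\<in>B. (\<Sum>a\<in>A. g a * c a b) = 0)"
  using assms
proof (induction B arbitrary: A c rule: finite_induct)
  case empty
  then have "A \<noteq> {}" by auto
  then show ?case by (intro exI[of _ "\<lambda>_. 1"]) auto
next
  case (insert b B)
  show ?case
  proof (cases "\<forall>a\<in>A. c a b = 0")
    case True
    moreover obtain g where "\<exists>a\<in>A. g a \<noteq> 0" "\<forall>b\<in>B. (\<Sum>a\<in>A. g a * c a b) = 0"
      using insert.IH[of A c] insert.prems insert.hyps by auto
    ultimately show ?thesis by (intro exI[of _ g]) auto
  next
    case False
    then obtain p where p: "p \<in> A" "c p b \<noteq> 0" by blast
    define A' where "A' = A - {p}"
    have A: "A = insert p A'" "p \<notin> A'" "finite A'" using p insert.prems by (auto simp: A'_def)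
    have "card B < card A'" using insert.prems insert.hyps A by simp
    then obtain g where g: "\<exists>a\<in>A'. g a \<noteq> 0"
      "\<forall>b'\<in>B. (\<Sum>a\<in>A'. g a * (c a b' - c a b / c p b * c p b')) = 0"
      using insert.IH[of A' "\<lambda>a b'. c a b' - c a b / c p b * c p b'"] A by blast
    define q where "q = - (\<Sum>a\<in>A'. g a * c a b / c p b)"
    have sum: "(\<Sum>a\<in>A. (g(p := q)) a * c a b') = (\<Sum>a\<in>A'. g a * (c a b' - c a b / c p b * c p b'))" for b'
    proof -
      have "(\<Sum>a\<in>A'. (g(p := q)) a * c a b') = (\<Sum>a\<in>A'. g a * c a b')"
        using A(2) by (intro sum.cong) auto
      then have "(\<Sum>a\<in>A. (g(p := q)) a * c a b') = q * c p b' + (\<Sum>a\<in>A'. g a * c a b')"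
        using A by simp
      also have "\<dots> = (\<Sum>a\<in>A'. g a * (c a b' - c a b / c p b * c p b'))"
        by (simp add: q_def sum_distrib_right sum_distrib_left sum_subtractf right_diff_distrib mult_ac)
      finally show ?thesis .
    qed
    have "\<exists>a\<in>A. (g(p := q)) a \<noteq> 0" using g(1) A by auto
    moreover have "\<forall>b'\<in>insert b B. (\<Sum>a\<in>A. (g(p := q)) a * c a b') = 0"
      unfolding sum using g(2) p(2) by auto
    ultimately show ?thesis by blast
  qed
qed

lemma finite_bounded_monomials:
  fixes F :: "'v set" and D :: nat
  assumes "finite F"
  defines "B \<equiv> {m :: 'v \<Rightarrow>\<^sub>0 nat. Poly_Mapping.keys m \<subseteq> F \<and> (\<forall>v. Poly_Mapping.lookup m v \<le> D)}"
  shows "finite B" "card B \<le> (D + 1) ^ card F"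
proof -
  let ?h = "\<lambda>m. restrict (Poly_Mapping.lookup m) F"
  have inj: "inj_on ?h B"
  proof (rule inj_onI)
    fix m m' assume m: "m \<in> B" "m' \<in> B" "?h m = ?h m'"
    show "m = m'"
    proof (rule poly_mapping_eqI)
      fix v
      show "Poly_Mapping.lookup m v = Poly_Mapping.lookup m' v"
      proof (cases "v \<in> F")
        case True
        then show ?thesis using fun_cong[OF m(3), of v] by simp
      next
        case False
        then have "v \<notin> Poly_Mapping.keys m" "v \<notin> Poly_Mapping.keys m'" using m unfolding B_def by auto
        then show ?thesis by (simp add: in_keys_iff)
      qed
    qed
  qed
  have sub: "?h ` B \<subseteq> F \<rightarrow>\<^sub>E {..D}" unfolding B_def by auto
  have fin: "finite (F \<rightarrow>\<^sub>E {..D})" using assms(1) by (intro finite_PiE) auto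
  show "finite B" using inj finite_subset[OF sub fin] by (metis finite_imageD)
  have "card B = card (?h ` B)" using inj by (simp add: card_image)
  also have "\<dots> \<le> card (F \<rightarrow>\<^sub>E {..D})" by (rule card_mono[OF fin sub])
  also have "\<dots> = (D + 1) ^ card F" using assms(1) by (simp add: card_PiE)
  finally show "card B \<le> (D + 1) ^ card F" .
qed

lemma card_bounded_exponents:
  fixes r k :: nat
  defines "A \<equiv> {\<alpha> :: nat \<Rightarrow> nat. (\<forall>j<r. \<alpha> j \<le> k) \<and> (\<forall>j\<ge>r. \<alpha> j = 0)}"
  shows "finite A" "card A = (k + 1) ^ r"
proof -
  let ?h = "\<lambda>\<beta> j. if j < r then \<beta> j else 0"
  have inj: "inj_on ?h ({..<r} \<rightarrow>\<^sub>E {..k})"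
  proof (rule inj_onI)
    fix \<alpha> \<beta> assume *: "\<alpha> \<in> {..<r} \<rightarrow>\<^sub>E {..k}" "\<beta> \<in> {..<r} \<rightarrow>\<^sub>E {..k}" "?h \<alpha> = ?h \<beta>"
    show "\<alpha> = \<beta>"
    proof (rule PiE_ext[OF *(1,2)])
      fix j assume "j \<in> {..<r}"
      then show "\<alpha> j = \<beta> j" using fun_cong[OF *(3), of j] by simp
    qed
  qed
  have A: "A = ?h ` ({..<r} \<rightarrow>\<^sub>E {..k})"
  proof (intro equalityI subsetI)
    fix \<alpha> assume \<alpha>: "\<alpha> \<in> A"
    then have "restrict \<alpha> {..<r} \<in> {..<r} \<rightarrow>\<^sub>E {..k}" unfolding A_def by auto
    moreover have "\<alpha> = ?h (restrict \<alpha> {..<r})" using \<alpha> unfolding A_def by auto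
    ultimately show "\<alpha> \<in> ?h ` ({..<r} \<rightarrow>\<^sub>E {..k})" by blast
  next
    fix \<alpha> assume "\<alpha> \<in> ?h ` ({..<r} \<rightarrow>\<^sub>E {..k})"
    then obtain \<beta> where \<beta>: "\<beta> \<in> {..<r} \<rightarrow>\<^sub>E {..k}" "\<alpha> = ?h \<beta>" by blast
    then have "\<beta> j \<le> k" if "j < r" for j using PiE_mem[OF \<beta>(1), of j] that by simp
    then show "\<alpha> \<in> A" unfolding A_def \<beta>(2) by simp
  qed
  show "finite A" unfolding A by (intro finite_imageI finite_PiE) auto
  show "card A = (k + 1) ^ r" unfolding A card_image[OF inj] by (simp add: card_PiE)
qed

lemma polynomial_growth_exceeds:
  fixes c d r :: nat
  assumes "d < r"
  shows "\<exists>k. (c * k + 1) ^ d < (k + 1) ^ r"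
proof
  \<comment> \<open>Then \<open>(c k + 1)^d\<close> is at most \<open>k\<close> times \<open>(k + 1)^d\<close>.\<close>
  define k where "k = (c + 1) ^ d"
  have "(c * k + 1) ^ d \<le> ((c + 1) * (k + 1)) ^ d" by (rule power_mono) (simp_all add: algebra_simps)
  also have "\<dots> = k * (k + 1) ^ d" by (simp only: power_mult_distrib k_def)
  also have "\<dots> < (k + 1) ^ Suc d" by simp
  also have "\<dots> \<le> (k + 1) ^ r" using assms by (intro power_increasing) auto
  finally show "(c * k + 1) ^ d < (k + 1) ^ r" .
qed

section \<open>Polynomial rings\<close>

lemma carrier_mpoly_ring:
  "p \<in> carrier (mpoly_ring V) \<longleftrightarrow> (\<forall>m\<in>Poly_Mapping.keys p. Poly_Mapping.keys m \<subseteq> V)"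
  by (simp add: mpoly_ring_def)

lemma mpoly_ring_ops:
  "monoid.mult (mpoly_ring V) = (*)" "monoid.one (mpoly_ring V) = 1"
  "ring.zero (mpoly_ring V) = 0" "ring.add (mpoly_ring V) = (+)"
  by (simp_all add: mpoly_ring_def)

lemma mpoly_ring_closed:
  fixes p q :: "('v, 'k::field) mpoly"
  assumes "p \<in> carrier (mpoly_ring V)" "q \<in> carrier (mpoly_ring V)"
  shows "p + q \<in> carrier (mpoly_ring V)" "p * q \<in> carrier (mpoly_ring V)"
    "- p \<in> carrier (mpoly_ring V)" "p - q \<in> carrier (mpoly_ring V)"
proof -
  interpret R: cring "mpoly_ring V :: ('v, 'k) mpoly ring" by (rule mpoly_ring_cring)
  show add: "p + q \<in> carrier (mpoly_ring V)" and "p * q \<in> carrier (mpoly_ring V)"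
    using R.a_closed[OF assms] R.m_closed[OF assms] by (simp_all add: mpoly_ring_ops)
  show "- p \<in> carrier (mpoly_ring V)" using assms(1) by (simp add: carrier_mpoly_ring)
  show "p - q \<in> carrier (mpoly_ring V)"
    using assms keys_diff[of p q] by (auto simp: carrier_mpoly_ring)
qed

lemma mpoly_ring_one: "1 \<in> carrier (mpoly_ring V)"
  and mpoly_ring_zero: "0 \<in> carrier (mpoly_ring V)"
  by (simp_all add: carrier_mpoly_ring)

lemma mpoly_ring_single:
  "Poly_Mapping.keys m \<subseteq> V \<Longrightarrow> Poly_Mapping.single m c \<in> carrier (mpoly_ring V)"
  by (auto simp: carrier_mpoly_ring)

lemma mpoly_ring_sum:
  "(\<And>x. x \<in> A \<Longrightarrow> h x \<in> carrier (mpoly_ring V)) \<Longrightarrow> sum h A \<in> carrier (mpoly_ring V)"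
  by (induction A rule: infinite_finite_induct) (auto simp: mpoly_ring_zero mpoly_ring_closed)

lemma a_inv_mpoly_ring:
  fixes p :: "('v, 'k::field) mpoly"
  assumes "p \<in> carrier (mpoly_ring V)"
  shows "\<ominus>\<^bsub>mpoly_ring V\<^esub> p = - p"
proof -
  interpret R: cring "mpoly_ring V :: ('v, 'k) mpoly ring" by (rule mpoly_ring_cring)
  show ?thesis
    by (rule R.minus_equality) (use assms mpoly_ring_closed(3)[OF assms assms] in \<open>simp_all add: mpoly_ring_ops\<close>)
qed

lemma a_minus_mpoly_ring:
  fixes p :: "('v, 'k::field) mpoly"
  assumes "q \<in> carrier (mpoly_ring V)"
  shows "p \<ominus>\<^bsub>mpoly_ring V\<^esub> q = p - q"
  using assms by (simp add: a_minus_def a_inv_mpoly_ring mpoly_ring_ops)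

lemma ideal_mpoly_ring:
  fixes J :: "('v, 'k::field) mpoly set"
  assumes "J \<subseteq> carrier (mpoly_ring V)" "0 \<in> J" "\<And>x y. x \<in> J \<Longrightarrow> y \<in> J \<Longrightarrow> x + y \<in> J"
    "\<And>s x. s \<in> carrier (mpoly_ring V) \<Longrightarrow> x \<in> J \<Longrightarrow> s * x \<in> J"
  shows "ideal J (mpoly_ring V)"
proof -
  interpret R: cring "mpoly_ring V :: ('v, 'k) mpoly ring" by (rule mpoly_ring_cring)
  have neg: "- x \<in> J" if "x \<in> J" for x
  proof -
    have "- (1 :: ('v, 'k) mpoly) \<in> carrier (mpoly_ring V)"
      by (rule mpoly_ring_closed(3)[OF mpoly_ring_one mpoly_ring_one])
    from assms(4)[OF this that] show ?thesis by simp
  qed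
  have right: "x * s \<in> J" if "x \<in> J" "s \<in> carrier (mpoly_ring V)" for x s
    using assms(4)[OF that(2,1)] by (simp add: mult.commute)
  show ?thesis
  proof (rule idealI)
    show "ring (mpoly_ring V :: ('v, 'k) mpoly ring)" by (rule R.ring_axioms)
    show "subgroup J (add_monoid (mpoly_ring V :: ('v, 'k) mpoly ring))"
    proof (rule subgroup.intro)
      fix x assume "x \<in> J"
      then have "inv\<^bsub>add_monoid (mpoly_ring V)\<^esub> x = - x"
        using a_inv_mpoly_ring[of x V] assms(1) by (auto simp: a_inv_def)
      then show "inv\<^bsub>add_monoid (mpoly_ring V)\<^esub> x \<in> J" using neg \<open>x \<in> J\<close> by simp
    qed (use assms in \<open>auto simp: mpoly_ring_ops\<close>)
  qed (simp_all add: mpoly_ring_ops assms(4) right)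
qed

lemma keys_monomial_add: "Poly_Mapping.keys (a + b :: 'v \<Rightarrow>\<^sub>0 nat) = Poly_Mapping.keys a \<union> Poly_Mapping.keys b"
  by (auto simp: in_keys_iff lookup_add)

lemma poly_expansion: "p = (\<Sum>m\<in>Poly_Mapping.keys p. Poly_Mapping.single m (Poly_Mapping.lookup p m))"
proof (rule poly_mapping_eqI)
  fix k
  show "Poly_Mapping.lookup p k = Poly_Mapping.lookup (\<Sum>m\<in>Poly_Mapping.keys p. Poly_Mapping.single m (Poly_Mapping.lookup p m)) k"
    by (cases "k \<in> Poly_Mapping.keys p")
      (auto simp: lookup_sum lookup_single when_def in_keys_iff sum.delta)
qed

lemma lookup_single_times:
  fixes p :: "('v, 'k::field) mpoly"
  shows "Poly_Mapping.lookup (Poly_Mapping.single t c * p) (t + m) = c * Poly_Mapping.lookup p m"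
proof -
  have *: "Poly_Mapping.lookup (Poly_Mapping.single t c * Poly_Mapping.single k a) (t + m) =
      c * Poly_Mapping.lookup (Poly_Mapping.single k a) m" for k a
    by (simp add: mult_single lookup_single when_def)
  have "Poly_Mapping.single t c * p =
      (\<Sum>k\<in>Poly_Mapping.keys p. Poly_Mapping.single t c * Poly_Mapping.single k (Poly_Mapping.lookup p k))"
    by (subst (1) poly_expansion[of p]) (simp add: sum_distrib_left)
  then have "Poly_Mapping.lookup (Poly_Mapping.single t c * p) (t + m) =
      c * Poly_Mapping.lookup (\<Sum>k\<in>Poly_Mapping.keys p. Poly_Mapping.single k (Poly_Mapping.lookup p k)) m"
    by (simp add: lookup_sum * sum_distrib_left)
  then show ?thesis by (simp add: poly_expansion[symmetric])
qed

lift_definition restrict_keys :: "'b set \<Rightarrow> ('b \<Rightarrow>\<^sub>0 'k::zero) \<Rightarrow> 'b \<Rightarrow>\<^sub>0 'k" is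
  "\<lambda>A p b. if b \<in> A then p b else 0"
  by (rule finite_subset) auto

lemma lookup_restrict_keys [simp]:
  "Poly_Mapping.lookup (restrict_keys A p) b = (if b \<in> A then Poly_Mapping.lookup p b else 0)"
  by transfer simp

lemma keys_restrict_keys: "Poly_Mapping.keys (restrict_keys A p) = Poly_Mapping.keys p \<inter> A"
  by (auto simp: in_keys_iff split: if_splits)

lemma exponent_bound_mult:
  fixes p q :: "('v, 'k::field) mpoly"
  assumes "\<And>m v. m \<in> Poly_Mapping.keys p \<Longrightarrow> Poly_Mapping.lookup m v \<le> a"
    and "\<And>m v. m \<in> Poly_Mapping.keys q \<Longrightarrow> Poly_Mapping.lookup m v \<le> b"
    and "m \<in> Poly_Mapping.keys (p * q)"
  shows "Poly_Mapping.lookup m v \<le> a + b"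
proof -
  obtain s t where "m = s + t" "s \<in> Poly_Mapping.keys p" "t \<in> Poly_Mapping.keys q"
    using keys_mult[of p q] assms(3) by blast
  then show ?thesis using assms(1)[of s v] assms(2)[of t v] by (simp add: lookup_add)
qed

lemma graded_max_ideal_subset:
  "graded_max_ideal V \<subseteq>
    ({p \<in> carrier (mpoly_ring V). Poly_Mapping.lookup p 0 = 0} :: ('a, 'k::field) mpoly set)"
proof -
  let ?J = "{p \<in> carrier (mpoly_ring V). 0 \<notin> Poly_Mapping.keys p} :: ('a, 'k) mpoly set"
  interpret R: cring "mpoly_ring V :: ('a, 'k) mpoly ring" by (rule mpoly_ring_cring)
  have "ideal ?J (mpoly_ring V)"
  proof (rule ideal_mpoly_ring)
    show "x + y \<in> ?J" if "x \<in> ?J" "y \<in> ?J" for x y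
      using that Poly_Mapping.keys_add[of x y] by (auto simp: mpoly_ring_closed)
    fix s x :: "('a, 'k) mpoly" assume sx: "s \<in> carrier (mpoly_ring V)" "x \<in> ?J"
    have "0 \<notin> Poly_Mapping.keys (s * x)"
    proof
      assume "0 \<in> Poly_Mapping.keys (s * x)"
      then obtain a b where ab: "0 = a + b" "b \<in> Poly_Mapping.keys x" using keys_mult[of s x] by blast
      have "Poly_Mapping.keys b \<subseteq> {}" using keys_monomial_add[of a b] ab(1) by simp
      then show False using ab(2) sx(2) by simp
    qed
    then show "s * x \<in> ?J" using sx by (simp add: mpoly_ring_closed)
  qed (auto simp: mpoly_ring_zero)
  moreover have "indet ` V \<subseteq> ?J"
  proof
    fix p :: "('a, 'k) mpoly" assume "p \<in> indet ` V"
    then obtain v where v: "v \<in> V" "p = Poly_Mapping.single (Poly_Mapping.single v 1) 1"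
      by (auto simp: indet_def)
    have "Poly_Mapping.single v (1::nat) \<noteq> 0" by (metis lookup_single_eq lookup_zero zero_neq_one)
    then show "p \<in> ?J" using v by (auto intro!: mpoly_ring_single)
  qed
  ultimately have "graded_max_ideal V \<subseteq> ?J"
    unfolding graded_max_ideal_def by (rule R.genideal_minimal)
  then show ?thesis by (auto simp: in_keys_iff)
qed

section \<open>Residue class rings as modules\<close>

text \<open>Residue classes are written \<open>cls p\<close>, so that statements about the module turn into statements
about polynomials modulo \<open>I\<close>.\<close>

locale mpoly_quotient =
  fixes V :: "'v set" and I :: "('v, 'k::field) mpoly set"
  assumes ideal_I: "ideal I (mpoly_ring V)"
begin

abbreviation R :: "('v, 'k) mpoly ring" where "R \<equiv> mpoly_ring V"
abbreviation S :: "('v, 'k) mpoly set" where "S \<equiv> carrier R"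
abbreviation M :: "(('v, 'k) mpoly, ('v, 'k) mpoly set) module" where "M \<equiv> quotient_module R I"
abbreviation cls :: "('v, 'k) mpoly \<Rightarrow> ('v, 'k) mpoly set" where "cls p \<equiv> I +>\<^bsub>R\<^esub> p"

sublocale R: cring R by (rule mpoly_ring_cring)
sublocale I: ideal I R by (rule ideal_I)
sublocale Q: cring "R Quot I" by (rule I.quotient_is_cring[OF mpoly_ring_cring])
sublocale M: module R M by (rule quotient_module_module[OF mpoly_ring_cring ideal_I])

sublocale ring_with_ideal S I
proof
  show I_S: "I \<subseteq> S" using I.a_subset by simp
  show zero: "0 \<in> I" using I.zero_closed by (simp add: mpoly_ring_ops)
  show "x - y \<in> I" if "x \<in> I" "y \<in> I" for x y
    using I.a_closed[OF that(1) I.a_inv_closed[OF that(2)]] that I_S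
    by (simp add: a_inv_mpoly_ring subsetD mpoly_ring_ops)
  show "s * x \<in> I" if "s \<in> S" "x \<in> I" for s x
    using I.I_l_closed[OF that(2,1)] by (simp add: mpoly_ring_ops)
qed (simp_all add: mpoly_ring_one mpoly_ring_closed)

lemma M_simps:
  "carrier M = carrier (R Quot I)" "add M = add (R Quot I)" "zero M = zero (R Quot I)"
  "smult M = (\<lambda>r X. cls r \<otimes>\<^bsub>R Quot I\<^esub> X)"
  by (simp_all add: quotient_module_def ring.defs module.defs)

lemma carrier_M: "carrier M = cls ` S"
  unfolding M_simps FactRing_def A_RCOSETS_def' by auto

lemma cls_eq_iff: "p \<in> S \<Longrightarrow> q \<in> S \<Longrightarrow> cls p = cls q \<longleftrightarrow> p - q \<in> I"
  using R.quotient_eq_iff_same_a_r_cos[OF ideal_I, of p q] by (simp add: a_minus_mpoly_ring)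

lemma smult_cls: "r \<in> S \<Longrightarrow> p \<in> S \<Longrightarrow> r \<odot>\<^bsub>M\<^esub> cls p = cls (r * p)"
  using ring_hom_mult[OF I.rcos_ring_hom, of r p] by (simp add: M_simps mpoly_ring_ops)

lemma add_cls: "p \<in> S \<Longrightarrow> q \<in> S \<Longrightarrow> cls p \<oplus>\<^bsub>M\<^esub> cls q = cls (p + q)"
  using ring_hom_add[OF I.rcos_ring_hom, of p q] by (simp add: M_simps mpoly_ring_ops)

lemma zero_M: "\<zero>\<^bsub>M\<^esub> = cls 0"
  using ring_hom_zero[OF I.rcos_ring_hom R.ring_axioms Q.ring_axioms]
  by (simp add: M_simps mpoly_ring_ops)

lemma cls_eq_zero_iff: "p \<in> S \<Longrightarrow> cls p = \<zero>\<^bsub>M\<^esub> \<longleftrightarrow> p \<in> I"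
  unfolding zero_M using cls_eq_iff[of p 0] by (simp add: mpoly_ring_zero)

lemma cls_in_M: "p \<in> S \<Longrightarrow> cls p \<in> carrier M"
  by (simp add: carrier_M)

lemma finsum_cls:
  assumes "finite A" "\<And>a. a \<in> A \<Longrightarrow> h a \<in> S"
  shows "finsum M (\<lambda>a. cls (h a)) A = cls (sum h A)"
  using assms
proof (induction A rule: finite_induct)
  case (insert a A)
  then show ?case
    by (simp add: M.finsum_insert Pi_def cls_in_M add_cls mpoly_ring_sum)
qed (simp add: zero_M)

text \<open>The value 0 beyond the end of the list keeps all terms of the sequence in \<open>S\<close>, as the filtration
requires.\<close>

definition seq_fun :: "('v, 'k) mpoly list \<Rightarrow> nat \<Rightarrow> ('v, 'k) mpoly" where
  "seq_fun fs i = (if i < length fs then fs ! i else 0)"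

lemma ring_sequence_seq_fun: "set fs \<subseteq> S \<Longrightarrow> ring_sequence S I (seq_fun fs)"
  by unfold_locales (auto simp: seq_fun_def mpoly_ring_zero)

lemma seq_submodule_iff:
  assumes fs: "set fs \<subseteq> S" and i: "i \<le> length fs" and p: "p \<in> S"
  shows "cls p \<in> seq_submodule M (take i fs) \<longleftrightarrow>
    p \<in> ring_sequence.adic I (seq_fun fs) i 1 S"
proof -
  interpret ring_sequence S I "seq_fun fs" by (rule ring_sequence_seq_fun[OF fs])
  have sum_S: "(\<Sum>j<i. seq_fun fs j * q j) \<in> S" if "\<forall>j<i. q j \<in> S" for q
    using that by (intro mpoly_ring_sum mult_S f_S) auto
  have fin: "finsum M (\<lambda>j. take i fs ! j \<odot>\<^bsub>M\<^esub> x j) {..<length (take i fs)} = cls (\<Sum>j<i. seq_fun fs j * q j)"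
    if "\<forall>j<i. x j = cls (q j)" "\<forall>j<i. q j \<in> S" for x q
  proof -
    have "finsum M (\<lambda>j. take i fs ! j \<odot>\<^bsub>M\<^esub> x j) {..<length (take i fs)} =
        finsum M (\<lambda>j. cls (seq_fun fs j * q j)) {..<i}"
    proof (rule M.finsum_cong')
      show "take i fs ! j \<odot>\<^bsub>M\<^esub> x j = cls (seq_fun fs j * q j)" if "j \<in> {..<i}" for j
      proof -
        have "take i fs ! j = seq_fun fs j" using that i by (simp add: seq_fun_def)
        then show ?thesis using smult_cls[OF f_S, of "q j" j] that \<open>\<forall>j<i. x j = cls (q j)\<close>
          \<open>\<forall>j<i. q j \<in> S\<close> by simp
      qed
    qed (use i that mult_S f_S in \<open>auto simp: Pi_def cls_in_M\<close>)
    also have "\<dots> = cls (\<Sum>j<i. seq_fun fs j * q j)"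
      using that mult_S f_S by (intro finsum_cls) auto
    finally show ?thesis .
  qed
  show ?thesis
  proof
    assume "cls p \<in> seq_submodule M (take i fs)"
    then obtain x where x: "x \<in> {..<i} \<rightarrow> carrier M"
      "cls p = finsum M (\<lambda>j. take i fs ! j \<odot>\<^bsub>M\<^esub> x j) {..<length (take i fs)}"
      unfolding seq_submodule_def using i by auto
    have "\<forall>j. \<exists>q. q \<in> S \<and> (j < i \<longrightarrow> x j = cls q)"
    proof
      fix j
      show "\<exists>q. q \<in> S \<and> (j < i \<longrightarrow> x j = cls q)"
        using x(1) mpoly_ring_zero by (cases "j < i") (auto simp: carrier_M Pi_def)
    qed
    then obtain q where q: "\<forall>j. q j \<in> S" "\<forall>j<i. x j = cls (q j)" by metis
    have "cls p = cls (\<Sum>j<i. seq_fun fs j * q j)" using x(2) fin[OF q(2)] q(1) by simp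
    then have "p - (\<Sum>j<i. seq_fun fs j * q j) \<in> I"
      using cls_eq_iff[OF p sum_S] q(1) by simp
    then show "p \<in> partial_ideal i" unfolding partial_ideal_iff using q(1) by blast
  next
    assume "p \<in> partial_ideal i"
    then obtain q where q: "\<forall>j. q j \<in> S" "p - (\<Sum>j<i. seq_fun fs j * q j) \<in> I"
      unfolding partial_ideal_iff by blast
    then have "cls p = cls (\<Sum>j<i. seq_fun fs j * q j)" using cls_eq_iff[OF p sum_S] by simp
    also have "\<dots> = finsum M (\<lambda>j. take i fs ! j \<odot>\<^bsub>M\<^esub> cls (q j)) {..<length (take i fs)}"
      using fin[of "\<lambda>j. cls (q j)" q] q(1) by simp
    finally have "cls p = finsum M (\<lambda>j. take i fs ! j \<odot>\<^bsub>M\<^esub> cls (q j)) {..<length (take i fs)}" .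
    moreover have "(\<lambda>j. cls (q j)) \<in> {..<length (take i fs)} \<rightarrow> carrier M"
      using q(1) by (auto simp: cls_in_M)
    ultimately show "cls p \<in> seq_submodule M (take i fs)"
      unfolding seq_submodule_def by (intro CollectI exI conjI)
  qed
qed

text \<open>Regularity is moved from the module to the ring, where the powers of the ideal of the sequence are
available.\<close>

lemma regular_sequence_iff:
  "regular_sequence R M fs \<longleftrightarrow> set fs \<subseteq> S \<and>
    (\<forall>i<length fs. \<forall>p\<in>S. seq_fun fs i * p \<in> ring_sequence.adic I (seq_fun fs) i 1 S \<longrightarrow>
       p \<in> ring_sequence.adic I (seq_fun fs) i 1 S) \<and>
    \<not> S \<subseteq> ring_sequence.adic I (seq_fun fs) (length fs) 1 S"
proof (cases "set fs \<subseteq> S")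
  case True
  interpret ring_sequence S I "seq_fun fs" by (rule ring_sequence_seq_fun[OF True])
  have "(\<forall>x\<in>carrier M. fs ! i \<odot>\<^bsub>M\<^esub> x \<in> seq_submodule M (take i fs) \<longrightarrow>
        x \<in> seq_submodule M (take i fs)) \<longleftrightarrow>
      (\<forall>p\<in>S. seq_fun fs i * p \<in> partial_ideal i \<longrightarrow> p \<in> partial_ideal i)" if "i < length fs" for i
  proof -
    have "fs ! i = seq_fun fs i" using that by (simp add: seq_fun_def)
    then show ?thesis using that
      by (simp add: carrier_M smult_cls f_S seq_submodule_iff[OF True] mult_S)
  qed
  moreover have "seq_submodule M fs \<noteq> carrier M \<longleftrightarrow> \<not> S \<subseteq> partial_ideal (length fs)"
  proof -
    have "seq_submodule M fs \<subseteq> carrier M"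
      unfolding seq_submodule_def
      using True by (auto intro!: M.finsum_closed M.smult_closed simp: Pi_def)
    then have "seq_submodule M fs = carrier M \<longleftrightarrow> (\<forall>p\<in>S. cls p \<in> seq_submodule M fs)"
      by (auto simp: carrier_M)
    then show ?thesis using seq_submodule_iff[OF True order_refl] by auto
  qed
  ultimately show ?thesis unfolding regular_sequence_def using True by auto
qed (simp add: regular_sequence_def)

end

section \<open>Edge ideals\<close>

definition squarefree_monomial :: "'v set \<Rightarrow> 'v \<Rightarrow>\<^sub>0 nat" where
  "squarefree_monomial W = (\<Sum>v\<in>W. Poly_Mapping.single v 1)"

lemma lookup_squarefree_monomial:
  "finite W \<Longrightarrow> Poly_Mapping.lookup (squarefree_monomial W) v = (if v \<in> W then 1 else 0)"
  by (simp add: squarefree_monomial_def lookup_sum lookup_single when_def sum.delta')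

lemma keys_squarefree_monomial: "finite W \<Longrightarrow> Poly_Mapping.keys (squarefree_monomial W) = W"
  by (auto simp: in_keys_iff lookup_squarefree_monomial split: if_splits)

lemma keys_times_monomial:
  fixes p :: "('v, 'k::field) mpoly"
  assumes "k \<in> Poly_Mapping.keys (Poly_Mapping.single t c * p)"
  obtains m where "m \<in> Poly_Mapping.keys p" "k = t + m"
  using assms keys_mult[of "Poly_Mapping.single t c" p] by (auto split: if_splits)

lemma lookup_const_times:
  fixes p :: "('v, 'k::field) mpoly"
  shows "Poly_Mapping.lookup (Poly_Mapping.single 0 c * p) m = c * Poly_Mapping.lookup p m"
  using lookup_single_times[of 0 c p m] by simp

definition independent :: "'v graph \<Rightarrow> 'v set \<Rightarrow> bool" where
  "independent G A \<longleftrightarrow> (\<forall>u\<in>A. \<forall>v\<in>A. {u, v} \<notin> edges G)"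

lemma independent_subset: "independent G A \<Longrightarrow> B \<subseteq> A \<Longrightarrow> independent G B"
  unfolding independent_def by blast

definition maximal_independent :: "'v graph \<Rightarrow> 'v set \<Rightarrow> bool" where
  "maximal_independent G F \<longleftrightarrow> F \<subseteq> verts G \<and> independent G F \<and>
     (\<forall>v\<in>verts G - F. \<not> independent G (insert v F))"

locale edge_ring =
  fixes G :: "'v graph" and I :: "('v, 'k::field) mpoly set"
  assumes finite_verts: "finite (verts G)"
    and edge_subset: "e \<in> edges G \<Longrightarrow> e \<subseteq> verts G"
    and no_loop: "{v} \<notin> edges G"
    and I_def: "I = edge_ideal G"
begin

sublocale mpoly_quotient "verts G" I
  by (rule mpoly_quotient.intro) (unfold I_def, rule edge_ideal_ideal[OF edge_subset])

text \<open>The polynomials on the right form an ideal, which contains the generators. Conversely, a monomial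
with dependent support is a multiple of the product of the two ends of an edge.\<close>

lemma mem_I_iff: "p \<in> I \<longleftrightarrow> p \<in> S \<and> (\<forall>m\<in>Poly_Mapping.keys p. \<not> independent G (Poly_Mapping.keys m))"
proof -
  let ?J = "{p \<in> S. \<forall>m\<in>Poly_Mapping.keys p. \<not> independent G (Poly_Mapping.keys m)}"
  let ?gens = "{indet u * indet v | u v. {u, v} \<in> edges G} :: ('v, 'k) mpoly set"
  have prod: "(indet u * indet v :: ('v, 'k) mpoly) =
      Poly_Mapping.single (Poly_Mapping.single u 1 + Poly_Mapping.single v 1) 1" for u v
    by (simp add: indet_def mult_single)
  have "ideal ?J R"
  proof (rule ideal_mpoly_ring)
    show "x + y \<in> ?J" if "x \<in> ?J" "y \<in> ?J" for x y
      using that Poly_Mapping.keys_add[of x y] by (auto simp: mpoly_ring_closed)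
    fix s x assume sx: "s \<in> S" "x \<in> ?J"
    show "s * x \<in> ?J"
    proof (intro CollectI conjI ballI)
      fix m assume "m \<in> Poly_Mapping.keys (s * x)"
      then obtain a b where "m = a + b" "b \<in> Poly_Mapping.keys x" using keys_mult[of s x] by blast
      then show "\<not> independent G (Poly_Mapping.keys m)"
        using sx(2) independent_subset[of G "Poly_Mapping.keys m" "Poly_Mapping.keys b"]
        by (auto simp: keys_monomial_add)
    qed (use sx in \<open>simp add: mpoly_ring_closed\<close>)
  qed (auto simp: mpoly_ring_zero)
  moreover have "?gens \<subseteq> ?J"
  proof
    fix p assume "p \<in> ?gens"
    then obtain u v where uv: "{u, v} \<in> edges G"
      "p = Poly_Mapping.single (Poly_Mapping.single u 1 + Poly_Mapping.single v 1) 1"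
      unfolding prod by blast
    have k: "Poly_Mapping.keys (Poly_Mapping.single u (1::nat) + Poly_Mapping.single v 1) = {u, v}"
      by (auto simp: keys_monomial_add)
    have "p \<in> S" unfolding uv(2) by (rule mpoly_ring_single) (use k edge_subset[OF uv(1)] in simp)
    moreover have "\<not> independent G {u, v}" using uv(1) unfolding independent_def by blast
    ultimately show "p \<in> ?J" using uv(2) k by simp
  qed
  ultimately have sub: "I \<subseteq> ?J" unfolding I_def edge_ideal_def by (rule R.genideal_minimal)
  have gen: "?gens \<subseteq> I" unfolding I_def edge_ideal_def
    using \<open>?gens \<subseteq> ?J\<close> by (intro R.genideal_self) auto
  have "p \<in> I" if p: "p \<in> ?J" for p
  proof -
    have "Poly_Mapping.single m (Poly_Mapping.lookup p m) \<in> I" if m: "m \<in> Poly_Mapping.keys p" for m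
    proof -
      have "\<not> independent G (Poly_Mapping.keys m)" using p m by blast
      then obtain u v where uv: "u \<in> Poly_Mapping.keys m" "v \<in> Poly_Mapping.keys m" "{u, v} \<in> edges G"
        unfolding independent_def by blast
      have "u \<noteq> v" using uv(3) no_loop by auto
      define e where "e = Poly_Mapping.single u (1::nat) + Poly_Mapping.single v 1"
      have m_eq: "m = (m - e) + e"
      proof (rule poly_mapping_eqI)
        fix w
        have "Poly_Mapping.lookup m u > 0" "Poly_Mapping.lookup m v > 0" using uv by (auto simp: in_keys_iff)
        then show "Poly_Mapping.lookup m w = Poly_Mapping.lookup (m - e + e) w"
          using \<open>u \<noteq> v\<close> unfolding e_def by (auto simp: lookup_add lookup_minus lookup_single when_def)
      qed
      have "Poly_Mapping.keys m \<subseteq> verts G" using p m by (auto simp: carrier_mpoly_ring)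
      moreover have "Poly_Mapping.keys (m - e) \<subseteq> Poly_Mapping.keys m"
        by (auto simp: in_keys_iff lookup_minus)
      ultimately have "Poly_Mapping.single (m - e) (Poly_Mapping.lookup p m) \<in> S"
        by (intro mpoly_ring_single) blast
      moreover have "Poly_Mapping.single e 1 \<in> I"
        using gen uv(3) unfolding prod e_def by blast
      ultimately have "Poly_Mapping.single (m - e) (Poly_Mapping.lookup p m) * Poly_Mapping.single e 1 \<in> I"
        by (rule mult_I)
      then show ?thesis by (simp add: mult_single m_eq[symmetric])
    qed
    then have "(\<Sum>m\<in>Poly_Mapping.keys p. Poly_Mapping.single m (Poly_Mapping.lookup p m)) \<in> I"
      by (rule sum_in_above[OF above_I])
    then show ?thesis by (simp add: poly_expansion[symmetric])
  qed
  then show ?thesis using sub by blast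
qed

section \<open>Upper bounds from a maximal independent set\<close>

text \<open>The product \<open>u\<close> of the variables in \<open>F\<close> has coefficient 1 in a sum of elements of the Stanley spaces,
hence a nonzero coefficient in one of the summands. The corresponding generator is, up to a scalar
and modulo \<open>I\<close>, a monomial \<open>b\<close> with \<open>u = m b\<close> for a monomial \<open>m \<in> K[A]\<close>. A variable \<open>v \<in> A\<close>
outside \<open>F\<close> would give \<open>v m b = v u \<in> I\<close>, which contradicts freeness.\<close>

theorem sdepth_le_card_maximal_independent:
  assumes F: "maximal_independent G F"
  shows "sdepth (verts G) (quotient_grading (verts G) I) M \<le> enat (card F)"
  unfolding sdepth_def
proof (rule Sup_least, clarify)
  fix D assume D: "stanley_decomposition (verts G) (quotient_grading (verts G) I) M D"
  have finF: "finite F" and FV: "F \<subseteq> verts G" using F finite_verts finite_subset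
    unfolding maximal_independent_def by auto
  let ?m = "squarefree_monomial F"
  define u :: "('v, 'k) mpoly" where "u = Poly_Mapping.single ?m 1"
  have uS: "u \<in> S" unfolding u_def using FV by (intro mpoly_ring_single) (simp add: keys_squarefree_monomial finF)
  obtain y where y: "y \<in> (\<Pi>\<^sub>E i\<in>{..<length D}. stanley_space M (fst (D ! i)) (snd (D ! i)))"
    "cls u = finsum M y {..<length D}"
    using D cls_in_M[OF uS] unfolding stanley_decomposition_def by (metis (no_types, lifting))
  have "\<forall>i. \<exists>f p. i < length D \<longrightarrow> f \<in> carrier (mpoly_ring (snd (D ! i))) \<and> f \<in> S \<and> p \<in> S \<and>
      (\<exists>b c. p = Poly_Mapping.single b c) \<and> fst (D ! i) = cls p \<and> y i = cls (f * p)"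
  proof
    fix i
    show "\<exists>f p. i < length D \<longrightarrow> f \<in> carrier (mpoly_ring (snd (D ! i))) \<and> f \<in> S \<and> p \<in> S \<and>
      (\<exists>b c. p = Poly_Mapping.single b c) \<and> fst (D ! i) = cls p \<and> y i = cls (f * p)"
    proof (cases "i < length D")
      case True
      then have "D ! i \<in> set D" by simp
      then obtain a where a: "fst (D ! i) \<in> quotient_grading (verts G) I a" "snd (D ! i) \<subseteq> verts G"
        using D unfolding stanley_decomposition_def by (auto simp: case_prod_unfold)
      obtain f where f: "f \<in> carrier (mpoly_ring (snd (D ! i)))" "y i = f \<odot>\<^bsub>M\<^esub> fst (D ! i)"
        using y(1) True unfolding stanley_space_def by (auto simp: PiE_iff)
      obtain p where p: "fst (D ! i) = cls p" "p \<in> mpoly_component (verts G) a"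
        using a(1) unfolding quotient_grading_def by blast
      have "\<exists>b c. p = Poly_Mapping.single b c"
      proof (cases "Poly_Mapping.keys p = {}")
        case True
        then have "p = 0" by simp
        then show ?thesis by (metis single_zero)
      next
        case False
        then obtain b where b: "b \<in> Poly_Mapping.keys p" by blast
        have "m = b" if "m \<in> Poly_Mapping.keys p" for m
        proof (rule poly_mapping_eqI)
          fix v
          have "int (Poly_Mapping.lookup m v) = int (Poly_Mapping.lookup b v)"
            using p(2) b that unfolding mpoly_component_def by auto
          then show "Poly_Mapping.lookup m v = Poly_Mapping.lookup b v" by simp
        qed
        then have "Poly_Mapping.keys p = {b}" using b by blast
        then have "p = Poly_Mapping.single b (Poly_Mapping.lookup p b)" using poly_expansion[of p] by simp
        then show ?thesis by blast
      qed
      moreover have fS: "f \<in> S" using f(1) a(2) by (auto simp: carrier_mpoly_ring)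
      moreover have pS: "p \<in> S" using p(2) unfolding mpoly_component_def by blast
      ultimately show ?thesis using f p smult_cls[OF fS pS] by auto
    qed blast
  qed
  from choice[OF this] obtain f where "\<forall>i. \<exists>p. i < length D \<longrightarrow>
      f i \<in> carrier (mpoly_ring (snd (D ! i))) \<and> f i \<in> S \<and> p \<in> S \<and>
      (\<exists>b c. p = Poly_Mapping.single b c) \<and> fst (D ! i) = cls p \<and> y i = cls (f i * p)" ..
  from choice[OF this] obtain p where "\<forall>i. i < length D \<longrightarrow>
      f i \<in> carrier (mpoly_ring (snd (D ! i))) \<and> f i \<in> S \<and> p i \<in> S \<and>
      (\<exists>b c. p i = Poly_Mapping.single b c) \<and> fst (D ! i) = cls (p i) \<and> y i = cls (f i * p i)" ..
  then have fp: "\<And>i. i < length D \<Longrightarrow> f i \<in> carrier (mpoly_ring (snd (D ! i)))"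
    "\<And>i. i < length D \<Longrightarrow> f i \<in> S" "\<And>i. i < length D \<Longrightarrow> p i \<in> S"
    "\<And>i. i < length D \<Longrightarrow> \<exists>b c. p i = Poly_Mapping.single b c"
    "\<And>i. i < length D \<Longrightarrow> fst (D ! i) = cls (p i)"
    "\<And>i. i < length D \<Longrightarrow> y i = cls (f i * p i)"
    by blast+
  have "finsum M y {..<length D} = finsum M (\<lambda>i. cls (f i * p i)) {..<length D}"
    using fp by (intro M.finsum_cong') (auto simp: cls_in_M mult_S)
  also have "\<dots> = cls (\<Sum>i<length D. f i * p i)"
    using fp by (intro finsum_cls) (auto simp: mult_S)
  finally have "cls u = cls (\<Sum>i<length D. f i * p i)" using y(2) by simp
  moreover have "(\<Sum>i<length D. f i * p i) \<in> S"
    using fp(2,3) by (intro mpoly_ring_sum mult_S) simp_all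
  ultimately have "u - (\<Sum>i<length D. f i * p i) \<in> I" using cls_eq_iff[OF uS] by blast
  \<comment> \<open>A monomial with independent support does not occur in any element of \<open>I\<close>.\<close>
  then have "?m \<notin> Poly_Mapping.keys (u - (\<Sum>i<length D. f i * p i))"
    using F mem_I_iff keys_squarefree_monomial[OF finF] unfolding maximal_independent_def by metis
  then have "(\<Sum>i<length D. Poly_Mapping.lookup (f i * p i) ?m) = 1"
    by (simp add: u_def in_keys_iff lookup_minus lookup_sum)
  then obtain i where i: "i < length D" "Poly_Mapping.lookup (f i * p i) ?m \<noteq> 0"
    by (metis (no_types, lifting) lessThan_iff sum.neutral zero_neq_one)
  then have "?m \<in> Poly_Mapping.keys (f i * p i)" by (simp add: in_keys_iff)
  then obtain m b where mb: "?m = m + b" "m \<in> Poly_Mapping.keys (f i)" "b \<in> Poly_Mapping.keys (p i)"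
    using keys_mult[of "f i" "p i"] by blast
  obtain w A where wA: "D ! i = (w, A)" by fastforce
  have in_D: "(w, A) \<in> set D" using wA i(1) by (metis nth_mem)
  have w: "w = cls (p i)" and fA: "f i \<in> carrier (mpoly_ring A)" using fp[OF i(1)] wA by auto
  have AV: "A \<subseteq> verts G" and free: "\<And>g. g \<in> carrier (mpoly_ring A) \<Longrightarrow> g \<odot>\<^bsub>M\<^esub> w = \<zero>\<^bsub>M\<^esub> \<Longrightarrow> g = 0"
    using D in_D unfolding stanley_decomposition_def by auto
  obtain c where p: "p i = Poly_Mapping.single b c"
    using fp(4)[OF i(1)] mb(3) by (auto split: if_splits)
  have "A \<subseteq> F"
  proof
    fix v assume v: "v \<in> A"
    show "v \<in> F"
    proof (rule ccontr)
      assume "v \<notin> F"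
      define t where "t = Poly_Mapping.single v 1 + m"
      have tA: "Poly_Mapping.keys t \<subseteq> A"
        using fA mb(2) v unfolding t_def by (auto simp: keys_monomial_add carrier_mpoly_ring)
      let ?g = "Poly_Mapping.single t (1::'k)"
      have gA: "?g \<in> carrier (mpoly_ring A)" by (rule mpoly_ring_single[OF tA])
      have gS: "?g \<in> S" by (rule mpoly_ring_single) (use tA AV in blast)
      have "t + b = Poly_Mapping.single v 1 + ?m" unfolding t_def mb(1) by (simp add: add.assoc)
      then have keys: "Poly_Mapping.keys (t + b) = insert v F"
        using keys_squarefree_monomial[OF finF] by (simp add: keys_monomial_add)
      have "?g * p i \<in> S" using gS fp(3)[OF i(1)] by (rule mult_S)
      moreover have "\<not> independent G (insert v F)"
        using F v AV \<open>v \<notin> F\<close> unfolding maximal_independent_def by blast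
      ultimately have "?g * p i \<in> I" unfolding mem_I_iff p
        using keys by (simp add: mult_single)
      then have "?g \<odot>\<^bsub>M\<^esub> w = \<zero>\<^bsub>M\<^esub>"
        unfolding w using smult_cls[OF gS fp(3)[OF i(1)]] cls_eq_zero_iff mult_S[OF gS fp(3)[OF i(1)]]
        by simp
      then have "?g = 0" by (rule free[OF gA])
      then show False by (metis lookup_single_eq lookup_zero zero_neq_one)
    qed
  qed
  then have "card A \<le> card F" by (rule card_mono[OF finF])
  moreover have "sdepth_of D \<le> enat (card A)"
    unfolding sdepth_of_def by (rule INF_lower2[OF in_D]) simp
  ultimately show "sdepth_of D \<le> enat (card F)" by (meson enat_ord_simps(1) order_trans)
qed

end

context edge_ring
begin

definition total_degree :: "('v \<Rightarrow>\<^sub>0 nat) \<Rightarrow> nat" where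
  "total_degree m = (\<Sum>v\<in>verts G. Poly_Mapping.lookup m v)"

lemma total_degree_add: "total_degree (a + b) = total_degree a + total_degree b"
  by (simp add: total_degree_def lookup_add sum.distrib)

text \<open>Each factor from the sequence has no constant term, so it contributes at least 1 to the degree.
In particular a monomial outside \<open>I\<close> does not lie in high powers of the ideal of the sequence.\<close>

lemma adic_degree:
  assumes seq: "ring_sequence S I f" and f0: "\<And>i. Poly_Mapping.lookup (f i) 0 = 0"
    and p: "p \<in> ring_sequence.adic I f i k S" "m \<in> Poly_Mapping.keys p" "independent G (Poly_Mapping.keys m)"
  shows "k \<le> total_degree m"
proof -
  interpret ring_sequence S I f by (rule seq)
  \<comment> \<open>The set \<open>S\<close> becomes a variable for the induction over the recursion of the filtration.\<close>
  define L where "L = S"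
  have "p \<in> adic i k L \<Longrightarrow> m \<in> Poly_Mapping.keys p \<Longrightarrow> independent G (Poly_Mapping.keys m) \<Longrightarrow> k \<le> total_degree m"
    for p m
  proof (induction i k L arbitrary: p m rule: adic.induct)
    case (2 k L)
    then show ?case by (simp add: mem_I_iff)
  next
    case (3 i k L)
    obtain a b where ab: "p = f i * a + b" "a \<in> adic (Suc i) k L" "b \<in> adic i (Suc k) L"
      using 3(3) by (rule adicE)
    then consider "m \<in> Poly_Mapping.keys (f i * a)" | "m \<in> Poly_Mapping.keys b"
      using 3(4) Poly_Mapping.keys_add[of "f i * a" b] by blast
    then show ?case
    proof cases
      case 1
      then obtain s t where st: "m = s + t" "s \<in> Poly_Mapping.keys (f i)" "t \<in> Poly_Mapping.keys a"
        using keys_mult[of "f i" a] by blast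
      have "k \<le> total_degree t"
        using 3(1)[OF ab(2) st(3)] 3(5) independent_subset unfolding st(1) keys_monomial_add by blast
      moreover have "total_degree s \<noteq> 0"
      proof
        assume "total_degree s = 0"
        then have "\<forall>v\<in>verts G. Poly_Mapping.lookup s v = 0"
          using finite_verts by (simp add: total_degree_def)
        moreover have "Poly_Mapping.keys s \<subseteq> verts G" using f_S[of i] st(2) by (auto simp: carrier_mpoly_ring)
        ultimately have "s = 0" by (metis in_keys_iff poly_mapping_eqI subsetD lookup_zero)
        then show False using f0[of i] st(2) by (simp add: in_keys_iff)
      qed
      ultimately show ?thesis by (simp add: st(1) total_degree_add)
    next
      case 2
      then show ?thesis using 3(2)[OF ab(3)] 3(5) by blast
    qed
  qed simp
  then show ?thesis using p unfolding L_def by blast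
qed

text \<open>If \<open>r > |F|\<close>, consider the products of powers of \<open>f\<^sub>0, \<dots>, f\<^sub>r\<^sub>-\<^sub>1\<close> with exponents up to \<open>k\<close>. For
large \<open>k\<close> there are more of them than monomials in \<open>K[F]\<close> that can occur in them, as the numbers
grow like \<open>k^r\<close> and at most like \<open>k^|F|\<close>. So some nontrivial combination \<open>P\<close> has no monomial in \<open>K[F]\<close> at all, and then
\<open>P u \<in> I\<close> for the product \<open>u\<close> of the variables in \<open>F\<close>. This contradicts algebraic independence.\<close>

theorem depth_le_card_maximal_independent:
  assumes F: "maximal_independent G F"
  shows "depth (verts G) M \<le> enat (card F)"
  unfolding depth_def
proof (rule Sup_least, clarify)
  fix fs :: "('v, 'k) mpoly list"
  assume max: "set fs \<subseteq> graded_max_ideal (verts G)" and regular: "regular_sequence R M fs"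
  define r where "r = length fs"
  define f where "f = seq_fun fs"
  have fs: "set fs \<subseteq> S" using regular unfolding regular_sequence_def by blast
  have seq: "ring_sequence S I f" unfolding f_def by (rule ring_sequence_seq_fun[OF fs])
  have f0: "Poly_Mapping.lookup (f i) 0 = 0" for i
  proof (cases "i < length fs")
    case True
    then have "f i \<in> graded_max_ideal (verts G)" using max nth_mem[OF True]
      unfolding f_def seq_fun_def by (simp only: if_True) blast
    then show ?thesis using graded_max_ideal_subset by blast
  qed (simp add: f_def seq_fun_def)
  interpret ring_sequence S I f by (rule seq)
  have reg: "p \<in> partial_ideal i" if "i < r" "p \<in> S" "f i * p \<in> partial_ideal i" for i p
    using regular that unfolding regular_sequence_iff f_def r_def by blast
  have finF: "finite F" and FV: "F \<subseteq> verts G" and indF: "independent G F" using F finite_verts finite_subset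
    unfolding maximal_independent_def by auto
  define d where "d = card F"
  let ?m = "squarefree_monomial F"
  define u :: "('v, 'k) mpoly" where "u = Poly_Mapping.single ?m 1"
  have uS: "u \<in> S" unfolding u_def using FV by (intro mpoly_ring_single) (simp add: keys_squarefree_monomial finF)
  have deg_m: "total_degree ?m = d"
    using FV finite_verts by (simp add: total_degree_def lookup_squarefree_monomial finF d_def sum.If_cases Int_absorb1)
  have u_out: "u \<notin> adic r (Suc d) S"
    using adic_degree[OF ring_sequence_axioms f0, of u r "Suc d" ?m] indF deg_m
    by (auto simp: u_def keys_squarefree_monomial finF)
  have "r \<le> d"
  proof (rule ccontr)
    assume "\<not> r \<le> d"
    then have rd: "Suc d \<le> r" by simp
    \<comment> \<open>\<open>e\<close> bounds all exponents in the given sequence, so that \<open>D\<close> bounds all exponents in the products.\<close>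
    define E where "E = (\<Union>j<r. \<Union>m\<in>Poly_Mapping.keys (f j). Poly_Mapping.lookup m ` verts G)"
    define e where "e = Max (insert 0 E)"
    have "finite E" unfolding E_def using finite_verts by auto
    then have eE: "x \<le> e" if "x \<in> E" for x unfolding e_def using that by auto
    have f_exp: "Poly_Mapping.lookup m v \<le> e" if "j < r" "m \<in> Poly_Mapping.keys (f j)" for j m v
    proof (cases "v \<in> verts G")
      case True
      then show ?thesis using eE that unfolding E_def by blast
    next
      case False
      then have "v \<notin> Poly_Mapping.keys m" using f_S[of j] that by (auto simp: carrier_mpoly_ring)
      then show ?thesis by (simp add: in_keys_iff)
    qed
    obtain k where k: "(e * r * k + 1) ^ d < (k + 1) ^ r"
      using polynomial_growth_exceeds[of d r "e * r"] rd by auto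
    define D where "D = e * r * k"
    define A where "A = {\<alpha> :: nat \<Rightarrow> nat. (\<forall>j<r. \<alpha> j \<le> k) \<and> (\<forall>j\<ge>r. \<alpha> j = 0)}"
    define B where "B = {m :: 'v \<Rightarrow>\<^sub>0 nat. Poly_Mapping.keys m \<subseteq> F \<and> (\<forall>v. Poly_Mapping.lookup m v \<le> D)}"
    have A: "finite A" "card A = (k + 1) ^ r"
      unfolding A_def by (rule card_bounded_exponents)+
    have B: "finite B" "card B \<le> (D + 1) ^ d"
      unfolding B_def d_def by (rule finite_bounded_monomials[OF finF])+
    have "card B < card A" using A(2) B(2) k unfolding D_def by linarith
    then obtain g :: "(nat \<Rightarrow> nat) \<Rightarrow> 'k" where g: "\<exists>\<alpha>\<in>A. g \<alpha> \<noteq> 0"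
      "\<forall>m\<in>B. (\<Sum>\<alpha>\<in>A. g \<alpha> * Poly_Mapping.lookup (power_product r \<alpha>) m) = 0"
      using homogeneous_system_nontrivial_solution[OF B(1) A(1), of "\<lambda>\<alpha>. Poly_Mapping.lookup (power_product r \<alpha>)"]
      by blast
    define P where "P = (\<Sum>\<alpha>\<in>A. Poly_Mapping.single 0 (g \<alpha>) * power_product r \<alpha>)"
    have pow_exp: "Poly_Mapping.lookup m v \<le> e * n" if "j < r" "m \<in> Poly_Mapping.keys (f j ^ n)" for j n m v
      using that(2)
    proof (induction n arbitrary: m v)
      case (Suc n)
      have "Poly_Mapping.lookup m v \<le> e + e * n"
        by (rule exponent_bound_mult[of "f j" e "f j ^ n"]) (use Suc f_exp[OF that(1)] in simp_all)
      then show ?case by simp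
    qed (simp add: in_keys_iff lookup_one when_def split: if_splits)
    have prod_exp: "Poly_Mapping.lookup m v \<le> e * j * k"
      if "\<alpha> \<in> A" "j \<le> r" "m \<in> Poly_Mapping.keys (power_product j \<alpha>)" for \<alpha> j m v
      using that(2,3)
    proof (induction j arbitrary: m v)
      case 0
      then show ?case by (simp add: power_product_def)
    next
      case (Suc j)
      have "Poly_Mapping.lookup m v \<le> e * j * k + e * \<alpha> j"
        by (rule exponent_bound_mult[of "power_product j \<alpha>" _ "f j ^ \<alpha> j"])
          (use Suc pow_exp[of j] in \<open>simp_all add: power_product_def\<close>)
      also have "\<dots> \<le> e * j * k + e * k" using that(1) Suc(2) unfolding A_def by auto
      finally show ?case by (simp add: algebra_simps)
    qed
    have PS: "P \<in> S" unfolding P_def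
      using aboveD(2)[OF above_adic[OF above_S] power_product_adic]
      by (intro mpoly_ring_sum mult_S mpoly_ring_single) auto
    have "P * u \<in> I" unfolding mem_I_iff
    proof (intro conjI ballI notI)
      show "P * u \<in> S" using PS uS by (rule mult_S)
      fix n assume n: "n \<in> Poly_Mapping.keys (P * u)" and ind: "independent G (Poly_Mapping.keys n)"
      obtain m where m: "m \<in> Poly_Mapping.keys P" "n = ?m + m"
        by (rule keys_times_monomial[of n ?m 1 P]) (use n in \<open>simp add: u_def mult.commute\<close>)
      have keys_n: "Poly_Mapping.keys n = F \<union> Poly_Mapping.keys m"
        using m(2) by (simp add: keys_monomial_add keys_squarefree_monomial finF)
      have "Poly_Mapping.keys m \<subseteq> F"
      proof
        fix v assume v: "v \<in> Poly_Mapping.keys m"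
        show "v \<in> F"
        proof (rule ccontr)
          assume "v \<notin> F"
          moreover have "v \<in> verts G" using PS m(1) v by (auto simp: carrier_mpoly_ring)
          ultimately have "\<not> independent G (insert v F)" using F unfolding maximal_independent_def by blast
          then show False using ind independent_subset[of G _ "insert v F"] v keys_n by blast
        qed
      qed
      have look: "Poly_Mapping.lookup P m = (\<Sum>\<alpha>\<in>A. g \<alpha> * Poly_Mapping.lookup (power_product r \<alpha>) m)"
        by (simp add: P_def lookup_sum lookup_const_times)
      then obtain \<alpha> where \<alpha>: "\<alpha> \<in> A" "g \<alpha> * Poly_Mapping.lookup (power_product r \<alpha>) m \<noteq> 0"
        using m(1) by (metis (no_types, lifting) in_keys_iff sum.neutral)
      then have "m \<in> Poly_Mapping.keys (power_product r \<alpha>)" by (auto simp: in_keys_iff)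
      then have "Poly_Mapping.lookup m v \<le> D" for v
        using prod_exp[OF \<alpha>(1) order_refl] unfolding D_def by blast
      then have "m \<in> B" unfolding B_def using \<open>Poly_Mapping.keys m \<subseteq> F\<close> by blast
      then have "Poly_Mapping.lookup P m = 0" using g(2) look by simp
      then show False using m(1) by (simp add: in_keys_iff)
    qed
    moreover have "P * u \<notin> I"
      unfolding P_def
    proof (rule regular_sequence_independent[OF reg uS u_out A(1)])
      show "\<alpha> j = 0" if "\<alpha> \<in> A" "j \<ge> r" for \<alpha> j using that unfolding A_def by blast
      have nonzero: "Poly_Mapping.single 0 c = (0 :: ('v, 'k) mpoly) \<longleftrightarrow> c = 0" for c
        by (metis lookup_single_eq lookup_zero single_zero)
      show "\<exists>\<alpha>\<in>A. Poly_Mapping.single 0 (g \<alpha>) \<noteq> (0 :: ('v, 'k) mpoly)"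
        using g(1) by (simp add: nonzero)
      fix \<alpha>
      have const: "Poly_Mapping.single 0 c \<in> S" for c by (rule mpoly_ring_single) simp
      show "Poly_Mapping.single 0 (g \<alpha>) \<in> S \<and> (Poly_Mapping.single 0 (g \<alpha>) = (0 :: ('v, 'k) mpoly) \<or>
          (\<exists>h\<in>S. h * Poly_Mapping.single 0 (g \<alpha>) = 1))"
      proof (cases "g \<alpha> = 0")
        case False
        then have unit: "Poly_Mapping.single 0 (inverse (g \<alpha>)) * Poly_Mapping.single 0 (g \<alpha>) = (1 :: ('v, 'k) mpoly)"
          by (simp add: mult_single)
        show ?thesis by (intro conjI disjI2 bexI) (rule const, rule unit, rule const)
      qed (simp add: mpoly_ring_zero)
    qed
    ultimately show False by blast
  qed
  then show "enat (length fs) \<le> enat (card F)" by (simp add: r_def d_def)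
qed

end

section \<open>Triangular sequences are regular\<close>

text \<open>The monomials in \<open>B\<close> represent a basis of \<open>S/I\<close>. Multiplication of \<open>m \<in> B\<close> by \<open>f\<^sub>j\<close> gives \<open>\<sigma>\<^sub>j m\<close>
plus terms of smaller weight. The maps \<open>\<sigma>\<^sub>j\<close> on \<open>B\<close> behave like multiplication by different
variables: they are injective, and for \<open>k \<noteq> j\<close> the image of \<open>\<sigma>\<^sub>k\<close> contains \<open>\<sigma>\<^sub>j m\<close> only if it
contains \<open>m\<close>. The weights are
well-ordered, which makes reduction terminate.\<close>

locale triangular_sequence = mpoly_quotient V I + ring_sequence "carrier (mpoly_ring V)" I f
  for V :: "'v set" and I :: "('v, 'k::field) mpoly set" and f :: "nat \<Rightarrow> ('v, 'k) mpoly" +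
  fixes B :: "('v \<Rightarrow>\<^sub>0 nat) set" and \<sigma> :: "nat \<Rightarrow> ('v \<Rightarrow>\<^sub>0 nat) \<Rightarrow> ('v \<Rightarrow>\<^sub>0 nat)"
    and \<omega> :: "('v \<Rightarrow>\<^sub>0 nat) \<Rightarrow> 'o::wellorder" and r :: nat
  assumes B_keys: "m \<in> B \<Longrightarrow> Poly_Mapping.keys m \<subseteq> V"
    and mem_I: "p \<in> I \<longleftrightarrow> p \<in> carrier (mpoly_ring V) \<and> Poly_Mapping.keys p \<inter> B = {}"
    and shift_B: "j < r \<Longrightarrow> m \<in> B \<Longrightarrow> \<sigma> j m \<in> B"
    and shift_inj: "j < r \<Longrightarrow> inj_on (\<sigma> j) B"
    and shift_image: "j < r \<Longrightarrow> k < r \<Longrightarrow> j \<noteq> k \<Longrightarrow> m \<in> B \<Longrightarrow> \<sigma> j m \<in> \<sigma> k ` B \<Longrightarrow> m \<in> \<sigma> k ` B"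
    and leading: "j < r \<Longrightarrow> m \<in> B \<Longrightarrow> Poly_Mapping.lookup (f j * Poly_Mapping.single m 1) (\<sigma> j m) = 1"
    and lower: "j < r \<Longrightarrow> m \<in> B \<Longrightarrow> m' \<in> B \<Longrightarrow>
      m' \<in> Poly_Mapping.keys (f j * Poly_Mapping.single m 1) \<Longrightarrow> m' = \<sigma> j m \<or> \<omega> m' < \<omega> (\<sigma> j m)"
begin

abbreviation mon :: "('v \<Rightarrow>\<^sub>0 nat) \<Rightarrow> ('v, 'k) mpoly" where
  "mon m \<equiv> Poly_Mapping.single m 1"

definition reduced :: "nat \<Rightarrow> ('v \<Rightarrow>\<^sub>0 nat) set" where
  "reduced i = {m \<in> B. \<forall>j<i. m \<notin> \<sigma> j ` B}"

text \<open>A normal form modulo \<open>f\<^sub>0, \<dots>, f\<^sub>i\<^sub>-\<^sub>1\<close>, together with control over the weights of its monomials.\<close>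

definition reducible_to :: "nat \<Rightarrow> 'o set \<Rightarrow> ('v, 'k) mpoly \<Rightarrow> bool" where
  "reducible_to i U p \<longleftrightarrow>
     (\<exists>a. Poly_Mapping.keys a \<subseteq> reduced i \<and> \<omega> ` Poly_Mapping.keys a \<subseteq> U \<and> p - a \<in> partial_ideal i)"

lemmas pideal = aboveD[OF above_adic[OF above_S]]

lemma mon_S: "m \<in> B \<Longrightarrow> mon m \<in> S"
  by (intro mpoly_ring_single B_keys)

lemma const_S: "Poly_Mapping.single 0 c \<in> S"
  by (rule mpoly_ring_single) simp

lemma keys_B_S: "Poly_Mapping.keys a \<subseteq> B \<Longrightarrow> a \<in> S"
  using B_keys by (auto simp: carrier_mpoly_ring)

lemma reduced_B: "reduced i \<subseteq> B"
  by (auto simp: reduced_def)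

lemma reducible_mono: "reducible_to i U p \<Longrightarrow> U \<subseteq> U' \<Longrightarrow> reducible_to i U' p"
  unfolding reducible_to_def by blast

lemma reducible_cong:
  assumes "reducible_to i U p" "q - p \<in> partial_ideal i"
  shows "reducible_to i U q"
proof -
  obtain a where a: "Poly_Mapping.keys a \<subseteq> reduced i" "\<omega> ` Poly_Mapping.keys a \<subseteq> U" "p - a \<in> partial_ideal i"
    using assms(1) unfolding reducible_to_def by blast
  have "(q - p) + (p - a) \<in> partial_ideal i" using assms(2) a(3) by (rule pideal(7))
  then have "q - a \<in> partial_ideal i" by simp
  then show ?thesis unfolding reducible_to_def using a by blast
qed

lemma reducible_add:
  assumes "reducible_to i U p" "reducible_to i U q"
  shows "reducible_to i U (p + q)"
proof -
  obtain a b where ab: "Poly_Mapping.keys a \<subseteq> reduced i" "\<omega> ` Poly_Mapping.keys a \<subseteq> U" "p - a \<in> partial_ideal i"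
    "Poly_Mapping.keys b \<subseteq> reduced i" "\<omega> ` Poly_Mapping.keys b \<subseteq> U" "q - b \<in> partial_ideal i"
    using assms unfolding reducible_to_def by blast
  have "(p - a) + (q - b) \<in> partial_ideal i" using ab(3,6) by (rule pideal(7))
  then have "p + q - (a + b) \<in> partial_ideal i" by (simp add: algebra_simps)
  then show ?thesis unfolding reducible_to_def
    using ab Poly_Mapping.keys_add[of a b] by (intro exI[of _ "a + b"]) blast
qed

lemma reducible_scale:
  assumes "reducible_to i U p"
  shows "reducible_to i U (Poly_Mapping.single 0 c * p)"
proof -
  obtain a where a: "Poly_Mapping.keys a \<subseteq> reduced i" "\<omega> ` Poly_Mapping.keys a \<subseteq> U" "p - a \<in> partial_ideal i"
    using assms unfolding reducible_to_def by blast
  have "Poly_Mapping.single 0 c * (p - a) \<in> partial_ideal i" using pideal(4)[OF const_S a(3)] .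
  then have "Poly_Mapping.single 0 c * p - Poly_Mapping.single 0 c * a \<in> partial_ideal i"
    by (simp add: right_diff_distrib)
  moreover have "Poly_Mapping.keys (Poly_Mapping.single 0 c * a) \<subseteq> Poly_Mapping.keys a"
    by (auto simp: in_keys_iff lookup_const_times)
  ultimately show ?thesis unfolding reducible_to_def using a by blast
qed

lemma reducible_zero: "reducible_to i U 0"
  unfolding reducible_to_def by (intro exI[of _ 0]) (simp add: pideal(5))

lemma reducible_self:
  assumes "m \<in> reduced i" "\<omega> m \<in> U"
  shows "reducible_to i U (mon m)"
proof -
  have "mon m - mon m \<in> partial_ideal i" unfolding diff_self by (rule pideal(5))
  moreover have "Poly_Mapping.keys (mon m) \<subseteq> reduced i" "\<omega> ` Poly_Mapping.keys (mon m) \<subseteq> U"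
    using assms by simp_all
  ultimately show ?thesis unfolding reducible_to_def by blast
qed

lemma reducible_sum: "(\<And>x. x \<in> A \<Longrightarrow> reducible_to i U (h x)) \<Longrightarrow> reducible_to i U (sum h A)"
  by (induction A rule: infinite_finite_induct) (auto simp: reducible_zero reducible_add)

lemma single_conv_const: "Poly_Mapping.single m c = Poly_Mapping.single 0 c * mon m"
  by (simp add: mult_single)

lemma reducible_lift:
  assumes "p \<in> S" "\<And>m. m \<in> Poly_Mapping.keys p \<Longrightarrow> m \<in> B \<Longrightarrow> reducible_to i U (mon m)"
  shows "reducible_to i U p"
proof -
  have "reducible_to i U (Poly_Mapping.single m (Poly_Mapping.lookup p m))"
    if m: "m \<in> Poly_Mapping.keys p" for m
  proof (cases "m \<in> B")
    case True
    then show ?thesis unfolding single_conv_const[of m "Poly_Mapping.lookup p m"]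
      using assms(2)[OF m] by (intro reducible_scale)
  next
    case False
    let ?t = "Poly_Mapping.single m (Poly_Mapping.lookup p m)"
    have "?t \<in> S" using assms(1) m by (intro mpoly_ring_single) (auto simp: carrier_mpoly_ring)
    then have "?t \<in> I" using False by (simp add: mem_I)
    then have "?t - 0 \<in> partial_ideal i" using pideal(1) by simp
    then show ?thesis using reducible_zero reducible_cong by blast
  qed
  then have "reducible_to i U (\<Sum>m\<in>Poly_Mapping.keys p. Poly_Mapping.single m (Poly_Mapping.lookup p m))"
    by (rule reducible_sum)
  then show ?thesis by (simp add: poly_expansion[symmetric])
qed

text \<open>First \<open>m\<close> is reduced with respect to the first \<open>i\<close> elements. A monomial of the result in the
image of \<open>\<sigma>\<^sub>i\<close>, say \<open>\<sigma>\<^sub>i n\<close>, equals \<open>f\<^sub>i n\<close> up to terms of smaller weight than that of \<open>m\<close>;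
these are reducible by induction on the weight.\<close>

lemma reducible_Suc_index:
  assumes i: "i < r" and IH: "\<And>m. m \<in> B \<Longrightarrow> reducible_to i {..\<omega> m} (mon m)"
  shows "m \<in> B \<Longrightarrow> reducible_to (Suc i) {..\<omega> m} (mon m)"
proof (induction "\<omega> m" arbitrary: m rule: less_induct)
  case less
  obtain a where a: "Poly_Mapping.keys a \<subseteq> reduced i" "\<omega> ` Poly_Mapping.keys a \<subseteq> {..\<omega> m}"
    "mon m - a \<in> partial_ideal i"
    using IH[OF less(2)] unfolding reducible_to_def by blast
  have "reducible_to (Suc i) {..\<omega> m} a"
  proof (rule reducible_lift)
    show "a \<in> S" using a(1) reduced_B keys_B_S by blast
    fix m' assume m': "m' \<in> Poly_Mapping.keys a" "m' \<in> B"
    show "reducible_to (Suc i) {..\<omega> m} (mon m')"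
    proof (cases "m' \<in> \<sigma> i ` B")
      case False
      then have "m' \<in> reduced (Suc i)" using m' a(1) by (auto simp: reduced_def less_Suc_eq)
      then show ?thesis by (rule reducible_self) (use m'(1) a(2) in blast)
    next
      case True
      then obtain n where n: "n \<in> B" "m' = \<sigma> i n" by blast
      define h where "h = mon m' - f i * mon n"
      have fS: "f i * mon n \<in> S" using f_S mon_S[OF n(1)] by (rule mult_S)
      have "reducible_to (Suc i) {..\<omega> m} h"
      proof (rule reducible_lift)
        show "h \<in> S" unfolding h_def using mon_S[OF m'(2)] fS by (rule diff_S)
        fix k assume k: "k \<in> Poly_Mapping.keys h" "k \<in> B"
        have "k \<noteq> m'" using k(1) leading[OF i n(1)] n(2)
          by (auto simp: h_def in_keys_iff lookup_minus)
        then have "k \<in> Poly_Mapping.keys (f i * mon n)"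
          using k(1) by (auto simp: h_def in_keys_iff lookup_minus lookup_single)
        then have "\<omega> k < \<omega> m'" using lower[OF i n(1) k(2)] \<open>k \<noteq> m'\<close> n(2) by blast
        moreover have "\<omega> m' \<le> \<omega> m" using a(2) m'(1) by blast
        ultimately have "\<omega> k < \<omega> m" by simp
        from less(1)[OF this k(2)] show "reducible_to (Suc i) {..\<omega> m} (mon k)"
          by (rule reducible_mono) (use \<open>\<omega> k < \<omega> m\<close> in auto)
      qed
      moreover have "mon m' - h \<in> partial_ideal (Suc i)"
      proof -
        have "f i * mon n \<in> adic (Suc i) (Suc 0) S"
          by (rule adic_mult_f[OF above_S]) (use mon_S[OF n(1)] in simp_all)
        then show ?thesis by (simp add: h_def)
      qed
      ultimately show ?thesis by (rule reducible_cong)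
    qed
  qed
  moreover have "mon m - a \<in> partial_ideal (Suc i)" using a(3) adic_Suc_index[OF above_S] by blast
  ultimately show ?case by (rule reducible_cong)
qed

lemma reducible: "i \<le> r \<Longrightarrow> m \<in> B \<Longrightarrow> reducible_to i {..\<omega> m} (mon m)"
proof (induction i arbitrary: m)
  case 0
  then show ?case by (intro reducible_self) (simp_all add: reduced_def)
next
  case (Suc i)
  then show ?case using reducible_Suc_index[of i m] by simp
qed

lemma reduced_representative:
  assumes "i \<le> r" "p \<in> S"
  obtains a where "Poly_Mapping.keys a \<subseteq> reduced i" "p - a \<in> partial_ideal i"
proof -
  have "reducible_to i UNIV p"
    by (rule reducible_lift[OF assms(2)], rule reducible_mono[OF reducible[OF assms(1)]]) simp_all
  then show ?thesis using that unfolding reducible_to_def by blast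
qed

text \<open>In \<open>f\<^sub>i a\<close> the terms \<open>\<sigma>\<^sub>i m\<close> are reduced already, because the \<open>m\<close> are. All other terms, and so also
their normal forms, have weights below the largest weight \<open>s\<close> of the \<open>\<sigma>\<^sub>i m\<close>, and hence cannot
cancel the term of weight \<open>s\<close>.\<close>

lemma leading_term_survives:
  assumes i: "i < r" and a: "Poly_Mapping.keys a \<subseteq> reduced i" "a \<noteq> 0"
  obtains b m where "Poly_Mapping.keys b \<subseteq> reduced i" "f i * a - b \<in> partial_ideal i"
    "m \<in> B" "Poly_Mapping.lookup b (\<sigma> i m) \<noteq> 0"
proof -
  let ?K = "Poly_Mapping.keys a"
  have KB: "?K \<subseteq> B" using a(1) reduced_B by blast
  define s where "s = Max ((\<lambda>m. \<omega> (\<sigma> i m)) ` ?K)"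
  have ne: "?K \<noteq> {}" using a(2) by simp
  have "s \<in> (\<lambda>m. \<omega> (\<sigma> i m)) ` ?K" unfolding s_def using ne by (intro Max_in) auto
  then obtain m0 where m0: "m0 \<in> ?K" "\<omega> (\<sigma> i m0) = s" by blast
  have s_max: "\<omega> (\<sigma> i m) \<le> s" if "m \<in> ?K" for m
    unfolding s_def using that by (intro Max_ge) auto
  define lead where "lead = (\<Sum>m\<in>?K. Poly_Mapping.single (\<sigma> i m) (Poly_Mapping.lookup a m))"
  have f_a: "f i * a = (\<Sum>m\<in>?K. Poly_Mapping.single 0 (Poly_Mapping.lookup a m) * (f i * mon m))"
  proof -
    have "f i * a = f i * (\<Sum>m\<in>?K. Poly_Mapping.single 0 (Poly_Mapping.lookup a m) * mon m)"
      by (subst poly_expansion[of a]) (simp only: single_conv_const[symmetric])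
    then show ?thesis by (simp only: sum_distrib_left mult.left_commute)
  qed
  have rest: "f i * a - lead =
      (\<Sum>m\<in>?K. Poly_Mapping.single 0 (Poly_Mapping.lookup a m) * (f i * mon m - mon (\<sigma> i m)))"
    unfolding f_a lead_def
    by (simp only: sum_subtractf[symmetric] right_diff_distrib single_conv_const[symmetric])
  have S_a: "a \<in> S" using KB by (rule keys_B_S)
  have lead_keys: "Poly_Mapping.keys lead \<subseteq> \<sigma> i ` ?K"
    unfolding lead_def using keys_sum[of "\<lambda>m. Poly_Mapping.single (\<sigma> i m) (Poly_Mapping.lookup a m)" ?K]
    by (fastforce split: if_splits)
  have lead_red: "Poly_Mapping.keys lead \<subseteq> reduced i"
  proof
    fix k assume "k \<in> Poly_Mapping.keys lead"
    then obtain m where m: "m \<in> ?K" "k = \<sigma> i m" using lead_keys by blast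
    then have mB: "m \<in> B" "\<forall>j<i. m \<notin> \<sigma> j ` B" using a(1) unfolding reduced_def by auto
    show "k \<in> reduced i" unfolding reduced_def m(2)
      using mB shift_B[OF i mB(1)] shift_image[OF i _ _ mB(1)] i by auto
  qed
  have lead_S: "lead \<in> S" using lead_red reduced_B keys_B_S by blast
  have "reducible_to i {..<s} (f i * a - lead)"
  proof (rule reducible_lift)
    show "f i * a - lead \<in> S" using f_S S_a lead_S by (intro diff_S mult_S)
    fix k assume k: "k \<in> Poly_Mapping.keys (f i * a - lead)" "k \<in> B"
    then have "(\<Sum>m\<in>?K. Poly_Mapping.lookup a m * Poly_Mapping.lookup (f i * mon m - mon (\<sigma> i m)) k) \<noteq> 0"
      unfolding rest by (simp add: in_keys_iff lookup_sum lookup_const_times)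
    then obtain m where m: "m \<in> ?K" "Poly_Mapping.lookup (f i * mon m - mon (\<sigma> i m)) k \<noteq> 0"
      by (metis (no_types, lifting) mult_zero_right sum.neutral)
    have mB: "m \<in> B" using m(1) KB by blast
    have "k \<noteq> \<sigma> i m" using m(2) leading[OF i mB] by (auto simp: lookup_minus)
    moreover from this have "k \<in> Poly_Mapping.keys (f i * mon m)"
      using m(2) by (auto simp: lookup_minus lookup_single in_keys_iff)
    ultimately have "\<omega> k < s" using lower[OF i mB k(2)] s_max[OF m(1)] by fastforce
    then show "reducible_to i {..<s} (mon k)"
      by (intro reducible_mono[OF reducible]) (use i k(2) in auto)
  qed
  then obtain a' where a': "Poly_Mapping.keys a' \<subseteq> reduced i" "\<omega> ` Poly_Mapping.keys a' \<subseteq> {..<s}"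
    "f i * a - lead - a' \<in> partial_ideal i" unfolding reducible_to_def by blast
  show ?thesis
  proof
    show "Poly_Mapping.keys (lead + a') \<subseteq> reduced i"
      using lead_red a'(1) Poly_Mapping.keys_add[of lead a'] by blast
    show "f i * a - (lead + a') \<in> partial_ideal i" using a'(3) by (simp add: algebra_simps)
    show "m0 \<in> B" using m0(1) KB by blast
    have "\<sigma> i m0 \<notin> Poly_Mapping.keys a'" using a'(2) m0(2) by auto
    then have 0: "Poly_Mapping.lookup a' (\<sigma> i m0) = 0" by (simp add: in_keys_iff)
    have "Poly_Mapping.lookup (Poly_Mapping.single (\<sigma> i m) (Poly_Mapping.lookup a m)) (\<sigma> i m0) =
        (if m = m0 then Poly_Mapping.lookup a m else 0)" if "m \<in> ?K" for m
      using inj_onD[OF shift_inj[OF i], of m m0] that m0(1) KB by (auto simp: lookup_single when_def)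
    then have "Poly_Mapping.lookup lead (\<sigma> i m0) = (\<Sum>m\<in>?K. if m = m0 then Poly_Mapping.lookup a m else 0)"
      unfolding lead_def lookup_sum by (intro sum.cong) auto
    also have "\<dots> = Poly_Mapping.lookup a m0" using m0(1) by (simp add: sum.delta)
    finally show "Poly_Mapping.lookup (lead + a') (\<sigma> i m0) \<noteq> 0"
      using 0 m0(1) by (simp add: lookup_add in_keys_iff)
  qed
qed

text \<open>Normal forms are unique. If \<open>a\<close> is reduced for \<open>i + 1\<close> and congruent to \<open>f\<^sub>i b\<close> with \<open>b\<close> reduced for
\<open>i\<close>, then \<open>a\<close> is the normal form of \<open>f\<^sub>i b\<close> for \<open>i\<close>. A nonzero \<open>b\<close> would make \<open>a\<close> contain a monomial
in the image of \<open>\<sigma>\<^sub>i\<close>.\<close>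

lemma reduced_unique:
  "i \<le> r \<Longrightarrow> Poly_Mapping.keys a \<subseteq> reduced i \<Longrightarrow> a \<in> partial_ideal i \<Longrightarrow> a = 0"
proof (induction i arbitrary: a)
  case 0
  then have "Poly_Mapping.keys a \<inter> B = {}" by (simp add: mem_I)
  moreover have "Poly_Mapping.keys a \<subseteq> B" using 0(2) reduced_B by blast
  ultimately have "Poly_Mapping.keys a = {}" by blast
  then show ?case by simp
next
  case (Suc i)
  have i: "i < r" and ir: "i \<le> r" using Suc by auto
  have red: "reduced (Suc i) \<subseteq> reduced i" unfolding reduced_def by (auto dest: less_SucI)
  obtain p q where pq: "a = f i * p + q" "p \<in> S" "q \<in> partial_ideal i"
    using Suc.prems(3) unfolding One_nat_def by (elim adicE) simp
  obtain b where b: "Poly_Mapping.keys b \<subseteq> reduced i" "p - b \<in> partial_ideal i"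
    using reduced_representative[OF ir pq(2)] by blast
  have "f i * (p - b) + q \<in> partial_ideal i"
    by (rule pideal(7)[OF pideal(4)[OF f_S b(2)] pq(3)])
  then have ab: "a - f i * b \<in> partial_ideal i" unfolding pq(1) by (simp add: algebra_simps)
  have "b = 0"
  proof (rule ccontr)
    assume "b \<noteq> 0"
    then obtain c m where c: "Poly_Mapping.keys c \<subseteq> reduced i" "f i * b - c \<in> partial_ideal i"
      "m \<in> B" "Poly_Mapping.lookup c (\<sigma> i m) \<noteq> 0"
      using leading_term_survives[OF i b(1)] by blast
    have "(a - f i * b) + (f i * b - c) \<in> partial_ideal i" using ab c(2) by (rule pideal(7))
    then have "a - c \<in> partial_ideal i" by simp
    moreover have "Poly_Mapping.keys (a - c) \<subseteq> reduced i"
      using keys_diff[of a c] Suc.prems(2) c(1) red by blast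
    ultimately have "a = c" using Suc.IH[OF ir, of "a - c"] by simp
    then have "\<sigma> i m \<in> reduced (Suc i)" using c(4) Suc.prems(2) by (auto simp: in_keys_iff)
    then show False using c(3) unfolding reduced_def by blast
  qed
  then have "a \<in> partial_ideal i" using ab by simp
  then show ?case using Suc.IH[OF ir] Suc.prems(2) red by blast
qed

text \<open>Modulo the first \<open>i\<close> elements, \<open>p\<close> has a normal form \<open>a\<close>, and \<open>f\<^sub>i a\<close> has a nonzero normal form
unless \<open>a = 0\<close>.\<close>

theorem triangular_regular:
  assumes i: "i < r" and p: "p \<in> S" "f i * p \<in> partial_ideal i"
  shows "p \<in> partial_ideal i"
proof -
  have ir: "i \<le> r" using i by simp
  obtain a where a: "Poly_Mapping.keys a \<subseteq> reduced i" "p - a \<in> partial_ideal i"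
    using reduced_representative[OF ir p(1)] by blast
  have "f i * (p - a) \<in> partial_ideal i" using f_S a(2) by (rule pideal(4))
  then have "f i * p - f i * (p - a) \<in> partial_ideal i" by (rule pideal(3)[OF p(2)])
  then have fa: "f i * a \<in> partial_ideal i" by (simp add: algebra_simps)
  have "a = 0"
  proof (rule ccontr)
    assume "a \<noteq> 0"
    then obtain b m where b: "Poly_Mapping.keys b \<subseteq> reduced i" "f i * a - b \<in> partial_ideal i"
      "m \<in> B" "Poly_Mapping.lookup b (\<sigma> i m) \<noteq> 0"
      using leading_term_survives[OF i a(1)] by blast
    have "f i * a - (f i * a - b) \<in> partial_ideal i" using fa b(2) by (rule pideal(3))
    then have "b = 0" using reduced_unique[OF ir b(1)] by simp
    then show False using b(4) by simp
  qed
  then show ?thesis using a(2) by simp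
qed

end

section \<open>Depth and packings of closed neighbourhoods\<close>

locale packing = edge_ring G I for G :: "'v graph" and I :: "('v, 'k::field) mpoly set" +
  fixes c :: "nat \<Rightarrow> 'v" and r :: nat
  assumes center_in_verts: "j < r \<Longrightarrow> c j \<in> verts G"
    and disjoint: "j < r \<Longrightarrow> k < r \<Longrightarrow> j \<noteq> k \<Longrightarrow>
      insert (c j) {w. {c j, w} \<in> edges G} \<inter> insert (c k) {w. {c k, w} \<in> edges G} = {}"
begin

definition nbrs :: "nat \<Rightarrow> 'v set" where
  "nbrs j = {w. {c j, w} \<in> edges G}"

definition centers :: "'v set" where
  "centers = c ` {..<r}"

text \<open>In the product of a monomial \<open>m\<close> with core \<open>W\<close> and the sum of the variables in the closed
neighbourhood of \<open>c\<^sub>j\<close>, the leading term is \<open>m\<close> times this variable. If \<open>c\<^sub>j\<close>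
has no neighbour in \<open>W\<close>, no other choice than \<open>c\<^sub>j\<close> leaves the core unchanged. Otherwise any
neighbour in \<open>W\<close> would do, and one is fixed for each \<open>W\<close>.\<close>

definition pivot_vertex :: "nat \<Rightarrow> 'v set \<Rightarrow> 'v" where
  "pivot_vertex j W = (if W \<inter> nbrs j = {} then c j else SOME w. w \<in> W \<inter> nbrs j)"

lemma pivot_vertex_cases:
  "W \<inter> nbrs j = {} \<and> pivot_vertex j W = c j \<or> pivot_vertex j W \<in> W \<inter> nbrs j"
proof (cases "W \<inter> nbrs j = {}")
  case False
  then have "pivot_vertex j W = (SOME w. w \<in> W \<inter> nbrs j)" by (simp add: pivot_vertex_def)
  moreover have "(SOME w. w \<in> W \<inter> nbrs j) \<in> W \<inter> nbrs j"
    by (rule someI_ex) (use False in blast)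
  ultimately show ?thesis by simp
qed (simp add: pivot_vertex_def)

lemma closed_nbrs_disjoint:
  "j < r \<Longrightarrow> k < r \<Longrightarrow> x \<in> insert (c j) (nbrs j) \<Longrightarrow> x \<in> insert (c k) (nbrs k) \<Longrightarrow> j = k"
  using disjoint[of j k] unfolding nbrs_def by blast

lemma nbrs_no_center: "j < r \<Longrightarrow> nbrs j \<inter> centers = {}"
proof (rule ccontr)
  assume j: "j < r" and "nbrs j \<inter> centers \<noteq> {}"
  then obtain k where k: "k < r" "c k \<in> nbrs j" unfolding centers_def by blast
  then have "j = k" using closed_nbrs_disjoint[OF j k(1), of "c k"] by blast
  then show False using k(2) no_loop[of "c j"] by (simp add: nbrs_def)
qed

lemma nbrs_verts: "nbrs j \<subseteq> verts G"
  using edge_subset unfolding nbrs_def by blast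

lemma pivot_vertex_closed_nbr: "pivot_vertex j W \<in> insert (c j) (nbrs j)"
  using pivot_vertex_cases[of W j] by blast

lemma pivot_vertex_inj: "j < r \<Longrightarrow> k < r \<Longrightarrow> pivot_vertex j W = pivot_vertex k W' \<Longrightarrow> j = k"
  using closed_nbrs_disjoint[of j k] pivot_vertex_closed_nbr[of j W] pivot_vertex_closed_nbr[of k W'] by metis

definition core :: "('v \<Rightarrow>\<^sub>0 nat) \<Rightarrow> 'v set" where
  "core m = Poly_Mapping.keys m - centers"

definition standard :: "('v \<Rightarrow>\<^sub>0 nat) set" where
  "standard = {m. Poly_Mapping.keys m \<subseteq> verts G \<and> independent G (Poly_Mapping.keys m)}"

abbreviation pivot :: "nat \<Rightarrow> ('v \<Rightarrow>\<^sub>0 nat) \<Rightarrow> 'v" where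
  "pivot j m \<equiv> pivot_vertex j (core m)"

definition shift :: "nat \<Rightarrow> ('v \<Rightarrow>\<^sub>0 nat) \<Rightarrow> ('v \<Rightarrow>\<^sub>0 nat)" where
  "shift j m = Poly_Mapping.single (pivot j m) 1 + m"

text \<open>Pairs are ordered lexicographically. A term of \<open>star_sum j * m\<close> outside \<open>I\<close> other than \<open>shift j m\<close>
is smaller for one of two reasons: its core is larger, or its core is the same and the exponents of
the pivots do not grow.\<close>

definition weight :: "('v \<Rightarrow>\<^sub>0 nat) \<Rightarrow> nat \<times> nat" where
  "weight m = (card (verts G) - card (core m), \<Sum>k<r. Poly_Mapping.lookup m (pivot k m))"

definition star_sum :: "nat \<Rightarrow> ('v, 'k) mpoly" where
  "star_sum j = (if j < r then \<Sum>w\<in>insert (c j) (nbrs j). indet w else 0)"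

lemma independent_insert_center:
  assumes "independent G A" "A \<inter> nbrs j = {}"
  shows "independent G (insert (c j) A)"
proof -
  have "{c j, u} \<notin> edges G \<and> {u, c j} \<notin> edges G" if "u \<in> A" for u
    using assms(2) that unfolding nbrs_def by (auto simp: insert_commute)
  moreover have "{c j, c j} \<notin> edges G" using no_loop by simp
  ultimately show ?thesis using assms(1) unfolding independent_def by auto
qed

lemma core_inter_nbrs: "j < r \<Longrightarrow> core m \<inter> nbrs j = Poly_Mapping.keys m \<inter> nbrs j"
  using nbrs_no_center[of j] unfolding core_def by blast

lemma core_shift: "j < r \<Longrightarrow> core (shift j m) = core m"
  using pivot_vertex_cases[of "core m" j] unfolding shift_def
  by (auto simp: core_def keys_monomial_add centers_def)

lemma shift_standard: "j < r \<Longrightarrow> m \<in> standard \<Longrightarrow> shift j m \<in> standard"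
proof -
  assume j: "j < r" and m: "m \<in> standard"
  consider "core m \<inter> nbrs j = {}" "pivot j m = c j" | "pivot j m \<in> core m"
    using pivot_vertex_cases[of "core m" j] by blast
  then show ?thesis
  proof cases
    case 1
    then have "independent G (insert (c j) (Poly_Mapping.keys m))"
      using m core_inter_nbrs[OF j] by (intro independent_insert_center) (auto simp: standard_def)
    then show ?thesis
      using m 1(2) center_in_verts[OF j] by (simp add: standard_def shift_def keys_monomial_add)
  next
    case 2
    then have "insert (pivot j m) (Poly_Mapping.keys m) = Poly_Mapping.keys m" by (auto simp: core_def)
    then show ?thesis using m by (simp add: standard_def shift_def keys_monomial_add)
  qed
qed

lemma shift_injective: "j < r \<Longrightarrow> inj_on (shift j) standard"
proof (rule inj_onI)
  fix m m' assume j: "j < r" and eq: "shift j m = shift j m'"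
  have "core m = core m'" using core_shift[OF j, of m] core_shift[OF j, of m'] eq by simp
  then show "m = m'" using eq by (simp add: shift_def)
qed

text \<open>The pivots for \<open>j\<close> and \<open>k\<close> are different variables, so the exponent of the pivot for \<open>k\<close> can be
lowered already in \<open>m\<close>. This does not change the core: if the pivot belongs to the core, its
exponent in \<open>m\<close> is at least 2.\<close>

lemma shift_image:
  assumes jk: "j < r" "k < r" "j \<noteq> k" and m: "m \<in> standard" "shift j m \<in> shift k ` standard"
  shows "m \<in> shift k ` standard"
proof -
  obtain m0 where m0: "m0 \<in> standard" "shift j m = shift k m0" using m(2) by blast
  have core0: "core m0 = core m" using core_shift[OF jk(1), of m] core_shift[OF jk(2), of m0] m0(2) by simp
  define t where "t = pivot k m"
  have "pivot j m \<noteq> t" unfolding t_def using pivot_vertex_inj[OF jk(1,2)] jk(3) by blast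
  moreover have "Poly_Mapping.single (pivot j m) 1 + m = Poly_Mapping.single t 1 + m0"
    using m0(2) core0 by (simp add: shift_def t_def)
  then have "Poly_Mapping.lookup (Poly_Mapping.single (pivot j m) 1 + m) t = Poly_Mapping.lookup (Poly_Mapping.single t 1 + m0) t"
    by (rule arg_cong)
  ultimately have look: "Poly_Mapping.lookup m t = Suc (Poly_Mapping.lookup m0 t)"
    by (simp add: lookup_add lookup_single)
  define m' where "m' = m - Poly_Mapping.single t 1"
  have m'_look: "Poly_Mapping.lookup m' v = (if v = t then Poly_Mapping.lookup m0 t else Poly_Mapping.lookup m v)" for v
    by (simp add: m'_def lookup_minus lookup_single when_def look)
  have m_eq: "m = Poly_Mapping.single t 1 + m'"
    by (rule poly_mapping_eqI) (simp add: lookup_add m'_look lookup_single when_def look)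
  have keys: "Poly_Mapping.keys m' \<subseteq> Poly_Mapping.keys m"
    by (auto simp: in_keys_iff m'_look look split: if_splits)
  have "v \<in> Poly_Mapping.keys m'" if v: "v \<in> core m" for v
  proof (cases "v = t")
    case True
    then have "t \<in> Poly_Mapping.keys m0" using v core0 by (auto simp: core_def)
    then show ?thesis using True by (simp add: in_keys_iff m'_look)
  next
    case False
    then show ?thesis using v by (auto simp: core_def in_keys_iff m'_look)
  qed
  then have "core m' = core m" using keys unfolding core_def by blast
  then have "shift k m' = m" unfolding shift_def by (simp only: m_eq[symmetric] t_def[symmetric])
  moreover have "m' \<in> standard"
    using m(1) keys independent_subset unfolding standard_def by blast
  ultimately show ?thesis by blast
qed

lemma star_sum_times:
  assumes "j < r"
  shows "star_sum j * Poly_Mapping.single m 1 =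
    (\<Sum>w\<in>insert (c j) (nbrs j). Poly_Mapping.single (Poly_Mapping.single w 1 + m) 1)"
  using assms by (simp add: star_sum_def sum_distrib_right indet_def mult_single)

lemma finite_closed_nbrs: "finite (insert (c j) (nbrs j))"
  using finite_subset[OF nbrs_verts finite_verts] by simp

lemma star_sum_leading:
  assumes "j < r"
  shows "Poly_Mapping.lookup (star_sum j * Poly_Mapping.single m 1) (shift j m) = 1"
proof -
  have eq: "Poly_Mapping.single w (1::nat) + m = shift j m \<longleftrightarrow> w = pivot j m" for w
  proof
    assume "Poly_Mapping.single w (1::nat) + m = shift j m"
    then have "Poly_Mapping.single w (1::nat) = Poly_Mapping.single (pivot j m) 1" by (simp add: shift_def)
    then have "Poly_Mapping.keys (Poly_Mapping.single w (1::nat)) = Poly_Mapping.keys (Poly_Mapping.single (pivot j m) (1::nat))"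
      by (rule arg_cong)
    then show "w = pivot j m" by simp
  qed (simp add: shift_def)
  have "Poly_Mapping.lookup (star_sum j * Poly_Mapping.single m 1) (shift j m) =
      (\<Sum>w\<in>insert (c j) (nbrs j). if w = pivot j m then 1 else 0)"
    unfolding star_sum_times[OF assms] lookup_sum lookup_single when_def eq ..
  also have "\<dots> = 1"
    using pivot_vertex_closed_nbr[of j "core m"] finite_closed_nbrs[of j] by (simp only: sum.delta if_True)
  finally show ?thesis .
qed

text \<open>The vertex \<open>w\<close> that is added to \<open>m\<close> is the pivot, or another vertex of the core, or a new vertex
of the core, or a centre. The last case does not occur: the only centre in the closed neighbourhood
is \<open>c\<^sub>j\<close>, and if it is not the pivot then it has a neighbour in \<open>m\<close>, so that
the product lies in \<open>I\<close>.\<close>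

lemma star_sum_lower:
  assumes j: "j < r" and m: "m \<in> standard" and m': "m' \<in> standard"
    "m' \<in> Poly_Mapping.keys (star_sum j * Poly_Mapping.single m 1)"
  shows "m' = shift j m \<or> weight m' < weight (shift j m)"
proof -
  obtain w where w: "w \<in> insert (c j) (nbrs j)" "m' = Poly_Mapping.single w 1 + m"
    using m'(2) keys_sum[of "\<lambda>w. Poly_Mapping.single (Poly_Mapping.single w 1 + m) (1::'k)" "insert (c j) (nbrs j)"]
    unfolding star_sum_times[OF j] by (auto split: if_splits)
  have keys: "Poly_Mapping.keys m' = insert w (Poly_Mapping.keys m)" unfolding w(2) by (simp add: keys_monomial_add)
  have cs: "core (shift j m) = core m" by (rule core_shift[OF j])
  consider "w = pivot j m" | "w \<noteq> pivot j m" "w \<in> core m" | "w \<notin> core m" "w \<notin> centers"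
    | "w \<noteq> pivot j m" "w \<in> centers" by blast
  then show ?thesis
  proof cases
    case 1
    then show ?thesis using w(2) by (simp add: shift_def)
  next
    case 2
    have core': "core m' = core m" using keys 2(2) by (auto simp: core_def)
    have "Poly_Mapping.lookup m' (pivot k m) = Poly_Mapping.lookup m (pivot k m)" if "k < r" for k
    proof -
      have "w \<noteq> pivot k m"
        using closed_nbrs_disjoint[OF j that w(1)] pivot_vertex_closed_nbr[of k "core m"] 2(1) by metis
      then show ?thesis by (simp add: w(2) lookup_add lookup_single)
    qed
    then have mu': "(\<Sum>k<r. Poly_Mapping.lookup m' (pivot k m)) = (\<Sum>k<r. Poly_Mapping.lookup m (pivot k m))"
      by (intro sum.cong) auto
    have "(\<Sum>k<r. Poly_Mapping.lookup m (pivot k m)) < (\<Sum>k<r. Poly_Mapping.lookup (shift j m) (pivot k m))"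
    proof (rule sum_strict_mono_ex1)
      show "\<exists>k\<in>{..<r}. Poly_Mapping.lookup m (pivot k m) < Poly_Mapping.lookup (shift j m) (pivot k m)"
        by (rule bexI[of _ j]) (simp_all add: shift_def lookup_add j)
    qed (auto simp: shift_def lookup_add)
    then show ?thesis by (simp add: weight_def core' cs mu' less_prod_def)
  next
    case 3
    then have core': "core m' = insert w (core m)" using keys by (auto simp: core_def)
    have fin: "finite (core m)" by (simp add: core_def)
    have "card (core m') \<le> card (verts G)"
      using m'(1) finite_verts by (intro card_mono) (auto simp: core_def standard_def)
    then have "card (verts G) - card (core m') < card (verts G) - card (core m)"
      using core' 3(1) fin by simp
    then show ?thesis by (simp add: weight_def cs less_prod_def)
  next
    case 4
    then obtain k where k: "k < r" "w = c k" unfolding centers_def by blast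
    then have "w = c j" using closed_nbrs_disjoint[OF j k(1) w(1)] by blast
    then have "pivot j m \<noteq> c j" using 4(1) by simp
    then have "pivot j m \<in> core m \<inter> nbrs j" using pivot_vertex_cases[of "core m" j] by simp
    then obtain u where u: "u \<in> Poly_Mapping.keys m" "{c j, u} \<in> edges G"
      unfolding core_def nbrs_def by blast
    have "\<not> independent G (Poly_Mapping.keys m')"
      unfolding keys \<open>w = c j\<close> independent_def using u by blast
    then show ?thesis using m'(1) unfolding standard_def by blast
  qed
qed

lemma star_sum_S: "star_sum j \<in> S"
proof -
  have "indet w \<in> S" if "j < r" "w \<in> insert (c j) (nbrs j)" for w
    using that nbrs_verts[of j] center_in_verts[of j] unfolding indet_def by (intro mpoly_ring_single) auto
  then show ?thesis unfolding star_sum_def by (auto intro!: mpoly_ring_sum simp: mpoly_ring_zero)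
qed

lemma star_sums_triangular: "triangular_sequence (verts G) I star_sum standard shift weight r"
proof unfold_locales
  show "star_sum i \<in> S" for i by (rule star_sum_S)
  show "p \<in> I \<longleftrightarrow> p \<in> S \<and> Poly_Mapping.keys p \<inter> standard = {}" for p
    unfolding mem_I_iff standard_def by (auto simp: carrier_mpoly_ring)
  show "m \<in> standard \<Longrightarrow> Poly_Mapping.keys m \<subseteq> verts G" for m by (simp add: standard_def)
  show "Poly_Mapping.lookup (star_sum j * Poly_Mapping.single m 1) (shift j m) = 1" if "j < r" for j m
    using that by (rule star_sum_leading)
qed (fact shift_standard shift_injective shift_image star_sum_lower)+

lemma star_sum_graded_max_ideal: "j < r \<Longrightarrow> star_sum j \<in> graded_max_ideal (verts G)"
proof -
  assume j: "j < r"
  have gens: "(indet ` verts G :: ('v, 'k) mpoly set) \<subseteq> S"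
    unfolding indet_def by (intro image_subsetI mpoly_ring_single) simp
  interpret J: mpoly_quotient "verts G" "graded_max_ideal (verts G) :: ('v, 'k) mpoly set"
    by (rule mpoly_quotient.intro) (unfold graded_max_ideal_def, rule R.genideal_ideal[OF gens])
  have "(indet w :: ('v, 'k) mpoly) \<in> graded_max_ideal (verts G)" if "w \<in> insert (c j) (nbrs j)" for w
    using R.genideal_self[OF gens] that nbrs_verts[of j] center_in_verts[OF j]
    unfolding graded_max_ideal_def by blast
  then have "(\<Sum>w\<in>insert (c j) (nbrs j). indet w :: ('v, 'k) mpoly) \<in> graded_max_ideal (verts G)"
    by (rule J.sum_in_above[OF J.above_I])
  then show ?thesis using j by (simp only: star_sum_def if_True)
qed

theorem packing_number_le_depth: "enat r \<le> depth (verts G) M"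
proof -
  define fs where "fs = map star_sum [0..<r]"
  have seq_fun: "seq_fun fs = star_sum"
    by (rule ext) (simp add: seq_fun_def fs_def star_sum_def)
  interpret T: triangular_sequence "verts G" I star_sum standard shift weight r
    by (rule star_sums_triangular)
  have max: "set fs \<subseteq> graded_max_ideal (verts G)"
    unfolding fs_def using star_sum_graded_max_ideal by auto
  have const: "Poly_Mapping.lookup (star_sum i) 0 = 0" for i
  proof (cases "i < r")
    case True
    then show ?thesis using star_sum_graded_max_ideal graded_max_ideal_subset by blast
  qed (simp add: star_sum_def)
  have "1 \<notin> T.partial_ideal r"
    using adic_degree[OF T.ring_sequence_axioms const, of 1 r 1 0]
    by (auto simp: total_degree_def independent_def)
  then have "regular_sequence R M fs"
    unfolding regular_sequence_iff seq_fun
    using T.triangular_regular star_sum_S one_S by (auto simp: fs_def)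
  then show ?thesis
    unfolding depth_def by (intro Sup_upper CollectI exI[of _ fs] conjI max) (simp_all add: fs_def)
qed

end

section \<open>Stanley depth and packings of closed neighbourhoods\<close>

context packing
begin

definition cells :: "'v set set" where
  "cells = {W. W \<subseteq> verts G - centers \<and> independent G W}"

text \<open>The independent sets whose members outside the centres form \<open>W\<close> are those between \<open>W\<close> and this set.
So the cells partition the independence complex into intervals.\<close>

definition free_vars :: "'v set \<Rightarrow> 'v set" where
  "free_vars W = W \<union> {c j | j. j < r \<and> nbrs j \<inter> W = {}}"

definition cell_monomials :: "'v set \<Rightarrow> ('v \<Rightarrow>\<^sub>0 nat) set" where
  "cell_monomials W = {m \<in> standard. core m = W}"

lemma finite_cells: "finite cells"
  unfolding cells_def by (rule finite_subset[of _ "Pow (verts G)"]) (use finite_verts in auto)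

lemma cell_finite: "W \<in> cells \<Longrightarrow> finite W"
  unfolding cells_def using finite_subset[OF _ finite_verts] by blast

lemma free_vars_verts: "W \<in> cells \<Longrightarrow> free_vars W \<subseteq> verts G"
  unfolding cells_def free_vars_def using center_in_verts by blast

lemma free_vars_core: "W \<in> cells \<Longrightarrow> free_vars W - centers = W"
  unfolding cells_def free_vars_def centers_def by blast

lemma free_vars_independent:
  assumes "W \<in> cells"
  shows "independent G (free_vars W)"
  unfolding independent_def
proof (intro ballI)
  have W: "independent G W" "W \<subseteq> verts G - centers" using assms unfolding cells_def by blast+
  have no: "{c j, v} \<notin> edges G" if "j < r" "nbrs j \<inter> W = {}" "v \<in> free_vars W" for j v
  proof
    assume "{c j, v} \<in> edges G"
    then have v: "v \<in> nbrs j" by (simp add: nbrs_def)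
    then have "v \<notin> W" using that(2) by blast
    then have "v \<in> centers" using that(3) unfolding free_vars_def centers_def by blast
    then show False using nbrs_no_center[OF that(1)] v by blast
  qed
  fix u v assume uv: "u \<in> free_vars W" "v \<in> free_vars W"
  consider "u \<in> W" "v \<in> W" | j where "j < r" "nbrs j \<inter> W = {}" "u = c j"
    | j where "j < r" "nbrs j \<inter> W = {}" "v = c j"
    using uv unfolding free_vars_def by blast
  then show "{u, v} \<notin> edges G"
  proof cases
    case 1
    then show ?thesis using W(1) unfolding independent_def by blast
  next
    case 2
    then show ?thesis using no uv(2) by blast
  next
    case (3 j)
    then show ?thesis using no[of j u] uv(1) by (simp add: insert_commute)
  qed
qed

lemma cell_monomials_iff:
  assumes W: "W \<in> cells"
  shows "m \<in> cell_monomials W \<longleftrightarrow> W \<subseteq> Poly_Mapping.keys m \<and> Poly_Mapping.keys m \<subseteq> free_vars W"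
proof
  assume "m \<in> cell_monomials W"
  then have m: "independent G (Poly_Mapping.keys m)" "Poly_Mapping.keys m - centers = W"
    unfolding cell_monomials_def standard_def core_def by blast+
  have "v \<in> free_vars W" if v: "v \<in> Poly_Mapping.keys m" for v
  proof (cases "v \<in> centers")
    case True
    then obtain j where j: "j < r" "v = c j" unfolding centers_def by blast
    have "nbrs j \<inter> W = {}"
      using m v unfolding nbrs_def independent_def j(2) by blast
    then show ?thesis unfolding free_vars_def using j by blast
  next
    case False
    then show ?thesis using m(2) v unfolding free_vars_def by blast
  qed
  then show "W \<subseteq> Poly_Mapping.keys m \<and> Poly_Mapping.keys m \<subseteq> free_vars W" using m(2) by blast
next
  assume m: "W \<subseteq> Poly_Mapping.keys m \<and> Poly_Mapping.keys m \<subseteq> free_vars W"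
  have "W \<inter> centers = {}" using W unfolding cells_def by blast
  then have "Poly_Mapping.keys m - centers = W" using m free_vars_core[OF W] by blast
  moreover have "independent G (Poly_Mapping.keys m)"
    by (rule independent_subset[OF free_vars_independent[OF W]]) (use m in blast)
  ultimately show "m \<in> cell_monomials W"
    unfolding cell_monomials_def standard_def core_def using m free_vars_verts[OF W] by blast
qed

lemma core_cell: "m \<in> standard \<Longrightarrow> core m \<in> cells"
  unfolding standard_def cells_def core_def using independent_subset by blast

definition cell_generator :: "'v set \<Rightarrow> ('v, 'k) mpoly" where
  "cell_generator W = Poly_Mapping.single (squarefree_monomial W) 1"

lemma cell_generator_S: "W \<in> cells \<Longrightarrow> cell_generator W \<in> S"
  unfolding cell_generator_def
  by (rule mpoly_ring_single) (auto simp: keys_squarefree_monomial cell_finite cells_def)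

lemma times_cell_generator:
  assumes W: "W \<in> cells" and f: "f \<in> carrier (mpoly_ring (free_vars W))"
  shows "Poly_Mapping.keys (f * cell_generator W) \<subseteq> cell_monomials W"
proof
  fix k assume k: "k \<in> Poly_Mapping.keys (f * cell_generator W)"
  obtain m where m: "m \<in> Poly_Mapping.keys f" "k = squarefree_monomial W + m"
    by (rule keys_times_monomial[of k "squarefree_monomial W" 1 f])
      (use k in \<open>simp add: cell_generator_def mult.commute\<close>)
  have "Poly_Mapping.keys m \<subseteq> free_vars W" using f m(1) by (auto simp: carrier_mpoly_ring)
  then show "k \<in> cell_monomials W"
    unfolding cell_monomials_iff[OF W] m(2) keys_monomial_add keys_squarefree_monomial[OF cell_finite[OF W]]
    by (auto simp: free_vars_def)
qed

lemma cell_generator_divides: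
  assumes W: "W \<in> cells" and q: "Poly_Mapping.keys q \<subseteq> cell_monomials W"
  obtains f where "f \<in> carrier (mpoly_ring (free_vars W))" "q = f * cell_generator W"
proof
  let ?e = "squarefree_monomial W"
  let ?f = "\<Sum>m\<in>Poly_Mapping.keys q. Poly_Mapping.single (m - ?e) (Poly_Mapping.lookup q m)"
  have keys: "W \<subseteq> Poly_Mapping.keys m" "Poly_Mapping.keys m \<subseteq> free_vars W" if "m \<in> Poly_Mapping.keys q" for m
    using q that cell_monomials_iff[OF W] by blast+
  have sub: "Poly_Mapping.keys (m - ?e) \<subseteq> Poly_Mapping.keys m" for m
    by (auto simp: in_keys_iff lookup_minus)
  show "?f \<in> carrier (mpoly_ring (free_vars W))"
    by (intro mpoly_ring_sum mpoly_ring_single) (use keys(2) sub in blast)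
  have "m - ?e + ?e = m" if m: "m \<in> Poly_Mapping.keys q" for m
  proof (rule poly_mapping_eqI)
    fix v
    show "Poly_Mapping.lookup (m - ?e + ?e) v = Poly_Mapping.lookup m v"
      using keys(1)[OF m] by (auto simp: lookup_add lookup_minus lookup_squarefree_monomial cell_finite[OF W] in_keys_iff subset_iff)
  qed
  then have "?f * cell_generator W = (\<Sum>m\<in>Poly_Mapping.keys q. Poly_Mapping.single m (Poly_Mapping.lookup q m))"
    unfolding cell_generator_def sum_distrib_right by (intro sum.cong) (simp_all add: mult_single)
  then show "q = ?f * cell_generator W" by (simp only: poly_expansion[symmetric])
qed

lemma cell_monomials_S: "Poly_Mapping.keys q \<subseteq> cell_monomials W \<Longrightarrow> q \<in> S"
  by (auto simp: carrier_mpoly_ring cell_monomials_def standard_def)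

lemma stanley_space_cell:
  assumes W: "W \<in> cells"
  shows "stanley_space M (cls (cell_generator W)) (free_vars W) =
    cls ` {q. Poly_Mapping.keys q \<subseteq> cell_monomials W}"
proof -
  have smult: "f \<odot>\<^bsub>M\<^esub> cls (cell_generator W) = cls (f * cell_generator W)"
    if "f \<in> carrier (mpoly_ring (free_vars W))" for f
  proof (rule smult_cls[OF _ cell_generator_S[OF W]])
    show "f \<in> S" using that free_vars_verts[OF W] by (auto simp: carrier_mpoly_ring)
  qed
  show ?thesis unfolding stanley_space_def
  proof (intro equalityI subsetI)
    fix x assume "x \<in> (\<lambda>f. f \<odot>\<^bsub>M\<^esub> cls (cell_generator W)) ` carrier (mpoly_ring (free_vars W))"
    then obtain f where f: "f \<in> carrier (mpoly_ring (free_vars W))" "x = f \<odot>\<^bsub>M\<^esub> cls (cell_generator W)"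
      by blast
    then show "x \<in> cls ` {q. Poly_Mapping.keys q \<subseteq> cell_monomials W}"
      using smult[OF f(1)] times_cell_generator[OF W f(1)] by blast
  next
    fix x assume "x \<in> cls ` {q. Poly_Mapping.keys q \<subseteq> cell_monomials W}"
    then obtain q where q: "Poly_Mapping.keys q \<subseteq> cell_monomials W" "x = cls q" by blast
    obtain f where f: "f \<in> carrier (mpoly_ring (free_vars W))" "q = f * cell_generator W"
      by (rule cell_generator_divides[OF W q(1)])
    show "x \<in> (\<lambda>f. f \<odot>\<^bsub>M\<^esub> cls (cell_generator W)) ` carrier (mpoly_ring (free_vars W))"
      by (rule image_eqI[of _ _ f]) (use f smult[OF f(1)] q(2) in simp_all)
  qed
qed

lemma cell_free:
  assumes W: "W \<in> cells" and f: "f \<in> carrier (mpoly_ring (free_vars W))"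
    and zero: "f \<odot>\<^bsub>M\<^esub> cls (cell_generator W) = \<zero>\<^bsub>M\<^esub>"
  shows "f = 0"
proof (rule poly_mapping_eqI)
  fix m
  have fS: "f \<in> S" using f free_vars_verts[OF W] by (auto simp: carrier_mpoly_ring)
  have "f * cell_generator W \<in> I"
    using zero smult_cls[OF fS cell_generator_S[OF W]] cls_eq_zero_iff mult_S[OF fS cell_generator_S[OF W]]
    by simp
  then have "Poly_Mapping.keys (f * cell_generator W) = {}"
    using times_cell_generator[OF W f] unfolding mem_I_iff cell_monomials_def standard_def by blast
  then have "Poly_Mapping.lookup (cell_generator W * f) (squarefree_monomial W + m) = 0"
    by (simp add: mult.commute)
  then show "Poly_Mapping.lookup f m = Poly_Mapping.lookup 0 m"
    unfolding cell_generator_def lookup_single_times by simp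
qed

text \<open>The pivots for the different \<open>j\<close> are different free variables.\<close>

lemma card_free_vars: "W \<in> cells \<Longrightarrow> r \<le> card (free_vars W)"
proof -
  assume W: "W \<in> cells"
  have "inj_on (\<lambda>j. pivot_vertex j W) {..<r}"
    by (rule inj_onI) (use pivot_vertex_inj in blast)
  moreover have "pivot_vertex j W \<in> free_vars W" if "j < r" for j
    using pivot_vertex_cases[of W j] that unfolding free_vars_def by auto
  moreover have "finite (free_vars W)" using free_vars_verts[OF W] finite_verts finite_subset by blast
  ultimately have "card {..<r} \<le> card (free_vars W)" by (intro card_inj_on_le) auto
  then show ?thesis by simp
qed

text \<open>The monomials outside \<open>I\<close> are distributed over the cells, so a residue class determines the part of
its representatives in each cell.\<close>

lemma cell_components_unique:
  assumes p: "p \<in> S" and q: "\<And>W. W \<in> cells \<Longrightarrow> Poly_Mapping.keys (q W) \<subseteq> cell_monomials W"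
  shows "cls p = cls (\<Sum>W\<in>cells. q W) \<longleftrightarrow> (\<forall>W\<in>cells. q W = restrict_keys (cell_monomials W) p)"
proof -
  have look: "Poly_Mapping.lookup (\<Sum>W\<in>cells. q W) m = Poly_Mapping.lookup (q (core m)) m"
    if m: "m \<in> standard" for m
  proof -
    have "Poly_Mapping.lookup (q W) m = (if W = core m then Poly_Mapping.lookup (q (core m)) m else 0)"
      if "W \<in> cells" for W
      using q[OF that] by (auto simp: cell_monomials_def in_keys_iff)
    then have "Poly_Mapping.lookup (\<Sum>W\<in>cells. q W) m =
        (\<Sum>W\<in>cells. if W = core m then Poly_Mapping.lookup (q (core m)) m else 0)"
      unfolding lookup_sum by (intro sum.cong) auto
    then show ?thesis using core_cell[OF m] finite_cells by (simp add: sum.delta)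
  qed
  have sum_S: "(\<Sum>W\<in>cells. q W) \<in> S"
    by (rule mpoly_ring_sum) (rule cell_monomials_S[OF q])
  have "cls p = cls (\<Sum>W\<in>cells. q W) \<longleftrightarrow> p - (\<Sum>W\<in>cells. q W) \<in> I"
    by (rule cls_eq_iff[OF p sum_S])
  also have "\<dots> \<longleftrightarrow> (\<forall>m\<in>standard. Poly_Mapping.lookup p m = Poly_Mapping.lookup (q (core m)) m)"
  proof -
    have d: "p - (\<Sum>W\<in>cells. q W) \<in> S" using p sum_S by (rule diff_S)
    then have "p - (\<Sum>W\<in>cells. q W) \<in> I \<longleftrightarrow>
        (\<forall>m\<in>standard. Poly_Mapping.lookup (p - (\<Sum>W\<in>cells. q W)) m = 0)"
      unfolding mem_I_iff standard_def by (auto simp: carrier_mpoly_ring in_keys_iff simp del: lookup_minus)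
    also have "\<dots> \<longleftrightarrow> (\<forall>m\<in>standard. Poly_Mapping.lookup p m = Poly_Mapping.lookup (q (core m)) m)"
      by (intro ball_cong) (simp_all add: lookup_minus look)
    finally show ?thesis .
  qed
  also have "\<dots> \<longleftrightarrow> (\<forall>W\<in>cells. q W = restrict_keys (cell_monomials W) p)"
  proof
    assume eq: "\<forall>m\<in>standard. Poly_Mapping.lookup p m = Poly_Mapping.lookup (q (core m)) m"
    show "\<forall>W\<in>cells. q W = restrict_keys (cell_monomials W) p"
    proof (intro ballI poly_mapping_eqI)
      fix W m assume W: "W \<in> cells"
      show "Poly_Mapping.lookup (q W) m = Poly_Mapping.lookup (restrict_keys (cell_monomials W) p) m"
      proof (cases "m \<in> cell_monomials W")
        case True
        then show ?thesis using eq by (simp add: cell_monomials_def)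
      next
        case False
        then have "m \<notin> Poly_Mapping.keys (q W)" using q[OF W] by blast
        then show ?thesis using False by (simp add: in_keys_iff)
      qed
    qed
  next
    assume "\<forall>W\<in>cells. q W = restrict_keys (cell_monomials W) p"
    then show "\<forall>m\<in>standard. Poly_Mapping.lookup p m = Poly_Mapping.lookup (q (core m)) m"
      using core_cell by (auto simp: cell_monomials_def)
  qed
  finally show ?thesis .
qed

lemma sum_over_list:
  assumes "distinct xs"
  shows "(\<Sum>i<length xs. h (xs ! i)) = (\<Sum>x\<in>set xs. h x)"
  by (rule sum.reindex_bij_betw) (use bij_betw_nth[OF assms] in \<open>simp add: atLeast0LessThan\<close>)

lemma cell_stanley_decomposition:
  assumes xs: "distinct xs" "set xs = cells"
  shows "stanley_decomposition (verts G) (quotient_grading (verts G) I) M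
    (map (\<lambda>W. (cls (cell_generator W), free_vars W)) xs)"
  unfolding stanley_decomposition_def
proof (intro conjI ballI)
  let ?D = "map (\<lambda>W. (cls (cell_generator W), free_vars W)) xs"
  fix x assume "x \<in> set ?D"
  then obtain W where W: "W \<in> cells" "x = (cls (cell_generator W), free_vars W)" using xs(2) by auto
  let ?a = "\<lambda>v. int (Poly_Mapping.lookup (squarefree_monomial W) v)"
  have "cell_generator W \<in> mpoly_component (verts G) ?a"
    using cell_generator_S[OF W(1)] unfolding mpoly_component_def by (simp add: cell_generator_def)
  then have "cls (cell_generator W) \<in> quotient_grading (verts G) I ?a"
    unfolding quotient_grading_def by blast
  then have "\<exists>a. cls (cell_generator W) \<in> quotient_grading (verts G) I a" by (rule exI[of _ ?a])
  moreover have "cls (cell_generator W) \<in> carrier M" by (rule cls_in_M[OF cell_generator_S[OF W(1)]])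
  ultimately show "case x of (w, A) \<Rightarrow> w \<in> carrier M \<and> (\<exists>a. w \<in> quotient_grading (verts G) I a) \<and>
      A \<subseteq> verts G \<and> (\<forall>f\<in>carrier (mpoly_ring A). f \<odot>\<^bsub>M\<^esub> w = \<zero>\<^bsub>M\<^esub> \<longrightarrow> f = 0)"
    unfolding W(2) prod.case using free_vars_verts[OF W(1)] cell_free[OF W(1)] by blast
next
  let ?D = "map (\<lambda>W. (cls (cell_generator W), free_vars W)) xs"
  let ?n = "length ?D"
  let ?space = "\<lambda>i. stanley_space M (fst (?D ! i)) (snd (?D ! i))"
  fix x assume "x \<in> carrier M"
  then obtain p where p: "p \<in> S" "x = cls p" by (auto simp: carrier_M)
  have cell: "xs ! i \<in> cells" if "i < ?n" for i using xs(2) that by (metis length_map nth_mem)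
  have space: "?space i = cls ` {q. Poly_Mapping.keys q \<subseteq> cell_monomials (xs ! i)}" if "i < ?n" for i
    using stanley_space_cell[OF cell[OF that]] that by simp
  have finsum: "finsum M y {..<?n} = cls (\<Sum>W\<in>cells. q W)"
    if y: "\<And>i. i < ?n \<Longrightarrow> y i = cls (q (xs ! i))"
      and q: "\<And>W. W \<in> cells \<Longrightarrow> Poly_Mapping.keys (q W) \<subseteq> cell_monomials W" for y q
  proof -
    have qS: "q (xs ! i) \<in> S" if "i < ?n" for i by (rule cell_monomials_S[OF q[OF cell[OF that]]])
    have "finsum M y {..<?n} = finsum M (\<lambda>i. cls (q (xs ! i))) {..<?n}"
      by (rule M.finsum_cong') (use y qS cls_in_M in auto)
    also have "\<dots> = cls (\<Sum>i<?n. q (xs ! i))" by (rule finsum_cls) (use qS in auto)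
    also have "(\<Sum>i<?n. q (xs ! i)) = (\<Sum>W\<in>cells. q W)"
      using sum_over_list[OF xs(1), of q] xs(2) by simp
    finally show ?thesis .
  qed
  let ?q = "\<lambda>W. restrict_keys (cell_monomials W) p"
  let ?y = "restrict (\<lambda>i. cls (?q (xs ! i))) {..<?n}"
  have q_keys: "Poly_Mapping.keys (?q W) \<subseteq> cell_monomials W" for W by (simp add: keys_restrict_keys)
  have "?y i \<in> ?space i" if "i < ?n" for i
    unfolding space[OF that] using that q_keys by auto
  then have y_space: "?y \<in> (\<Pi>\<^sub>E i\<in>{..<?n}. ?space i)" by (intro PiE_I) auto
  show "\<exists>!y. y \<in> (\<Pi>\<^sub>E i\<in>{..<?n}. ?space i) \<and> x = finsum M y {..<?n}"
  proof (rule ex1I[of _ ?y])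
    have "finsum M ?y {..<?n} = cls (\<Sum>W\<in>cells. ?q W)"
      by (rule finsum) (use q_keys in auto)
    moreover have "cls p = cls (\<Sum>W\<in>cells. ?q W)"
      using cell_components_unique[OF p(1), of ?q] q_keys by blast
    ultimately show "?y \<in> (\<Pi>\<^sub>E i\<in>{..<?n}. ?space i) \<and> x = finsum M ?y {..<?n}"
      using p(2) y_space by simp
  next
    fix y assume y: "y \<in> (\<Pi>\<^sub>E i\<in>{..<?n}. ?space i) \<and> x = finsum M y {..<?n}"
    have "\<exists>q. Poly_Mapping.keys q \<subseteq> cell_monomials W \<and> (\<forall>i<?n. xs ! i = W \<longrightarrow> y i = cls q)"
      if "W \<in> cells" for W
    proof -
      obtain i where i: "i < ?n" "xs ! i = W" using \<open>W \<in> cells\<close> xs(2) by (metis in_set_conv_nth length_map)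
      have "y i \<in> ?space i" by (rule PiE_mem[OF conjunct1[OF y]]) (use i(1) in simp)
      then obtain q where q: "Poly_Mapping.keys q \<subseteq> cell_monomials W" "y i = cls q"
        unfolding space[OF i(1)] i(2) by blast
      have "i' = i" if "i' < ?n" "xs ! i' = W" for i'
        using nth_eq_iff_index_eq[OF xs(1), of i' i] that i by simp
      then show ?thesis using q by blast
    qed
    then have "\<forall>W\<in>cells. \<exists>q. Poly_Mapping.keys q \<subseteq> cell_monomials W \<and> (\<forall>i<?n. xs ! i = W \<longrightarrow> y i = cls q)"
      by blast
    from bchoice[OF this] obtain q where "\<forall>W\<in>cells. Poly_Mapping.keys (q W) \<subseteq> cell_monomials W \<and>
        (\<forall>i<?n. xs ! i = W \<longrightarrow> y i = cls (q W))" ..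
    then have q: "\<And>W. W \<in> cells \<Longrightarrow> Poly_Mapping.keys (q W) \<subseteq> cell_monomials W"
      "\<And>W i. W \<in> cells \<Longrightarrow> i < ?n \<Longrightarrow> xs ! i = W \<Longrightarrow> y i = cls (q W)" by blast+
    have yq: "y i = cls (q (xs ! i))" if "i < ?n" for i using q(2)[OF cell[OF that] that refl] .
    have "cls p = cls (\<Sum>W\<in>cells. q W)" 
      unfolding p(2)[symmetric] conjunct2[OF y] by (rule finsum[OF yq q(1)])
    then have eq: "\<forall>W\<in>cells. q W = ?q W" using cell_components_unique[OF p(1), of q] q(1) by blast
    show "y = ?y"
    proof (rule PiE_ext[of y "{..<?n}" ?space])
      show "?y \<in> (\<Pi>\<^sub>E i\<in>{..<?n}. ?space i)" by (rule y_space)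
      fix i assume "i \<in> {..<?n}"
      then have i: "i < ?n" by simp
      then show "y i = ?y i" using yq[OF i] eq cell[OF i] by simp
    qed (use y in blast)
  qed
qed

theorem packing_number_le_sdepth: "enat r \<le> sdepth (verts G) (quotient_grading (verts G) I) M"
proof -
  obtain xs where xs: "set xs = cells" "distinct xs"
    using finite_distinct_list[OF finite_cells] by blast
  let ?D = "map (\<lambda>W. (cls (cell_generator W), free_vars W)) xs"
  have "enat r \<le> sdepth_of ?D"
    unfolding sdepth_of_def using xs(1) card_free_vars by (intro INF_greatest) auto
  also have "\<dots> \<le> sdepth (verts G) (quotient_grading (verts G) I) M"
    unfolding sdepth_def using cell_stanley_decomposition[OF xs(2,1)] by (intro Sup_upper) blast
  finally show ?thesis .
qed

end

section \<open>The strong product of two paths\<close>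

lemma strong_product_edge_iff:
  "{(v1, u1), (v2, u2)} \<in> edges (G \<boxtimes> H) \<longleftrightarrow>
     v1 \<in> verts G \<and> v2 \<in> verts G \<and> u1 \<in> verts H \<and> u2 \<in> verts H \<and> (v1, u1) \<noteq> (v2, u2) \<and>
     (v1 = v2 \<or> {v1, v2} \<in> edges G) \<and> (u1 = u2 \<or> {u1, u2} \<in> edges H)"
  (is "_ \<longleftrightarrow> ?adj v1 u1 v2 u2")
proof
  assume "{(v1, u1), (v2, u2)} \<in> edges (G \<boxtimes> H)"
  then obtain a b c d where abcd: "{(v1, u1), (v2, u2)} = {(a, b), (c, d)}" "?adj a b c d"
    unfolding strong_product_def graph.simps by blast
  then consider "v1 = a" "u1 = b" "v2 = c" "u2 = d" | "v1 = c" "u1 = d" "v2 = a" "u2 = b"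
    by (auto simp: doubleton_eq_iff)
  then show "?adj v1 u1 v2 u2"
  proof cases
    case 1
    then show ?thesis using abcd(2) by simp
  next
    case 2
    then show ?thesis using abcd(2) by (auto simp: insert_commute)
  qed
next
  assume "?adj v1 u1 v2 u2"
  then show "{(v1, u1), (v2, u2)} \<in> edges (G \<boxtimes> H)"
    unfolding strong_product_def graph.simps by blast
qed

lemma path_graph_edge_iff:
  "{a, b} \<in> edges (path_graph n) \<longleftrightarrow> a \<in> {1..n} \<and> b \<in> {1..n} \<and> (a = b + 1 \<or> b = a + 1)"
  unfolding path_graph_def by (auto simp: doubleton_eq_iff)

lemma strong_grid_edge_iff:
  "{(i, j), (k, l)} \<in> edges (strong_grid n 2) \<longleftrightarrow>
     i \<in> {1..n} \<and> k \<in> {1..n} \<and> j \<in> {1..2} \<and> l \<in> {1..2} \<and> (i, j) \<noteq> (k, l) \<and>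
     (i = k \<or> i = k + 1 \<or> k = i + 1)"
proof -
  have "verts (path_graph N) = {1..N}" for N by (simp add: path_graph_def)
  then show ?thesis
    unfolding strong_grid_def strong_product_edge_iff path_graph_edge_iff by auto
qed

lemma verts_strong_grid: "verts (strong_grid n 2) = {1..n} \<times> {1..2}"
  by (simp add: strong_grid_def strong_product_def path_graph_def)

lemma edge_ring_strong_grid:
  "edge_ring (strong_grid n 2) (edge_ideal (strong_grid n 2) :: (nat \<times> nat, 'k::field) mpoly set)"
proof
  show "finite (verts (strong_grid n 2))" by (simp add: verts_strong_grid)
  show "e \<subseteq> verts (strong_grid n 2)" if "e \<in> edges (strong_grid n 2)" for e
    using that by (rule strong_grid_edges)
  show "{v} \<notin> edges (strong_grid n 2)" for v
    using strong_grid_edge_iff[of "fst v" "snd v" "fst v" "snd v" n] by simp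
qed simp

lemma nat_ceiling_third: "nat \<lceil>real n / 3\<rceil> = (n + 2) div 3"
proof -
  have "\<lceil>real n / 3\<rceil> = int ((n + 2) div 3)"
  proof (rule ceiling_unique)
    have "3 * ((n + 2) div 3) < n + 3" "n \<le> 3 * ((n + 2) div 3)" by presburger+
    then have bounds: "real (3 * ((n + 2) div 3)) < real (n + 3)" "real n \<le> real (3 * ((n + 2) div 3))"
      unfolding of_nat_less_iff of_nat_le_iff by this+
    show "real_of_int (int ((n + 2) div 3)) - 1 < real n / 3" using bounds(1) by simp
    show "real n / 3 \<le> real_of_int (int ((n + 2) div 3))" using bounds(2) by simp
  qed
  then show ?thesis by simp
qed

text \<open>The closed neighbourhood of \<open>(3j + 1, 1)\<close> lies in the columns \<open>3j\<close>, \<open>3j + 1\<close> and \<open>3j + 2\<close>.\<close>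

lemma packing_strong_grid:
  "packing (strong_grid n 2) (edge_ideal (strong_grid n 2) :: (nat \<times> nat, 'k::field) mpoly set)
     (\<lambda>j. (3 * j + 1, 1)) ((n + 2) div 3)"
proof -
  interpret edge_ring "strong_grid n 2" "edge_ideal (strong_grid n 2) :: (nat \<times> nat, 'k) mpoly set"
    by (rule edge_ring_strong_grid)
  show ?thesis
  proof
    show "(3 * j + 1, 1) \<in> verts (strong_grid n 2)" if "j < (n + 2) div 3" for j
      unfolding verts_strong_grid using that by auto
    fix j k assume "j < (n + 2) div 3" "k < (n + 2) div 3" "j \<noteq> k"
    have near: "fst w \<le> 3 * i + 2 \<and> 3 * i \<le> fst w"
      if "w \<in> insert (3 * i + 1, 1) {w. {(3 * i + 1, 1), w} \<in> edges (strong_grid n 2)}" for i w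
      using that by (cases w) (auto simp: strong_grid_edge_iff)
    show "insert (3 * j + 1, 1) {w. {(3 * j + 1, 1), w} \<in> edges (strong_grid n 2)} \<inter>
        insert (3 * k + 1, 1) {w. {(3 * k + 1, 1), w} \<in> edges (strong_grid n 2)} = {}"
    proof (rule ccontr)
      assume "\<not> ?thesis"
      then obtain w where
        "w \<in> insert (3 * j + 1, 1) {w. {(3 * j + 1, 1), w} \<in> edges (strong_grid n 2)}"
        "w \<in> insert (3 * k + 1, 1) {w. {(3 * k + 1, 1), w} \<in> edges (strong_grid n 2)}" by blast
      from near[OF this(1)] near[OF this(2)] \<open>j \<noteq> k\<close> show False by linarith
    qed
  qed
qed

text \<open>Column \<open>3j + 2\<close> covers the columns \<open>3j + 1\<close> to \<open>3j + 3\<close>. If \<open>n\<close> is 1 modulo 3, the last of these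
columns would be \<open>n + 1\<close>; it is replaced by \<open>n\<close>, which is still not adjacent to the column \<open>n - 2\<close>
before it.\<close>

definition dominating_row :: "nat \<Rightarrow> (nat \<times> nat) set" where
  "dominating_row n = (\<lambda>j. (min (3 * j + 2) n, 1)) ` {..<(n + 2) div 3}"

lemma card_dominating_row: "card (dominating_row n) \<le> (n + 2) div 3"
  unfolding dominating_row_def using card_image_le[of "{..<(n + 2) div 3}"] by simp

lemma dominating_row_maximal_independent:
  "maximal_independent (strong_grid n 2) (dominating_row n)"
  unfolding maximal_independent_def
proof (intro conjI ballI)
  show "dominating_row n \<subseteq> verts (strong_grid n 2)"
    unfolding dominating_row_def verts_strong_grid by auto
  have "\<not> (min (3 * j + 2) n = min (3 * k + 2) n + 1)"
    if "j < (n + 2) div 3" "k < (n + 2) div 3" for j k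
    using that unfolding min_def by presburger
  then show "independent (strong_grid n 2) (dominating_row n)"
    unfolding independent_def dominating_row_def by (auto simp: strong_grid_edge_iff)
  fix v assume v: "v \<in> verts (strong_grid n 2) - dominating_row n"
  obtain a b where ab: "v = (a, b)" by (cases v)
  have a: "a \<in> {1..n}" "b \<in> {1..2}" using v ab by (auto simp: verts_strong_grid)
  \<comment> \<open>The columns \<open>3j + 1, 3j + 2, 3j + 3\<close> are dominated by the \<open>j\<close>-th vertex of the row.\<close>
  define j where "j = (a - 1) div 3"
  have j: "j < (n + 2) div 3" "3 * j + 1 \<le> a" "a \<le> 3 * j + 3" using a(1) unfolding j_def by auto
  let ?u = "(min (3 * j + 2) n, 1 :: nat)"
  have u: "?u \<in> dominating_row n" unfolding dominating_row_def using j(1) by blast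
  have "?u \<noteq> v" using u v by blast
  then have "{?u, v} \<in> edges (strong_grid n 2)"
    unfolding ab strong_grid_edge_iff using a j by (auto simp: min_def)
  then show "\<not> independent (strong_grid n 2) (insert v (dominating_row n))"
    unfolding independent_def using u by blast
qed

theorem lemma3p2:
  fixes n :: nat and I :: "(nat \<times> nat, 'k::field) mpoly set"
  assumes "n \<ge> 1"
    and "V = verts (strong_grid n 2)"
    and "I = edge_ideal (strong_grid n 2)"
    and "M = quotient_module (mpoly_ring V) I"
  shows "depth V M = sdepth V (quotient_grading V I) M \<and>
    sdepth V (quotient_grading V I) M = enat (nat \<lceil>real n / 3\<rceil>)"
proof -
  let ?r = "(n + 2) div 3"
  interpret packing "strong_grid n 2" I "\<lambda>j. (3 * j + 1, 1)" ?r
    unfolding assms(3) by (rule packing_strong_grid)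
  have "enat (card (dominating_row n)) \<le> enat ?r" using card_dominating_row by simp
  then have "depth V M \<le> enat ?r" "sdepth V (quotient_grading V I) M \<le> enat ?r"
    using depth_le_card_maximal_independent[OF dominating_row_maximal_independent]
      sdepth_le_card_maximal_independent[OF dominating_row_maximal_independent]
    unfolding assms(2,4) by (meson order_trans)+
  moreover have "enat ?r \<le> depth V M" "enat ?r \<le> sdepth V (quotient_grading V I) M"
    unfolding assms(2,4) by (rule packing_number_le_depth packing_number_le_sdepth)+
  ultimately show ?thesis unfolding nat_ceiling_third by simp
qed

end
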